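(* For each $k\in\{1,2,3,4,5\}$, the Krzyż conjecture holds if and only if, for every $n\ge3$ and every function $f(z)=\sum_{j\ge0}a_jz^j$ extremal for $M_n$ (with $N$ atoms), condition $(k)$ below holds: (1) there is $\theta\in(0,\frac{4\pi}{n})$ with $f(e^{i\theta}z)=f(z)$ for all $z\in\mathbb D$; (2) for a holomorphic branch $\log f$ of the logarithm of $f$ on $\mathbb D$, $\log f(z)=\log f(0)$ if and only if $z=0$; (3) $f'$ has no zeros in $\mathbb D\setminus\{0\}$; (4) $a_j=0$ for $1\le j\le N-1$; (5) $a_j=0$ for $1\le j\le\lceil\frac{n-2}{3}\rceil$.
   Context: $\mathbb D$ is the open unit disc; $\mathcal B_0=\{f$ holomorphic on $\mathbb D: 0<|f|\le1\}$; $M_n(f)=\mathrm{Re}\,a_n$ for $f=\sum a_jz^j$; $f\in\mathcal B_0$ is extremal for $M_n$ if $M_n(f)\ge M_n(F)$ for all $F\in\mathcal B_0$. Every extremal $f$ can be written as $f(z)=\gamma\exp\big(-\sum_{j=1}^N\lambda_j\frac{1+\alpha_jz}{1-\alpha_jz}\big)$ with $\gamma\in\partial\mathbb D$, $1\le N\le n$, $\lambda_j>0$, distinct $\alpha_j\in\partial\mathbb D$ ($N$ = number of atoms). The Krzyż conjecture is the statement: for every $n\in\mathbb N$ and every $f=\sum a_jz^j\in\mathcal B_0$ with $a_0>0$, $M_n(f)\le 2/e$, with equality only if $f=f_n$, where $f_n(z)=\exp\big(\frac{z^n-1}{z^n+1}\big)$. *)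

theory Defs
  imports "HOL-Complex_Analysis.Complex_Analysis"
begin

definition unit_disc :: "complex set" where
  "unit_disc = ball 0 1"

definition B0 :: "(complex \<Rightarrow> complex) set" where
  "B0 = {f. f holomorphic_on unit_disc \<and> (\<forall>z\<in>unit_disc. 0 < norm (f z) \<and> norm (f z) \<le> 1)}"

definition tcoeff :: "(complex \<Rightarrow> complex) \<Rightarrow> nat \<Rightarrow> complex" where
  "tcoeff f j = (deriv ^^ j) f 0 / of_nat (fact j)"

definition Mfun :: "nat \<Rightarrow> (complex \<Rightarrow> complex) \<Rightarrow> real" where
  "Mfun n f = Re (tcoeff f n)"

definition extremal :: "nat \<Rightarrow> (complex \<Rightarrow> complex) \<Rightarrow> bool" where
  "extremal n f \<longleftrightarrow> f \<in> B0 \<and> (\<forall>F\<in>B0. Mfun n F \<le> Mfun n f)"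

definition krzyz_fn :: "nat \<Rightarrow> complex \<Rightarrow> complex" where
  "krzyz_fn n z = exp ((z ^ n - 1) / (z ^ n + 1))"

definition krzyz_conjecture :: bool where
  "krzyz_conjecture \<longleftrightarrow>
     (\<forall>n::nat. n \<ge> 1 \<longrightarrow> (\<forall>f\<in>B0. tcoeff f 0 \<in> \<real> \<and> Re (tcoeff f 0) > 0 \<longrightarrow>
        Mfun n f \<le> 2 / exp 1 \<and>
        (Mfun n f = 2 / exp 1 \<longrightarrow> (\<forall>z\<in>unit_disc. f z = krzyz_fn n z))))"

definition has_atoms :: "(complex \<Rightarrow> complex) \<Rightarrow> nat \<Rightarrow> bool" where
  "has_atoms f N \<longleftrightarrow> 1 \<le> N \<and> (\<exists>(\<gamma>::complex) (lam::nat \<Rightarrow> real) (\<alpha>::nat \<Rightarrow> complex).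
     norm \<gamma> = 1 \<and> (\<forall>j<N. lam j > 0 \<and> norm (\<alpha> j) = 1) \<and> inj_on \<alpha> {..<N} \<and>
     (\<forall>z\<in>unit_disc. f z = \<gamma> * exp (- (\<Sum>j<N. of_real (lam j) * ((1 + \<alpha> j * z) / (1 - \<alpha> j * z))))))"

definition cond1 :: "nat \<Rightarrow> (complex \<Rightarrow> complex) \<Rightarrow> bool" where
  "cond1 n f \<longleftrightarrow> (\<exists>\<theta>::real. 0 < \<theta> \<and> \<theta> < 4 * pi / real n \<and>
      (\<forall>z\<in>unit_disc. f (exp (\<i> * of_real \<theta>) * z) = f z))"

definition cond2 :: "(complex \<Rightarrow> complex) \<Rightarrow> bool" where
  "cond2 f \<longleftrightarrow> (\<exists>g. g holomorphic_on unit_disc \<and> (\<forall>z\<in>unit_disc. exp (g z) = f z) \<and>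
      (\<forall>z\<in>unit_disc. g z = g 0 \<longleftrightarrow> z = 0))"

definition cond3 :: "(complex \<Rightarrow> complex) \<Rightarrow> bool" where
  "cond3 f \<longleftrightarrow> (\<forall>z\<in>unit_disc - {0}. deriv f z \<noteq> 0)"

definition cond4 :: "(complex \<Rightarrow> complex) \<Rightarrow> bool" where
  "cond4 f \<longleftrightarrow> (\<forall>N. has_atoms f N \<longrightarrow> (\<forall>j. 1 \<le> j \<and> j \<le> N - 1 \<longrightarrow> tcoeff f j = 0))"

definition cond5 :: "nat \<Rightarrow> (complex \<Rightarrow> complex) \<Rightarrow> bool" where
  "cond5 n f \<longleftrightarrow> (\<forall>j::nat. 1 \<le> j \<and> real j \<le> real_of_int (ceiling ((real n - 2) / 3)) \<longrightarrow> tcoeff f j = 0)"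

end

theory Submission
  imports Defs "HOL-Computational_Algebra.Fundamental_Theorem_Algebra"
begin

text \<open>
  Adding mass to \<open>p = - log f\<close> of an extremal \<open>f\<close> shows that a trigonometric polynomial \<open>T\<close> built from the
  coefficients of \<open>f\<close> is non-negative on the circle, and scaling \<open>p\<close> shows that \<open>T\<close> integrates to \<open>0\<close> against the
  representing measure of \<open>p\<close>; hence that measure has finitely many atoms \<open>\<alpha>\<^sub>j\<close>, with masses \<open>\<lambda>\<^sub>j\<close> of total \<open>l\<close>
  and moments \<open>\<mu>\<^sub>k\<close>.

  Suppose \<open>\<mu>\<^sub>1 = \<dots> = \<mu>\<^sub>J = 0\<close> with \<open>n \<le> 3 J + 2\<close>. Then \<open>a\<^sub>n\<close> is quadratic in the moments,
  \<open>a\<^sub>n = 2 exp (- l) (x + S)\<close> with \<open>x = - Re \<mu>\<^sub>n\<close> and \<open>S = Re (\<Sum> \<mu>\<^sub>i \<mu>\<^sub>n\<^sub>-\<^sub>i)\<close> over \<open>J < i < n - J\<close>. On this window the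
  powers \<open>\<alpha>\<^sup>i\<close> are orthogonal in \<open>L\<^sup>2\<close> of the measure, and Bessel's inequality for \<open>1 + \<alpha>\<^sup>n\<close>, together with
  stationarity under scaling and \<open>a\<^sub>n \<ge> 2/e\<close>, forces \<open>l = x = 1\<close> and \<open>S = 0\<close>, that is, \<open>f = f\<^sub>n\<close>. This settles
  condition (5), and \<open>n = 1, 2\<close> unconditionally because then \<open>J = 0\<close>.

  Condition (1) forces \<open>a\<^sub>j = 0\<close> for \<open>0 < j < n\<close>. Conditions (2) and (3) force the numerator of \<open>p - p(0)\<close>,
  respectively of \<open>p'\<close>, to be a monomial, hence (4). Under (4) the \<open>\<alpha>\<^sub>j\<close> are \<open>N\<close>-th roots of a common number,
  so \<open>f\<close> is a one-atom function of \<open>z\<^sup>N\<close> with \<open>N\<close> dividing \<open>n\<close>. If \<open>n \<le> 2 N\<close> this gives (5). Otherwise the one-atom function is extremal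
  for the index \<open>m = n / N \<ge> 3\<close>, which is impossible: its \<open>m\<close>-th coefficient is at most \<open>2/3 (1 + exp (- l))\<close> in modulus by
  two Laguerre sum estimates, while extremality makes it at least twice the moduli of the coefficients of
  index \<open>0\<close> and \<open>1\<close>, and together these bound it by \<open>8/11 < 2/e\<close>.
\<close>

section \<open>Taylor coefficients\<close>

lemma tcoeff_eq_fps_nth:
  assumes "f has_fps_expansion F"
  shows "tcoeff f n = fps_nth F n"
  using fps_nth_fps_expansion[OF assms, of n] by (simp add: tcoeff_def)

lemma has_fps_expansion_tcoeff:
  assumes "f holomorphic_on unit_disc"
  shows "f has_fps_expansion Abs_fps (tcoeff f)"
proof -
  have "f has_fps_expansion fps_expansion f 0"
    using assms by (intro has_fps_expansion_fps_expansion[of unit_disc]) (auto simp: unit_disc_def)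
  moreover have "fps_expansion f 0 = Abs_fps (tcoeff f)"
    unfolding fps_expansion_def tcoeff_def of_nat_fact ..
  ultimately show ?thesis by simp
qed

lemma tcoeff_0 [simp]: "tcoeff f 0 = f 0"
  by (simp add: tcoeff_def)

lemma unit_disc_0 [simp]: "0 \<in> unit_disc"
  by (simp add: unit_disc_def)

lemma open_unit_disc [simp]: "open unit_disc"
  by (simp add: unit_disc_def)

lemma tcoeff_cong:
  assumes "\<And>z. z \<in> unit_disc \<Longrightarrow> f z = g z"
  shows "tcoeff f n = tcoeff g n"
proof -
  have "(deriv ^^ n) f 0 = (deriv ^^ n) g 0"
    by (rule higher_deriv_cong_ev)
       (use assms in \<open>auto simp: eventually_nhds intro!: exI[of _ unit_disc]\<close>)
  then show ?thesis by (simp add: tcoeff_def)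
qed

lemma tcoeff_eqD:
  assumes "f holomorphic_on unit_disc" "g holomorphic_on unit_disc"
    and "\<And>n. tcoeff f n = tcoeff g n" and "z \<in> unit_disc"
  shows "f z = g z"
  using assms by (intro holomorphic_fun_eq_on_ball[of f 0 1 g z]) (auto simp: unit_disc_def tcoeff_def)

lemma tcoeff_mult:
  assumes "f holomorphic_on unit_disc" "g holomorphic_on unit_disc"
  shows "tcoeff (\<lambda>z. f z * g z) n = (\<Sum>i\<le>n. tcoeff f i * tcoeff g (n - i))"
  using tcoeff_eq_fps_nth[OF has_fps_expansion_mult[OF assms[THEN has_fps_expansion_tcoeff]], of n]
  by (simp add: fps_mult_nth atLeast0AtMost)

lemma tcoeff_add:
  assumes "f holomorphic_on unit_disc" "g holomorphic_on unit_disc"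
  shows "tcoeff (\<lambda>z. f z + g z) n = tcoeff f n + tcoeff g n"
  using tcoeff_eq_fps_nth[OF has_fps_expansion_add[OF assms[THEN has_fps_expansion_tcoeff]], of n]
  by simp

lemma tcoeff_diff:
  assumes "f holomorphic_on unit_disc" "g holomorphic_on unit_disc"
  shows "tcoeff (\<lambda>z. f z - g z) n = tcoeff f n - tcoeff g n"
  using tcoeff_eq_fps_nth[OF has_fps_expansion_diff[OF assms[THEN has_fps_expansion_tcoeff]], of n]
  by simp

lemma tcoeff_cmult:
  assumes "f holomorphic_on unit_disc"
  shows "tcoeff (\<lambda>z. c * f z) n = c * tcoeff f n"
  using tcoeff_eq_fps_nth[OF has_fps_expansion_cmult_left[OF assms[THEN has_fps_expansion_tcoeff]], of c n]
  by simp

lemma tcoeff_minus: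
  assumes "f holomorphic_on unit_disc"
  shows "tcoeff (\<lambda>z. - f z) n = - tcoeff f n"
  using tcoeff_cmult[OF assms, of "-1" n] by simp

lemma tcoeff_const: "tcoeff (\<lambda>z. c) n = (if n = 0 then c else 0)"
  using tcoeff_eq_fps_nth[OF has_fps_expansion_const, of c n] by simp

lemma tcoeff_sum:
  assumes "\<And>j. j \<in> A \<Longrightarrow> f j holomorphic_on unit_disc"
  shows "tcoeff (\<lambda>z. \<Sum>j\<in>A. f j z) n = (\<Sum>j\<in>A. tcoeff (f j) n)"
  using assms
proof (induction A rule: infinite_finite_induct)
  case (insert x F)
  then show ?case by (simp add: tcoeff_add holomorphic_on_sum)
qed (auto simp: tcoeff_const)

lemma tcoeff_deriv:
  assumes "f holomorphic_on unit_disc"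
  shows "tcoeff (deriv f) n = of_nat (n + 1) * tcoeff f (n + 1)"
  using tcoeff_eq_fps_nth[OF has_fps_expansion_deriv[OF assms[THEN has_fps_expansion_tcoeff]], of n]
  by simp

lemma holomorphic_on_compose_disc:
  assumes "f holomorphic_on unit_disc" "g holomorphic_on unit_disc" "g ` unit_disc \<subseteq> unit_disc"
  shows "(\<lambda>z. f (g z)) holomorphic_on unit_disc"
  using holomorphic_on_compose_gen[OF assms(2,1)] assms(3) by (auto simp: o_def)

lemma holomorphic_power_arg:
  assumes "f holomorphic_on unit_disc" "d \<ge> 1"
  shows "(\<lambda>z. f (z ^ d)) holomorphic_on unit_disc"
  using assms by (intro holomorphic_on_compose_disc[OF assms(1)] holomorphic_intros)
    (auto simp: unit_disc_def norm_power intro!: power_less_one_iff[THEN iffD2])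

lemma tcoeff_power_arg:
  assumes "f holomorphic_on unit_disc" "d \<ge> 1"
  shows "tcoeff (\<lambda>z. f (z ^ d)) n = (if d dvd n then tcoeff f (n div d) else 0)"
proof -
  have "(f \<circ> (\<lambda>z. z ^ d)) has_fps_expansion (Abs_fps (tcoeff f) oo fps_X ^ d)"
    using assms by (intro has_fps_expansion_compose has_fps_expansion_tcoeff fps_expansion_intros) auto
  from tcoeff_eq_fps_nth[OF this, of n] show ?thesis
    by (simp add: o_def fps_nth_compose_X_power)
qed

lemma holomorphic_rotate:
  assumes "f holomorphic_on unit_disc" "norm u = 1"
  shows "(\<lambda>z. f (u * z)) holomorphic_on unit_disc"
  using assms by (intro holomorphic_on_compose_disc[OF assms(1)] holomorphic_intros)
    (auto simp: unit_disc_def norm_mult)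

lemma tcoeff_rotate:
  assumes "f holomorphic_on unit_disc" "norm u = 1"
  shows "tcoeff (\<lambda>z. f (u * z)) n = u ^ n * tcoeff f n"
proof -
  have "(f \<circ> (\<lambda>z. u * z)) has_fps_expansion (Abs_fps (tcoeff f) oo (fps_const u * fps_X))"
    using assms by (intro has_fps_expansion_compose has_fps_expansion_tcoeff fps_expansion_intros) auto
  from tcoeff_eq_fps_nth[OF this, of n] show ?thesis
    by (simp add: o_def fps_nth_compose_linear)
qed

lemma norm_tcoeff_le:
  assumes "f holomorphic_on unit_disc" "0 < r" "r < 1"
    and "\<And>z. norm z = r \<Longrightarrow> norm (f z) \<le> B"
  shows "norm (tcoeff f n) \<le> B / r ^ n"
proof -
  have "norm ((deriv ^^ n) f 0) \<le> fact n * B / r ^ n"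
    using assms
    by (intro Cauchy_inequality holomorphic_on_subset[OF assms(1)] holomorphic_on_imp_continuous_on)
       (auto simp: unit_disc_def)
  then show ?thesis
    by (simp add: tcoeff_def norm_divide field_simps)
qed

text \<open>Weierstrass: locally uniform convergence of holomorphic functions passes to all
  derivatives at 0. This serves the difference quotients of a variation and the Montel limit of a
  maximizing sequence.\<close>

lemma tcoeff_tendsto:
  assumes "\<And>i::nat. F i holomorphic_on unit_disc"
    and "\<And>K. compact K \<Longrightarrow> K \<subseteq> unit_disc \<Longrightarrow> uniform_limit K F g sequentially"
  shows "(\<lambda>i. tcoeff (F i) n) \<longlonglongrightarrow> tcoeff g n"
proof -
  have "uniform_limit (ball 0 (1/2)) F g sequentially"
    by (rule uniform_limit_on_subset[OF assms(2)[of "cball 0 (1/2)"]]) (auto simp: unit_disc_def)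
  then have "(\<lambda>i. (deriv ^^ n) (F i) 0) \<longlonglongrightarrow> (deriv ^^ n) g 0"
    using assms(1) by (intro higher_deriv_complex_uniform_limit[where A = "ball 0 (1/2)"])
      (auto intro!: always_eventually holomorphic_on_subset[of _ unit_disc "ball 0 (1/2)"] simp: unit_disc_def)
  then show ?thesis
    unfolding tcoeff_def by (intro tendsto_intros) auto
qed

lemma one_minus_mult_nz: "norm a \<le> 1 \<Longrightarrow> z \<in> unit_disc \<Longrightarrow> 1 - a * z \<noteq> (0::complex)"
proof
  assume "norm a \<le> 1" "z \<in> unit_disc" "1 - a * z = 0"
  then have "norm a * norm z = 1" by (metis eq_iff_diff_eq_0 norm_mult norm_one)
  moreover have "norm a * norm z \<le> 1 * norm z" using \<open>norm a \<le> 1\<close> by (intro mult_right_mono) auto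
  ultimately show False using \<open>z \<in> unit_disc\<close> by (simp add: unit_disc_def)
qed

text \<open>The Herglotz kernel with node \<open>a\<close> is twice a geometric series minus 1,
  which turns atoms into power moments.\<close>

lemma tcoeff_Mobius:
  assumes "norm a \<le> 1"
  shows "tcoeff (\<lambda>z. (1 + a * z) / (1 - a * z)) n = (if n = 0 then 1 else 2 * a ^ n)"
proof -
  have inv: "inverse (1 - fps_const a * fps_X) = Abs_fps (\<lambda>n. a ^ n)"
    using one_minus_const_fps_X_neg_power'[of 1 a] by simp
  have "(\<lambda>z. 2 * inverse (1 - a * z) - 1) has_fps_expansion
      fps_const 2 * inverse (1 - fps_const a * fps_X) - 1"
    by (intro fps_expansion_intros) auto
  from tcoeff_eq_fps_nth[OF this, of n]
  have "tcoeff (\<lambda>z. 2 * inverse (1 - a * z) - 1) n = (if n = 0 then 1 else 2 * a ^ n)"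
    unfolding inv by simp
  moreover have "2 * inverse (1 - a * z) - 1 = (1 + a * z) / (1 - a * z)" if "z \<in> unit_disc" for z
    using one_minus_mult_nz[OF assms that] by (simp add: field_simps)
  ultimately show ?thesis
    using tcoeff_cong[of "\<lambda>z. 2 * inverse (1 - a * z) - 1" "\<lambda>z. (1 + a * z) / (1 - a * z)" n] by simp
qed

lemma holomorphic_Mobius:
  "norm a \<le> 1 \<Longrightarrow> (\<lambda>z. (1 + a * z) / (1 - a * z)) holomorphic_on unit_disc"
  using one_minus_mult_nz by (intro holomorphic_intros) auto

lemma Re_Cayley_nonneg:
  assumes "norm (w::complex) \<le> 1"
  shows "Re ((1 + w) / (1 - w)) \<ge> 0"
proof -
  \<comment> \<open>At w = 1 both sides are 0, since division by 0 yields 0.\<close>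
  have "Re ((1 + w) / (1 - w)) = (1 - (norm w)\<^sup>2) / (norm (1 - w))\<^sup>2"
    unfolding cmod_power2 by (simp add: Re_divide algebra_simps power2_eq_square)
  moreover have "(norm w)\<^sup>2 \<le> 1" using assms by (simp add: power_le_one)
  ultimately show ?thesis by simp
qed

section \<open>Coefficients of exponentials\<close>

text \<open>Coefficient comparison in f' = - p' f.\<close>

lemma tcoeff_exp_rec:
  assumes "p holomorphic_on unit_disc" "\<And>z. z \<in> unit_disc \<Longrightarrow> f z = c * exp (- p z)"
  shows "of_nat n * tcoeff f n = - (\<Sum>i=1..n. of_nat i * tcoeff p i * tcoeff f (n - i))"
proof (cases n)
  case (Suc m)
  have f: "f holomorphic_on unit_disc"
    by (rule holomorphic_transform[of "\<lambda>z. c * exp (- p z)"]) (use assms in \<open>auto intro!: holomorphic_intros\<close>)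
  have d: "deriv f z = - (deriv p z * f z)" if "z \<in> unit_disc" for z
  proof -
    have "(p has_field_derivative deriv p z) (at z)"
      using assms(1) that holomorphic_derivI open_unit_disc by blast
    then have "((\<lambda>z. c * exp (- p z)) has_field_derivative c * (exp (- p z) * (- deriv p z))) (at z)"
      by (auto intro!: derivative_eq_intros)
    then have "(f has_field_derivative c * (exp (- p z) * (- deriv p z))) (at z)"
      by (rule has_field_derivative_transform_within_open[of _ _ _ unit_disc])
         (use that assms(2) in auto)
    then show ?thesis using assms(2)[OF that] by (simp add: DERIV_imp_deriv)
  qed
  have dp: "deriv p holomorphic_on unit_disc"
    using assms(1) by (simp add: holomorphic_deriv)
  have "of_nat (m + 1) * tcoeff f (m + 1) = tcoeff (deriv f) m"
    by (simp add: tcoeff_deriv f)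
  also have "\<dots> = tcoeff (\<lambda>z. - (deriv p z * f z)) m"
    by (rule tcoeff_cong) (rule d)
  also have "\<dots> = - (\<Sum>i\<le>m. of_nat (i + 1) * tcoeff p (i + 1) * tcoeff f (m - i))"
    using dp f assms(1)
    by (simp add: tcoeff_minus tcoeff_mult tcoeff_deriv holomorphic_on_mult)
  also have "(\<Sum>i\<le>m. of_nat (i + 1) * tcoeff p (i + 1) * tcoeff f (m - i)) =
     (\<Sum>i=1..n. of_nat i * tcoeff p i * tcoeff f (n - i))"
    unfolding Suc by (rule sum.reindex_bij_witness[of _ "\<lambda>i. i - 1" "\<lambda>i. i + 1"]) auto
  finally show ?thesis using Suc by simp
qed auto

text \<open>Under the gap, p - p(0) vanishes at 0 to order J + 1, so its square starts at degree 2 J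
  + 2 and its cube at 3 J + 3. Hence the exponential is linear in p up to degree 2 J + 1 and
  quadratic up to 3 J + 2. The proof reads this off the recurrence.\<close>

lemma tcoeff_exp_gap:
  assumes p: "p holomorphic_on unit_disc" "\<And>z. z \<in> unit_disc \<Longrightarrow> f z = c * exp (- p z)"
    and f0: "f 0 \<noteq> 0"
    and gap: "\<And>j. 1 \<le> j \<Longrightarrow> j \<le> J \<Longrightarrow> tcoeff f j = 0"
  shows tcoeff_exp_gap_zero: "1 \<le> k \<Longrightarrow> k \<le> J \<Longrightarrow> tcoeff p k = 0"
    and tcoeff_exp_gap_linear: "1 \<le> k \<Longrightarrow> k \<le> 2 * J + 1 \<Longrightarrow> tcoeff f k = - f 0 * tcoeff p k"
    and tcoeff_exp_gap_quadratic: "1 \<le> n \<Longrightarrow> n \<le> 3 * J + 2 \<Longrightarrow>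
      tcoeff f n = f 0 * ((\<Sum>i\<in>{J<..<n-J}. tcoeff p i * tcoeff p (n - i)) / 2 - tcoeff p n)"
proof -
  have split_last: "(\<Sum>i=1..k. u i) = (\<Sum>i\<in>{1..<k}. u i) + (u k :: complex)" if "1 \<le> k" for u and k :: nat
  proof -
    have "{1..k} = insert k {1..<k}" using that by auto
    then show ?thesis by (simp add: add.commute)
  qed
  show zero: "tcoeff p k = 0" if k: "1 \<le> k" "k \<le> J" for k
  proof -
    have "(\<Sum>i\<in>{1..<k}. of_nat i * tcoeff p i * tcoeff f (k - i)) = 0"
      using k by (intro sum.neutral ballI) (auto simp: gap)
    then have "of_nat k * tcoeff p k * f 0 = 0"
      using tcoeff_exp_rec[OF p, of k] gap[OF k] unfolding split_last[OF k(1)] by simp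
    then show ?thesis using k f0 by simp
  qed
  show lin: "tcoeff f k = - f 0 * tcoeff p k" if k: "1 \<le> k" "k \<le> 2 * J + 1" for k
  proof -
    \<comment> \<open>As k <= 2 J + 1, one of i and k - i is at most J.\<close>
    have "tcoeff p i * tcoeff f (k - i) = 0" if "i \<in> {1..<k}" for i
    proof (cases "i \<le> J")
      case False
      then show ?thesis using that k by (subst gap[of "k - i"]) auto
    qed (use that zero in auto)
    then have "(\<Sum>i\<in>{1..<k}. of_nat i * tcoeff p i * tcoeff f (k - i)) = 0"
      by (intro sum.neutral ballI) (simp add: mult.assoc)
    then have "of_nat k * tcoeff f k = of_nat k * (- f 0 * tcoeff p k)"
      using tcoeff_exp_rec[OF p, of k] unfolding split_last[OF k(1)] by simp
    then show ?thesis using k by (subst (asm) mult_left_cancel) auto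
  qed
  show "tcoeff f n = f 0 * ((\<Sum>i\<in>{J<..<n-J}. tcoeff p i * tcoeff p (n - i)) / 2 - tcoeff p n)"
    if n: "1 \<le> n" "n \<le> 3 * J + 2"
  proof -
    let ?W = "{J<..<n-J}"
    let ?q = "\<lambda>i. tcoeff p i * tcoeff p (n - i)"
    have "(\<Sum>i\<in>{1..<n}. of_nat i * tcoeff p i * tcoeff f (n - i)) =
          (\<Sum>i\<in>?W. of_nat i * tcoeff p i * tcoeff f (n - i))"
    proof (rule sum.mono_neutral_right)
      show "\<forall>i\<in>{1..<n} - ?W. of_nat i * tcoeff p i * tcoeff f (n - i) = 0"
      proof
        fix i assume i: "i \<in> {1..<n} - ?W"
        then consider "1 \<le> i" "i \<le> J" | "1 \<le> n - i" "n - i \<le> J" by force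
        then show "of_nat i * tcoeff p i * tcoeff f (n - i) = 0"
          by cases (simp_all add: zero gap)
      qed
    qed auto
    also have "\<dots> = - f 0 * (\<Sum>i\<in>?W. of_nat i * ?q i)"
      unfolding sum_distrib_left
    proof (rule sum.cong[OF refl])
      fix i assume i: "i \<in> ?W"
      \<comment> \<open>Inside the window n - i <= 2 J + 1, so the linear formula replaces the
        coefficient of f.\<close>
      then have "1 \<le> n - i" "n - i \<le> 2 * J + 1" using n by auto
      from lin[OF this] show "of_nat i * tcoeff p i * tcoeff f (n - i) = - f 0 * (of_nat i * ?q i)"
        by simp
    qed
    also have "(\<Sum>i\<in>?W. of_nat i * ?q i) = of_nat n * (\<Sum>i\<in>?W. ?q i) / 2"
    proof -
      \<comment> \<open>Window and product are invariant under i -> n - i, so the weight i averages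
        with n - i to the constant n / 2.\<close>
      have "(\<Sum>i\<in>?W. of_nat i * ?q i) = (\<Sum>i\<in>?W. of_nat (n - i) * ?q i)"
        by (rule sum.reindex_bij_witness[of _ "\<lambda>i. n - i" "\<lambda>i. n - i"]) auto
      then have "2 * (\<Sum>i\<in>?W. of_nat i * ?q i) = (\<Sum>i\<in>?W. of_nat i * ?q i + of_nat (n - i) * ?q i)"
        by (simp add: sum.distrib)
      also have "\<dots> = (\<Sum>i\<in>?W. of_nat n * ?q i)"
        by (rule sum.cong) (auto simp flip: distrib_right of_nat_add)
      also have "\<dots> = of_nat n * (\<Sum>i\<in>?W. ?q i)"
        by (simp only: sum_distrib_left)
      finally show ?thesis
        using nonzero_mult_div_cancel_left[of 2 "\<Sum>i\<in>?W. of_nat i * ?q i"] by simp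
    qed
    finally have "of_nat n * tcoeff f n = of_nat n * (f 0 * ((\<Sum>i\<in>?W. ?q i) / 2 - tcoeff p n))"
      using tcoeff_exp_rec[OF p, of n] unfolding split_last[OF n(1)] by (simp add: algebra_simps)
    then show ?thesis using n by simp
  qed
qed

section \<open>Extremal functions\<close>

lemma B0_I:
  assumes "f holomorphic_on unit_disc" "\<And>z. z \<in> unit_disc \<Longrightarrow> f z \<noteq> 0 \<and> norm (f z) \<le> 1"
  shows "f \<in> B0"
  using assms by (auto simp: B0_def)

lemma B0_D:
  assumes "f \<in> B0"
  shows "f holomorphic_on unit_disc" "z \<in> unit_disc \<Longrightarrow> f z \<noteq> 0" "z \<in> unit_disc \<Longrightarrow> norm (f z) \<le> 1"
  using assms by (auto simp: B0_def)

text \<open>Cauchy's estimate on the circle of radius r, with r tending to 1.\<close>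

lemma norm_tcoeff_B0_le_1:
  assumes "f \<in> B0"
  shows "norm (tcoeff f n) \<le> 1"
proof -
  have "((\<lambda>r. 1 / r ^ n) \<longlongrightarrow> 1 / 1 ^ n) (at_left (1::real))"
    by (intro tendsto_intros) auto
  moreover have "eventually (\<lambda>r. norm (tcoeff f n) \<le> 1 / r ^ n) (at_left (1::real))"
    unfolding eventually_at_left_field
    by (rule exI[of _ 0]) (auto intro!: norm_tcoeff_le B0_D[OF assms] simp: unit_disc_def)
  ultimately show ?thesis
    using tendsto_lowerbound[of "\<lambda>r. 1 / r ^ n" "1 / 1 ^ n" "at_left (1::real)"] by simp
qed

lemma exp_minus_in_B0:
  assumes "p holomorphic_on unit_disc" "\<And>z. z \<in> unit_disc \<Longrightarrow> Re (p z) \<ge> 0" "norm c = 1"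
  shows "(\<lambda>z. c * exp (- p z)) \<in> B0"
  using assms by (intro B0_I holomorphic_intros) (auto simp: norm_mult)

lemma B0_tcoeff_cong_mem:
  assumes "f \<in> B0" "\<And>z. z \<in> unit_disc \<Longrightarrow> g z = f z"
  shows "g \<in> B0"
  using assms holomorphic_transform[of f unit_disc g] by (auto simp: B0_def)

lemma krzyz_fn_eq:
  "krzyz_fn n z = 1 * exp (- ((1 + (-1) * z ^ n) / (1 - (-1) * z ^ n)))"
  by (simp add: krzyz_fn_def minus_divide_left add.commute)

lemma
  assumes "n \<ge> 1"
  shows krzyz_fn_in_B0: "krzyz_fn n \<in> B0"
    and Mfun_krzyz_fn: "Mfun n (krzyz_fn n) = 2 / exp 1"
proof -
  let ?p = "\<lambda>z. (1 + (-1) * z ^ n) / (1 - (-1) * z ^ n) :: complex"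
  have p: "?p holomorphic_on unit_disc"
    using holomorphic_power_arg[OF holomorphic_Mobius[of "-1"] assms] by simp
  have p_coeff: "tcoeff ?p k = (if n dvd k then (if k = 0 then 1 else 2 * (-1) ^ (k div n)) else 0)" for k
    using tcoeff_power_arg[OF holomorphic_Mobius[of "-1"] assms, of k] tcoeff_Mobius[of "-1" "k div n"] assms
    by auto
  have "Re (?p z) \<ge> 0" if "z \<in> unit_disc" for z
    using Re_Cayley_nonneg[of "(-1) * z ^ n"] that
    by (simp add: unit_disc_def norm_power power_le_one)
  then show "krzyz_fn n \<in> B0"
    using exp_minus_in_B0[OF p, of 1] by (simp add: krzyz_fn_def[abs_def] minus_divide_left add.commute)
  have rep: "krzyz_fn n z = 1 * exp (- ?p z)" for z by (rule krzyz_fn_eq)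
  have kh: "krzyz_fn n holomorphic_on unit_disc" using \<open>krzyz_fn n \<in> B0\<close> B0_D by blast
  have pw: "tcoeff (krzyz_fn n) j = (if n dvd j then tcoeff (\<lambda>w. exp ((w - 1) / (w + 1))) (j div n) else 0)" for j
  proof -
    have "(\<lambda>w. exp ((w - 1) / (w + 1))) holomorphic_on unit_disc"
      by (intro holomorphic_intros) (auto simp: unit_disc_def add_eq_0_iff2)
    then show ?thesis
      using tcoeff_power_arg[OF _ assms, of "\<lambda>w. exp ((w - 1) / (w + 1))" j]
      by (simp add: krzyz_fn_def[abs_def])
  qed
  have zero: "tcoeff (krzyz_fn n) j = 0" if "1 \<le> j" "j < n" for j
    using that by (auto simp: pw dest: dvd_imp_le)
  \<comment> \<open>With J = n - 1 the index n lies in the linear range n <= 2 J + 1.\<close>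
  have "tcoeff (krzyz_fn n) n = - krzyz_fn n 0 * tcoeff ?p n"
    by (rule tcoeff_exp_gap_linear[OF p rep, where J = "n - 1"])
       (use assms zero in \<open>auto simp: krzyz_fn_eq[of n 0]\<close>)
  also have "\<dots> = of_real (2 / exp 1)"
  proof -
    have "krzyz_fn n 0 = of_real (exp (- 1))" using assms by (cases n) (simp_all add: krzyz_fn_def exp_of_real[symmetric])
    moreover have "tcoeff ?p n = - 2" unfolding p_coeff using assms by simp
    ultimately show ?thesis by (simp add: exp_minus divide_inverse)
  qed
  finally show "Mfun n (krzyz_fn n) = 2 / exp 1"
    by (simp only: Mfun_def Re_complex_of_real)
qed

lemma Mfun_extremal_ge:
  assumes "extremal n f" "n \<ge> 1"
  shows "Mfun n f \<ge> 2 / exp 1"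
  using assms(1) krzyz_fn_in_B0[OF assms(2)] Mfun_krzyz_fn[OF assms(2)] unfolding extremal_def by force

text \<open>The n-th coefficient of f exp(t q) is maximal over 0 <= t < 1 at t = 0, so its right
  derivative there, the n-th coefficient of f q, has nonpositive real part.\<close>

lemma extremal_variation:
  assumes f: "extremal n f" and q: "q holomorphic_on unit_disc"
    and B0: "\<And>t. 0 < t \<Longrightarrow> t < 1 \<Longrightarrow> (\<lambda>z. f z * exp (of_real t * q z)) \<in> B0"
  shows "Re (tcoeff (\<lambda>z. f z * q z) n) \<le> 0"
proof -
  have fB: "f \<in> B0" and fh: "f holomorphic_on unit_disc"
    using f B0_D unfolding extremal_def by auto
  define t where "t = (\<lambda>i::nat. 1 / real (i + 2))"
  have t: "0 < t i" "t i < 1" for i by (auto simp: t_def)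
  \<comment> \<open>\<open>F i\<close> is the difference quotient at \<open>t i\<close>; the
    second-order Taylor bound for exp makes it converge to f q uniformly on compact sets.\<close>
  define F where "F = (\<lambda>i z. of_real (1 / t i) * (f z * exp (of_real (t i) * q z) - f z))"
  have eh: "(\<lambda>z. f z * exp (of_real (t i) * q z)) holomorphic_on unit_disc" for i
    using fh q by (intro holomorphic_intros)
  have "Re (tcoeff (F i) n) \<le> 0" for i
  proof -
    have "tcoeff (F i) n = of_real (1 / t i) * (tcoeff (\<lambda>z. f z * exp (of_real (t i) * q z)) n - tcoeff f n)"
      unfolding F_def by (simp only: tcoeff_cmult[OF holomorphic_on_diff[OF eh fh]] tcoeff_diff[OF eh fh])
    then have "Re (tcoeff (F i) n) = 1 / t i * (Mfun n (\<lambda>z. f z * exp (of_real (t i) * q z)) - Mfun n f)"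
      by (simp add: Mfun_def)
    also have "\<dots> \<le> 0"
      using f B0[OF t] t[of i] by (intro mult_nonneg_nonpos) (auto simp: extremal_def)
    finally show ?thesis .
  qed
  moreover have lim: "(\<lambda>i. tcoeff (F i) n) \<longlonglongrightarrow> tcoeff (\<lambda>z. f z * q z) n"
  proof (rule tcoeff_tendsto[where F = F])
    show "F i holomorphic_on unit_disc" for i
      unfolding F_def using fh eh q by (intro holomorphic_intros)
    fix K assume K: "compact K" "K \<subseteq> unit_disc"
    have "compact (q ` K)"
      using K q by (intro compact_continuous_image holomorphic_on_imp_continuous_on) (auto intro: holomorphic_on_subset)
    then obtain B where B: "\<And>z. z \<in> K \<Longrightarrow> norm (q z) \<le> B" "B > 0"
      by (metis bounded_pos compact_imp_bounded imageI)
    have bound: "norm (F i z - f z * q z) \<le> exp B * B\<^sup>2 * t i" if z: "z \<in> K" for i z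
    proof -
      let ?w = "of_real (t i) * q z"
      have ti: "0 \<le> t i" "t i \<le> 1" using t[of i] by auto
      have w: "norm ?w \<le> B * t i" using mult_left_mono[OF B(1)[OF z] ti(1)] ti by (simp add: norm_mult mult.commute)
      also have "\<dots> \<le> B" using ti B(2) by (simp add: mult_left_le)
      finally have w': "norm ?w \<le> B" .
      have "F i z - f z * q z = f z * (of_real (1 / t i) * (exp ?w - (1 + ?w)))"
        using t(1)[of i] by (simp add: F_def field_simps)
      then have "norm (F i z - f z * q z) = norm (f z) * ((1 / t i) * norm (exp ?w - (1 + ?w)))"
        using ti by (simp add: norm_mult norm_divide)
      also have "\<dots> \<le> 1 * ((1 / t i) * (exp \<bar>Re ?w\<bar> * norm ?w ^ 2))"
        using Taylor_exp[of ?w 1] B0_D(3)[OF fB, of z] z K ti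
        by (intro mult_mono) (auto simp: eval_nat_numeral)
      also have "\<dots> \<le> 1 * ((1 / t i) * (exp B * (B * t i) ^ 2))"
        using ti B(2) w w' abs_Re_le_cmod[of ?w]
        by (intro mult_mono mult_left_mono power_mono) (auto intro: order_trans)
      also have "\<dots> = exp B * B\<^sup>2 * t i"
        using t(1)[of i] by (simp add: power2_eq_square field_simps)
      finally show ?thesis .
    qed
    have "(\<lambda>i. exp B * B\<^sup>2 * t i) \<longlonglongrightarrow> exp B * B\<^sup>2 * 0"
      unfolding t_def by real_asymp
    then have ev: "eventually (\<lambda>i. exp B * B\<^sup>2 * t i < e) sequentially" if "e > 0" for e
      using that order_tendstoD(2)[of _ "exp B * B\<^sup>2 * 0" sequentially e] by simp
    show "uniform_limit K F (\<lambda>z. f z * q z) sequentially"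
    proof (rule uniform_limitI)
      fix e :: real assume "e > 0"
      show "eventually (\<lambda>i. \<forall>z\<in>K. dist (F i z) (f z * q z) < e) sequentially"
        using ev[OF \<open>e > 0\<close>] by eventually_elim (auto simp: dist_norm intro: le_less_trans[OF bound])
    qed
  qed
  ultimately show ?thesis
    using LIMSEQ_le_const2[OF tendsto_Re[OF lim], of 0] by blast
qed

text \<open>Multiplication by exp(- t q) does not increase the modulus, so - q is an admissible
  variation.\<close>

lemma extremal_add_Re_nonneg:
  assumes f: "extremal n f" and q: "q holomorphic_on unit_disc"
    and Re: "\<And>z. z \<in> unit_disc \<Longrightarrow> Re (q z) \<ge> 0"
  shows "Re (tcoeff (\<lambda>z. f z * q z) n) \<ge> 0"
proof -
  have fB: "f \<in> B0" using f by (simp add: extremal_def)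
  have "Re (tcoeff (\<lambda>z. f z * - q z) n) \<le> 0"
  proof (rule extremal_variation[OF f])
    fix t :: real assume t: "0 < t" "t < 1"
    show "(\<lambda>z. f z * exp (of_real t * - q z)) \<in> B0"
    proof (rule B0_I)
      fix z assume z: "z \<in> unit_disc"
      have "norm (f z) * exp (- (t * Re (q z))) \<le> 1 * 1"
        using B0_D(3)[OF fB z] Re[OF z] t by (intro mult_mono) auto
      then show "f z * exp (of_real t * - q z) \<noteq> 0 \<and> norm (f z * exp (of_real t * - q z)) \<le> 1"
        using B0_D(2)[OF fB z] by (simp add: norm_mult)
    qed (use B0_D(1)[OF fB] q in \<open>intro holomorphic_intros\<close>)
  qed (use q in \<open>intro holomorphic_intros\<close>)
  then show ?thesis
    using tcoeff_minus[of "\<lambda>z. f z * q z" n] B0_D(1)[OF fB] q by (simp add: holomorphic_on_mult)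
qed

text \<open>A maximizing sequence has a locally uniform limit by Montel. Its n-th coefficient is at
  least 2/e, so it is not constant, and Hurwitz keeps it free of zeros.\<close>

lemma extremal_exists:
  assumes "n \<ge> 1"
  obtains f where "extremal n f"
proof -
  define s where "s = Sup (Mfun n ` B0)"
  have bdd: "bdd_above (Mfun n ` B0)"
  proof (rule bdd_aboveI)
    fix x assume "x \<in> Mfun n ` B0"
    then show "x \<le> 1"
      using norm_tcoeff_B0_le_1 complex_Re_le_cmod order_trans unfolding Mfun_def by blast
  qed
  have le_s: "Mfun n f \<le> s" if "f \<in> B0" for f
    unfolding s_def using that bdd by (intro cSup_upper) auto
  have "\<exists>f\<in>B0. Mfun n f > s - 1 / real (Suc i)" for i
    using less_cSup_iff[OF _ bdd, of "s - 1 / real (Suc i)"] krzyz_fn_in_B0[OF assms] s_def by auto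
  then obtain F where F: "\<And>i. F i \<in> B0" "\<And>i. Mfun n (F i) > s - 1 / real (Suc i)"
    by metis
  obtain g r where g: "g holomorphic_on unit_disc" and r: "strict_mono (r :: nat \<Rightarrow> nat)"
    and lim: "\<And>z. z \<in> unit_disc \<Longrightarrow> (\<lambda>i. F (r i) z) \<longlonglongrightarrow> g z"
    and unif: "\<And>K. compact K \<Longrightarrow> K \<subseteq> unit_disc \<Longrightarrow> uniform_limit K (F \<circ> r) g sequentially"
  proof (rule Montel[of unit_disc B0 F])
    show "\<exists>B. \<forall>h\<in>B0. \<forall>z\<in>K. norm (h z) \<le> B" if "compact K" "K \<subseteq> unit_disc" for K
      using that B0_D(3) by (intro exI[of _ 1]) auto
  qed (use B0_D F in auto)
  have Fh: "(F \<circ> r) i holomorphic_on unit_disc" for i using F(1) B0_D by auto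
  have "(\<lambda>i. Mfun n (F (r i))) \<longlonglongrightarrow> Mfun n g"
    unfolding Mfun_def using tendsto_Re[OF tcoeff_tendsto[OF Fh unif, of n]] by (simp add: o_def)
  moreover have "(\<lambda>i. Mfun n (F (r i))) \<longlonglongrightarrow> s"
  proof (rule tendsto_sandwich)
    show "(\<lambda>i. s - 1 / real (Suc i)) \<longlonglongrightarrow> s" by real_asymp
    show "eventually (\<lambda>i. s - 1 / real (Suc i) \<le> Mfun n (F (r i))) sequentially"
    proof (intro always_eventually allI)
      fix i
      have "1 / real (Suc (r i)) \<le> 1 / real (Suc i)"
        using seq_suble[OF r, of i] by (intro divide_left_mono) auto
      then show "s - 1 / real (Suc i) \<le> Mfun n (F (r i))" using F(2)[of "r i"] by linarith
    qed
  qed (use le_s F in auto)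
  ultimately have gs: "Mfun n g = s" by (rule LIMSEQ_unique)
  have "g \<in> B0"
  proof (rule B0_I[OF g])
    fix z assume z: "z \<in> unit_disc"
    have "norm (g z) \<le> 1"
      using tendsto_upperbound[OF tendsto_norm[OF lim[OF z]], of 1] B0_D(3)[OF F(1) z] by auto
    moreover have "g z \<noteq> 0"
    proof (rule Hurwitz_no_zeros[OF _ _ Fh g unif])
      show "\<not> g constant_on unit_disc"
      proof
        assume "g constant_on unit_disc"
        then obtain c where "\<And>z. z \<in> unit_disc \<Longrightarrow> g z = c" by (auto simp: constant_on_def)
        then have "tcoeff g n = 0" using tcoeff_cong[of g "\<lambda>z. c" n] assms by (simp add: tcoeff_const)
        moreover have "s \<ge> 2 / exp 1"
          using le_s[OF krzyz_fn_in_B0[OF assms]] Mfun_krzyz_fn[OF assms] by simp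
        ultimately show False using gs by (simp add: Mfun_def)
      qed
      show "connected unit_disc" by (simp add: unit_disc_def)
    qed (use z F(1) B0_D in auto)
    ultimately show "g z \<noteq> 0 \<and> norm (g z) \<le> 1" by simp
  qed
  then have "extremal n g" using gs le_s by (simp add: extremal_def)
  then show ?thesis by (rule that)
qed

lemma extremal_rotate:
  assumes f: "extremal n f" and u: "norm u = 1"
  shows "extremal n (\<lambda>z. cnj (u ^ n) * f (u * z))"
proof -
  have fB: "f \<in> B0" using f by (simp add: extremal_def)
  have uz: "u * z \<in> unit_disc" if "z \<in> unit_disc" for z
    using that u by (simp add: unit_disc_def norm_mult)
  have "(\<lambda>z. cnj (u ^ n) * f (u * z)) \<in> B0"
    using B0_D[OF fB] u uz
    by (intro B0_I holomorphic_intros holomorphic_rotate) (auto simp: norm_mult norm_power)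
  moreover have "tcoeff (\<lambda>z. cnj (u ^ n) * f (u * z)) n = (cnj (u ^ n) * u ^ n) * tcoeff f n"
    using B0_D(1)[OF fB] u by (simp add: tcoeff_cmult tcoeff_rotate holomorphic_rotate)
  moreover have "cnj (u ^ n) * u ^ n = 1"
    using u by (simp flip: power_mult_distrib add: complex_norm_square[symmetric] mult.commute)
  ultimately show ?thesis using f by (simp add: extremal_def Mfun_def)
qed

lemma ex_rotation:
  assumes "w \<noteq> 0" "n \<ge> 1"
  obtains u where "norm u = 1" "cnj (u ^ n) * w = of_real (norm w)"
proof
  define u where "u = cis (Arg w / real n)"
  have "u ^ n = cis (Arg w)" using assms(2) by (simp add: u_def Complex.DeMoivre)
  then show "cnj (u ^ n) * w = of_real (norm w)"
    using rcis_cmod_Arg[of w] by (metis cis_cnj cis_mult cis_zero add.left_inverse mult.assoc mult.commute mult_1 rcis_def)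
  show "norm u = 1" by (simp add: u_def)
qed

definition normalized :: "(complex \<Rightarrow> complex) \<Rightarrow> bool" where
  "normalized f \<longleftrightarrow> tcoeff f 0 \<in> \<real> \<and> Re (tcoeff f 0) > 0"

text \<open>Rotating the variable by \<open>u\<close> multiplies the n-th coefficient by u^n. The
  prefactor cancels this and, when u^n has the direction of f 0, also makes the value at 0
  positive.\<close>

lemma extremal_normalize:
  assumes f: "extremal n f" and n: "n \<ge> 1"
  obtains u where "norm u = 1" "extremal n (\<lambda>z. cnj (u ^ n) * f (u * z))"
    "normalized (\<lambda>z. cnj (u ^ n) * f (u * z))"
proof -
  have "f 0 \<noteq> 0" using f B0_D(2)[of f 0] by (simp add: extremal_def)
  from ex_rotation[OF this n] obtain u where u: "norm u = 1" "cnj (u ^ n) * f 0 = of_real (norm (f 0))" .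
  moreover have "normalized (\<lambda>z. cnj (u ^ n) * f (u * z))"
    unfolding normalized_def tcoeff_0 mult_zero_right u(2) using \<open>f 0 \<noteq> 0\<close> by simp
  ultimately show ?thesis
    using that extremal_rotate[OF f u(1)] by blast
qed

text \<open>An extremal function exists and can be normalized. If it then equals f_n, the maximum
  over \<open>B0\<close> is 2/e, and every function attaining 2/e is itself extremal.\<close>

lemma krzyz_conjecture_iff:
  "krzyz_conjecture \<longleftrightarrow>
    (\<forall>n\<ge>1. \<forall>f. extremal n f \<longrightarrow> normalized f \<longrightarrow> (\<forall>z\<in>unit_disc. f z = krzyz_fn n z))"
proof
  assume K: krzyz_conjecture
  show "\<forall>n\<ge>1. \<forall>f. extremal n f \<longrightarrow> normalized f \<longrightarrow> (\<forall>z\<in>unit_disc. f z = krzyz_fn n z)"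
  proof (intro allI impI)
    fix n f assume n: "1 \<le> n" and f: "extremal n f" and "normalized f"
    then have "Mfun n f \<le> 2 / exp 1 \<and> (Mfun n f = 2 / exp 1 \<longrightarrow> (\<forall>z\<in>unit_disc. f z = krzyz_fn n z))"
      using K unfolding krzyz_conjecture_def extremal_def normalized_def by blast
    then show "\<forall>z\<in>unit_disc. f z = krzyz_fn n z"
      using Mfun_extremal_ge[OF f n] by simp
  qed
next
  assume E: "\<forall>n\<ge>1. \<forall>f. extremal n f \<longrightarrow> normalized f \<longrightarrow> (\<forall>z\<in>unit_disc. f z = krzyz_fn n z)"
  show krzyz_conjecture
    unfolding krzyz_conjecture_def
  proof (intro allI impI ballI)
    fix n f assume n: "1 \<le> (n::nat)" and f: "f \<in> B0" and f0: "tcoeff f 0 \<in> \<real> \<and> Re (tcoeff f 0) > 0"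
    obtain g where "extremal n g" using extremal_exists[OF n] .
    from extremal_normalize[OF this n] obtain h where h: "extremal n h" "normalized h" by metis
    then have "\<forall>z\<in>unit_disc. h z = krzyz_fn n z" using E n by blast
    then have hM: "Mfun n h = 2 / exp 1"
      using Mfun_krzyz_fn[OF n] tcoeff_cong[of h "krzyz_fn n" n] by (simp add: Mfun_def)
    then have "Mfun n f \<le> 2 / exp 1" using h(1) f by (auto simp: extremal_def)
    moreover have "extremal n f" if "Mfun n f = 2 / exp 1"
      using that h(1) f hM by (auto simp: extremal_def)
    ultimately show "Mfun n f \<le> 2 / exp 1 \<and> (Mfun n f = 2 / exp 1 \<longrightarrow> (\<forall>z\<in>unit_disc. f z = krzyz_fn n z))"
      using E n f0 by (auto simp: normalized_def)
  qed
qed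

section \<open>Extremal functions have finitely many atoms\<close>

lemma B0_exp_rep:
  assumes "f \<in> B0"
  obtains c p where "norm c = 1" "p holomorphic_on unit_disc" "Im (p 0) = 0"
    "\<And>z. z \<in> unit_disc \<Longrightarrow> f z = c * exp (- p z)" "\<And>z. z \<in> unit_disc \<Longrightarrow> Re (p z) \<ge> 0"
proof -
  obtain g where g: "g holomorphic_on unit_disc" "\<And>z. z \<in> unit_disc \<Longrightarrow> exp (g z) = f z"
    using holomorphic_logarithm_exists[of unit_disc f 0] B0_D[OF assms]
    by (auto simp: unit_disc_def)
  show ?thesis
  \<comment> \<open>Moving the phase of f 0 into the constant makes p 0 real.\<close>
  proof (rule that[of "exp (\<i> * of_real (Im (g 0)))" "\<lambda>z. \<i> * of_real (Im (g 0)) - g z"])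
    fix z assume z: "z \<in> unit_disc"
    then show "f z = exp (\<i> * of_real (Im (g 0))) * exp (- (\<i> * of_real (Im (g 0)) - g z))"
      using g(2) by (simp flip: exp_add)
    have "exp (Re (g z)) \<le> 1" using B0_D(3)[OF assms z] g(2)[OF z] by (metis norm_exp_eq_Re)
    then show "0 \<le> Re (\<i> * of_real (Im (g 0)) - g z)" by simp
  qed (use g in \<open>auto intro!: holomorphic_intros\<close>)
qed

section \<open>Means over circles\<close>

definition unit_pt :: "real \<Rightarrow> complex" where
  "unit_pt t = exp (2 * of_real pi * \<i> * of_real t)"

lemma norm_unit_pt [simp]: "norm (unit_pt t) = 1"
  by (simp add: unit_pt_def)

lemma unit_pt_nz [simp]: "unit_pt t \<noteq> 0"
  by (simp add: unit_pt_def)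

lemma cnj_unit_pt: "cnj (unit_pt t) = inverse (unit_pt t)"
  by (simp add: unit_pt_def exp_cnj exp_minus)

lemma continuous_on_unit_pt [continuous_intros]: "continuous_on A unit_pt"
  unfolding unit_pt_def by (intro continuous_intros)

lemma has_integral_circle_coeff:
  assumes "h holomorphic_on unit_disc" "0 < r" "r < 1"
  shows "((\<lambda>t. h (of_real r * unit_pt t) * inverse (unit_pt t) ^ k) has_integral of_real r ^ k * tcoeff h k) {0..1}"
proof -
  have "((\<lambda>u. h u / (u - 0) ^ Suc k) has_contour_integral 2 * pi * \<i> / fact k * (deriv ^^ k) h 0) (circlepath 0 r)"
    using assms
    by (intro Cauchy_has_contour_integral_higher_derivative_circlepath holomorphic_on_subset[OF assms(1)]
        holomorphic_on_imp_continuous_on) (auto simp: unit_disc_def)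
  then have "((\<lambda>t. h (circlepath 0 r t) / circlepath 0 r t ^ Suc k *
        vector_derivative (circlepath 0 r) (at t within {0..1})) has_integral
      2 * pi * \<i> * tcoeff h k) {0..1}"
    by (simp add: has_contour_integral_def tcoeff_def)
  then have "((\<lambda>t. h (of_real r * unit_pt t) / (of_real r * unit_pt t) ^ Suc k *
        (2 * pi * \<i> * (of_real r * unit_pt t))) has_integral 2 * pi * \<i> * tcoeff h k) {0..1}"
  proof (rule has_integral_eq[rotated])
    fix t :: real assume t: "t \<in> {0..1}"
    have "circlepath 0 r t = of_real r * unit_pt t"
      by (simp add: circlepath unit_pt_def mult_ac)
    moreover have "vector_derivative (circlepath 0 r) (at t within {0..1}) = 2 * pi * \<i> * (of_real r * unit_pt t)"
      using t by (simp add: vector_derivative_circlepath01 unit_pt_def mult_ac)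
    ultimately show "h (circlepath 0 r t) / circlepath 0 r t ^ Suc k *
        vector_derivative (circlepath 0 r) (at t within {0..1}) =
      h (of_real r * unit_pt t) / (of_real r * unit_pt t) ^ Suc k * (2 * pi * \<i> * (of_real r * unit_pt t))"
      by simp
  qed
  then have "((\<lambda>t. of_real r ^ k / (2 * pi * \<i>) * (h (of_real r * unit_pt t) / (of_real r * unit_pt t) ^ Suc k *
        (2 * pi * \<i> * (of_real r * unit_pt t)))) has_integral
        of_real r ^ k / (2 * pi * \<i>) * (2 * pi * \<i> * tcoeff h k)) {0..1}"
    by (rule has_integral_mult_right)
  then show ?thesis
    by (rule has_integral_eq_rhs[OF has_integral_eq[rotated]])
       (use assms in \<open>simp_all add: field_simps power_mult_distrib\<close>)
qed

lemma has_integral_circle_Re_coeff: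
  assumes p: "p holomorphic_on unit_disc" and r: "0 < r" "r < 1" and Im: "Im (p 0) = 0"
  shows "((\<lambda>t. inverse (unit_pt t) ^ k * of_real (Re (p (of_real r * unit_pt t)))) has_integral
    of_real r ^ k * (if k = 0 then p 0 else tcoeff p k / 2)) {0..1}"
proof -
  let ?u = "\<lambda>t. of_real r * unit_pt t"
  \<comment> \<open>For k >= 1 the function z^k p vanishes at 0, so its circle mean is 0;
    conjugated, this removes cnj p from 2 Re p = p + cnj p. For k = 0 the mean is p 0, which is
    real.\<close>
  have "(\<lambda>z. z ^ k * p z) holomorphic_on unit_disc"
    by (intro holomorphic_intros p)
  from has_integral_circle_coeff[OF this r, of 0]
  have "((\<lambda>t. ?u t ^ k * p (?u t)) has_integral (if k = 0 then p 0 else 0)) {0..1}"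
    by (cases "k = 0") (auto simp: power_0_left)
  then have "((\<lambda>t. cnj (?u t ^ k * p (?u t))) has_integral cnj (if k = 0 then p 0 else 0)) {0..1}"
    by (rule has_integral_linear[OF _ bounded_linear_cnj, unfolded o_def])
  then have "((\<lambda>t. of_real (1 / r ^ k) * cnj (?u t ^ k * p (?u t))) has_integral
      of_real (1 / r ^ k) * cnj (if k = 0 then p 0 else 0)) {0..1}"
    by (rule has_integral_mult_right)
  then have "((\<lambda>t. cnj (p (?u t)) * inverse (unit_pt t) ^ k) has_integral (if k = 0 then p 0 else 0)) {0..1}"
    by (rule has_integral_eq_rhs[OF has_integral_eq[rotated]])
       (use r Im in \<open>auto simp: power_mult_distrib cnj_unit_pt complex_eq_iff\<close>)
  from has_integral_add[OF has_integral_circle_coeff[OF p r, of k] this]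
  have "((\<lambda>t. 1/2 * (p (?u t) * inverse (unit_pt t) ^ k + cnj (p (?u t)) * inverse (unit_pt t) ^ k)) has_integral
     1/2 * (of_real r ^ k * tcoeff p k + (if k = 0 then p 0 else 0))) {0..1}"
    by (rule has_integral_mult_right)
  then show ?thesis
  proof (rule has_integral_eq_rhs[OF has_integral_eq[rotated]])
    fix t :: real
    show "1/2 * (p (?u t) * inverse (unit_pt t) ^ k + cnj (p (?u t)) * inverse (unit_pt t) ^ k) =
       inverse (unit_pt t) ^ k * of_real (Re (p (?u t)))"
      unfolding distrib_right[symmetric] complex_add_cnj by simp
  qed auto
qed

text \<open>The mean of \<open>\<phi>\<close> against the measure \<open>Re p(r e\<^sup>i\<^sup>t) dt\<close>, read in the variable \<open>\<alpha> = e\<^sup>-\<^sup>i\<^sup>t\<close>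
  so that \<open>\<alpha>\<^sup>k\<close> picks out the \<open>k\<close>-th Taylor coefficient of \<open>p\<close>.\<close>

definition rmean :: "(complex \<Rightarrow> complex) \<Rightarrow> real \<Rightarrow> (complex \<Rightarrow> complex) \<Rightarrow> complex" where
  "rmean p r \<phi> = integral {0..1} (\<lambda>t. \<phi> (inverse (unit_pt t)) * of_real (Re (p (of_real r * unit_pt t))))"

context
  fixes p :: "complex \<Rightarrow> complex"
  assumes p: "p holomorphic_on unit_disc" and Re_p: "\<And>z. z \<in> unit_disc \<Longrightarrow> Re (p z) \<ge> 0"
    and Im_p: "Im (p 0) = 0"
begin

lemma Re_p_circle: "0 < r \<Longrightarrow> r < 1 \<Longrightarrow> Re (p (of_real r * unit_pt t)) \<ge> 0"
  by (rule Re_p) (simp add: unit_disc_def norm_mult)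

lemma continuous_rmean:
  fixes \<phi> :: "complex \<Rightarrow> complex"
  assumes "continuous_on (sphere 0 1) \<phi>" "0 < r" "r < 1"
  shows "continuous_on {0..1} (\<lambda>t. \<phi> (inverse (unit_pt t)) * of_real (Re (p (of_real r * unit_pt t))))"
  using assms
  by (intro continuous_intros continuous_on_compose2[OF assms(1)]
      continuous_on_compose2[OF holomorphic_on_imp_continuous_on[OF p]])
     (auto simp: unit_disc_def norm_mult norm_inverse)

lemma rmean_integrable:
  fixes \<phi> :: "complex \<Rightarrow> complex"
  assumes "continuous_on (sphere 0 1) \<phi>" "0 < r" "r < 1"
  shows "(\<lambda>t. \<phi> (inverse (unit_pt t)) * of_real (Re (p (of_real r * unit_pt t)))) integrable_on {0..1}"
  by (rule integrable_continuous_real[OF continuous_rmean[OF assms]])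

lemma rmean_diff:
  assumes "continuous_on (sphere 0 1) \<phi>" "continuous_on (sphere 0 1) \<psi>" "0 < r" "r < 1"
  shows "rmean p r (\<lambda>a. \<phi> a - \<psi> a) = rmean p r \<phi> - rmean p r \<psi>"
  unfolding rmean_def
  by (subst integral_diff[symmetric])
     (use assms in \<open>auto intro: rmean_integrable simp: left_diff_distrib\<close>)

lemma rmean_cmult: "rmean p r (\<lambda>a. c * \<phi> a) = c * rmean p r \<phi>"
  unfolding rmean_def by (simp add: mult.assoc)

lemma rmean_sum:
  assumes "finite A" "\<And>i. i \<in> A \<Longrightarrow> continuous_on (sphere 0 1) (\<phi> i)" "0 < r" "r < 1"
  shows "rmean p r (\<lambda>a. \<Sum>i\<in>A. \<phi> i a) = (\<Sum>i\<in>A. rmean p r (\<phi> i))"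
  unfolding rmean_def
  by (subst integral_sum[symmetric])
     (use assms in \<open>auto intro: rmean_integrable simp: sum_distrib_right\<close>)

lemma rmean_power:
  assumes "0 < r" "r < 1"
  shows "rmean p r (\<lambda>a. a ^ k) = of_real r ^ k * (if k = 0 then p 0 else tcoeff p k / 2)"
  unfolding rmean_def by (rule integral_unique[OF has_integral_circle_Re_coeff[OF p assms Im_p]])

text \<open>For polynomial test functions the limit r -> 1 is explicit, so these limits take the
  place of integrals against the Herglotz measure of p.\<close>

lemma rmean_poly_tendsto:
  "((\<lambda>r. rmean p r (\<lambda>a. \<Sum>k\<le>n. c k * a ^ k)) \<longlongrightarrow>
    (\<Sum>k\<le>n. c k * (if k = 0 then p 0 else tcoeff p k / 2))) (at_left 1)"
proof -
  have "((\<lambda>r. \<Sum>k\<le>n. c k * (of_real r ^ k * (if k = 0 then p 0 else tcoeff p k / 2))) \<longlongrightarrow>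
     (\<Sum>k\<le>n. c k * (of_real 1 ^ k * (if k = 0 then p 0 else tcoeff p k / 2)))) (at_left 1)"
    by (intro tendsto_intros)
  moreover have "eventually (\<lambda>r. (\<Sum>k\<le>n. c k * (of_real r ^ k * (if k = 0 then p 0 else tcoeff p k / 2))) =
      rmean p r (\<lambda>a. \<Sum>k\<le>n. c k * a ^ k)) (at_left (1::real))"
    unfolding eventually_at_left_field
  proof (intro exI[of _ 0] conjI allI impI)
    fix r :: real assume r: "0 < r" "r < 1"
    show "(\<Sum>k\<le>n. c k * (of_real r ^ k * (if k = 0 then p 0 else tcoeff p k / 2))) =
      rmean p r (\<lambda>a. \<Sum>k\<le>n. c k * a ^ k)"
      using r by (subst rmean_sum) (auto intro!: continuous_intros simp: rmean_cmult rmean_power)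
  qed simp
  ultimately show ?thesis
    by (subst (asm) tendsto_cong) (auto elim: eventually_mono)
qed

lemma rmean_norm_le:
  assumes "continuous_on (sphere 0 1) \<phi>" "continuous_on (sphere 0 1) g" "0 < r" "r < 1"
    and "\<And>a. norm a = 1 \<Longrightarrow> norm (\<phi> a) \<le> Re (g a)"
  shows "norm (rmean p r \<phi>) \<le> Re (rmean p r g)"
proof -
  have "norm (rmean p r \<phi>) \<le> integral {0..1}
      (\<lambda>t. Re (g (inverse (unit_pt t)) * of_real (Re (p (of_real r * unit_pt t)))))"
    unfolding rmean_def
  proof (rule integral_norm_bound_integral)
    show "(\<lambda>t. Re (g (inverse (unit_pt t)) * of_real (Re (p (of_real r * unit_pt t))))) integrable_on {0..1}"
      by (intro integrable_continuous_real continuous_intros continuous_rmean assms)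
    fix t :: real
    have "norm (\<phi> (inverse (unit_pt t))) * Re (p (of_real r * unit_pt t)) \<le>
       Re (g (inverse (unit_pt t))) * Re (p (of_real r * unit_pt t))"
      using assms Re_p_circle by (intro mult_right_mono) (auto simp: norm_inverse)
    then show "norm (\<phi> (inverse (unit_pt t)) * of_real (Re (p (of_real r * unit_pt t)))) \<le>
       Re (g (inverse (unit_pt t)) * of_real (Re (p (of_real r * unit_pt t))))"
      using Re_p_circle[OF assms(3,4), of t] by (simp add: norm_mult)
  qed (use assms in \<open>auto intro: rmean_integrable\<close>)
  also have "\<dots> = Re (rmean p r g)"
    unfolding rmean_def
    using integral_linear[OF rmean_integrable[OF assms(2-4)] bounded_linear_Re] by (simp add: o_def)
  finally show ?thesis .
qed

text \<open>A function vanishing wherever \<open>Re U\<close> does is bounded by \<open>\<epsilon> + C Re U\<close>, whatever the order of the zeros.\<close>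

lemma rmean_tendsto_0:
  assumes \<phi>: "continuous_on (sphere 0 1) \<phi>" and U: "continuous_on (sphere 0 1) U"
    and U_nonneg: "\<And>a. norm a = 1 \<Longrightarrow> Re (U a) \<ge> 0"
    and U_lim: "((\<lambda>r. Re (rmean p r U)) \<longlongrightarrow> 0) (at_left 1)"
    and zero: "\<And>a. norm a = 1 \<Longrightarrow> Re (U a) = 0 \<Longrightarrow> \<phi> a = 0"
  shows "((\<lambda>r. rmean p r \<phi>) \<longlongrightarrow> 0) (at_left 1)"
proof (rule tendstoI)
  fix e :: real assume e: "e > 0"
  have p0: "Re (p 0) \<ge> 0" using Re_p by simp
  \<comment> \<open>This makes d * Re (p 0) at most e / 2; the + 1 covers Re (p 0) = 0.\<close>
  define d where "d = e / (2 * (Re (p 0) + 1))"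
  have d: "d > 0" using e p0 by (simp add: d_def)
  obtain C where C: "\<And>a. norm a = 1 \<Longrightarrow> norm (\<phi> a) \<le> d + C * Re (U a)" "C \<ge> 0"
  proof -
    \<comment> \<open>Off the compact set K the bound d suffices. On K, Re U is positive and hence
      at least its minimum \<open>Re (U b)\<close>, so C = B / Re (U b) works.\<close>
    define K where "K = {a\<in>sphere 0 1. norm (\<phi> a) \<ge> d}"
    have "closedin (top_of_set (sphere 0 1)) (sphere 0 1 \<inter> (\<lambda>a. norm (\<phi> a)) -` {d..})"
      by (intro continuous_closedin_preimage continuous_on_norm \<phi>) auto
    moreover have "K = sphere 0 1 \<inter> (\<lambda>a. norm (\<phi> a)) -` {d..}" by (auto simp: K_def)
    ultimately have "compact K"
      using closedin_compact[OF compact_sphere] by metis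
    obtain B where B: "\<And>a. norm a = 1 \<Longrightarrow> norm (\<phi> a) \<le> B"
      using compact_imp_bounded[OF compact_continuous_image[OF \<phi> compact_sphere]]
      unfolding bounded_iff by (metis image_eqI mem_sphere_0)
    have B0: "B \<ge> 0" using order_trans[OF norm_ge_zero B[of 1]] by simp
    show ?thesis
    proof (cases "K = {}")
      case True
      then show ?thesis by (intro that[of 0]) (force simp: K_def)+
    next
      case False
      have "continuous_on K (\<lambda>a. Re (U a))"
        by (intro continuous_intros continuous_on_subset[OF U]) (auto simp: K_def)
      with continuous_attains_inf[OF \<open>compact K\<close> False]
      obtain b where b: "b \<in> K" "\<And>a. a \<in> K \<Longrightarrow> Re (U b) \<le> Re (U a)" by blast
      have bpos: "Re (U b) > 0"
        using b(1) U_nonneg[of b] zero[of b] d by (force simp: K_def)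
      show ?thesis
      proof (rule that[of "B / Re (U b)"])
        fix a :: complex assume a: "norm a = 1"
        show "norm (\<phi> a) \<le> d + B / Re (U b) * Re (U a)"
        proof (cases "a \<in> K")
          case True
          then have "B \<le> B / Re (U b) * Re (U a)"
            using b(2)[OF True] bpos B0 by (simp add: field_simps mult_left_mono)
          then show ?thesis using B[OF a] d by linarith
        next
          case False
          then have "norm (\<phi> a) < d" using a by (simp add: K_def)
          moreover have "B / Re (U b) * Re (U a) \<ge> 0" using B0 bpos U_nonneg[OF a] by simp
          ultimately show ?thesis by linarith
        qed
      qed (use B0 bpos in simp)
    qed
  qed
  have "((\<lambda>r. d * Re (p 0) + C * Re (rmean p r U)) \<longlongrightarrow> d * Re (p 0) + C * 0) (at_left 1)"
    by (intro tendsto_intros U_lim)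
  moreover have "d * Re (p 0) + C * 0 < e"
  proof -
    have "d * Re (p 0) \<le> d * (Re (p 0) + 1)" using d by simp
    also have "\<dots> = e / 2" using p0 by (simp add: d_def field_simps)
    finally show ?thesis using e by simp
  qed
  ultimately have ev: "eventually (\<lambda>r. d * Re (p 0) + C * Re (rmean p r U) < e) (at_left 1)"
    by (rule order_tendstoD(2))
  have "eventually (\<lambda>r::real. 0 < r \<and> r < 1) (at_left 1)"
    unfolding eventually_at_left_field by (intro exI[of _ 0]) auto
  with ev show "eventually (\<lambda>r. dist (rmean p r \<phi>) 0 < e) (at_left 1)"
  proof eventually_elim
    case (elim r)
    then have r: "0 < r" "r < 1" by auto
    \<comment> \<open>The majorant d + C U is written with a^0 and as a difference so that the rules
      for means of powers, multiples and differences apply.\<close>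
    have cont: "continuous_on (sphere 0 1) (\<lambda>a. of_real d * a ^ 0 :: complex)"
      "continuous_on (sphere 0 1) (\<lambda>a. (- of_real C) * U a)"
      by (intro continuous_intros U)+
    have "norm (rmean p r \<phi>) \<le> Re (rmean p r (\<lambda>a. of_real d * a ^ 0 - (- of_real C) * U a))"
      using r C by (intro rmean_norm_le \<phi> continuous_on_diff cont) auto
    also have "rmean p r (\<lambda>a. of_real d * a ^ 0 - (- of_real C) * U a) =
        of_real d * p 0 + of_real C * rmean p r U"
      using rmean_power[OF r, of 0] unfolding rmean_diff[OF cont r] rmean_cmult by simp
    finally show ?case using elim by simp
  qed
qed

end

text \<open>On the unit circle conjugation is inversion, so a^n times twice the real part is a
  polynomial in a of degree 2 n with top coefficient \<open>c n\<close>.\<close>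

lemma finite_zeros_Re_poly_circle:
  fixes c :: "nat \<Rightarrow> complex"
  assumes "n \<ge> 1" "c n \<noteq> 0"
  shows "finite {a. norm a = 1 \<and> Re (\<Sum>k\<le>n. c k * a ^ k) = 0}"
proof -
  define V where "V = (\<Sum>k\<le>n. monom (c k) (n + k) + monom (cnj (c k)) (n - k))"
  have "coeff V (2 * n) = (\<Sum>k\<le>n. if k = n then c n else 0)"
    unfolding V_def coeff_sum using assms(1) by (intro sum.cong) auto
  then have "V \<noteq> 0" using assms(2) by auto
  moreover have "{a. norm a = 1 \<and> Re (\<Sum>k\<le>n. c k * a ^ k) = 0} \<subseteq> {a. poly V a = 0}"
  proof safe
    fix a :: complex assume a: "norm a = 1" and z: "Re (\<Sum>k\<le>n. c k * a ^ k) = 0"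
    have "a * cnj a = 1" using a by (simp add: complex_norm_square[symmetric])
    have "a ^ (n - k) = a ^ n * cnj a ^ k" if "k \<le> n" for k
    proof -
      have "a ^ n * cnj a ^ k = a ^ (n - k) * (a * cnj a) ^ k"
        using that by (simp add: power_mult_distrib mult.assoc[symmetric] flip: power_add)
      then show ?thesis using \<open>a * cnj a = 1\<close> by simp
    qed
    then have "poly V a = a ^ n * ((\<Sum>k\<le>n. c k * a ^ k) + cnj (\<Sum>k\<le>n. c k * a ^ k))"
      unfolding V_def by (simp add: poly_sum poly_monom power_add sum.distrib sum_distrib_left distrib_left mult_ac)
    then show "poly V a = 0" by (simp only: complex_add_cnj z) simp
  qed
  ultimately show ?thesis using poly_roots_finite finite_subset by blast
qed

lemma extremal_nonzero_coeff:
  assumes "extremal n f" "n \<ge> 1"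
  shows "tcoeff f n \<noteq> 0"
proof
  assume "tcoeff f n = 0"
  then show False using Mfun_extremal_ge[OF assms] by (simp add: Mfun_def)
qed

text \<open>Extremality makes Re U nonnegative on the circle and its means against Re p tend to 0,
  so in the limit only the finite zero set Z of Re U carries mass. Lagrange interpolation on Z turns
  the moments of p into finitely many weights.\<close>

lemma extremal_has_atoms:
  assumes f: "extremal n f" and n: "n \<ge> 1"
  obtains N where "has_atoms f N"
proof -
  have fB: "f \<in> B0" using f by (simp add: extremal_def)
  note fh = B0_D(1)[OF fB]
  obtain c p where c: "norm c = 1" and p: "p holomorphic_on unit_disc" and Im_p: "Im (p 0) = 0"
    and frep: "\<And>z. z \<in> unit_disc \<Longrightarrow> f z = c * exp (- p z)"
    and Re_p: "\<And>z. z \<in> unit_disc \<Longrightarrow> Re (p z) \<ge> 0"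
    using B0_exp_rep[OF fB] by blast
  \<comment> \<open>\<open>U a\<close> is the n-th coefficient of f times the kernel 1 + 2 a z + 2
    a^2 z^2 + ..., so \<open>Re (U a)\<close> tests extremality against an atom added at a.\<close>
  define C where "C = (\<lambda>k. (if k = 0 then 1 else 2) * tcoeff f (n - k))"
  define U where "U = (\<lambda>a. \<Sum>k\<le>n. C k * a ^ k)"
  define m where "m = (\<lambda>k. if k = 0 then p 0 else tcoeff p k / 2)"
  have U_nonneg: "Re (U a) \<ge> 0" if a: "norm a = 1" for a
  proof -
    let ?q = "\<lambda>z. (1 + a * z) / (1 - a * z)"
    have q: "?q holomorphic_on unit_disc" using a by (intro holomorphic_Mobius) simp
    have "Re (tcoeff (\<lambda>z. f z * ?q z) n) \<ge> 0"
      using a by (intro extremal_add_Re_nonneg[OF f q] Re_Cayley_nonneg) (simp add: unit_disc_def norm_mult)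
    moreover have "tcoeff (\<lambda>z. f z * ?q z) n = tcoeff (\<lambda>z. ?q z * f z) n"
      by (simp only: mult.commute)
    moreover have "tcoeff (\<lambda>z. ?q z * f z) n = U a"
      unfolding tcoeff_mult[OF q fh] U_def C_def
      using a by (intro sum.cong) (auto simp: tcoeff_Mobius)
    ultimately show ?thesis by simp
  qed
  \<comment> \<open>The exponent p may be perturbed along itself in both directions: f exp(t p) has
    exponent (1 - t) p.\<close>
  have fp0: "Re (tcoeff (\<lambda>z. f z * p z) n) = 0"
  proof (rule antisym)
    show "Re (tcoeff (\<lambda>z. f z * p z) n) \<le> 0"
    proof (rule extremal_variation[OF f p])
      fix t :: real assume t: "0 < t" "t < 1"
      show "(\<lambda>z. f z * exp (of_real t * p z)) \<in> B0"
      proof (rule B0_tcoeff_cong_mem[OF exp_minus_in_B0[of "\<lambda>z. of_real (1 - t) * p z" c]])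
        fix z assume "z \<in> unit_disc"
        then show "f z * exp (of_real t * p z) = c * exp (- (of_real (1 - t) * p z))"
          by (simp add: frep mult.assoc algebra_simps flip: exp_add)
      qed (use t c p Re_p in \<open>auto intro!: holomorphic_intros\<close>)
    qed
  qed (rule extremal_add_Re_nonneg[OF f p Re_p])
  have Ucont: "continuous_on (sphere 0 1) U"
    unfolding U_def by (intro continuous_intros)
  have Ulim: "((\<lambda>r. Re (rmean p r U)) \<longlongrightarrow> 0) (at_left 1)"
  proof -
    have "(\<Sum>k\<le>n. C k * m k) = tcoeff (\<lambda>z. p z * f z) n"
      unfolding tcoeff_mult[OF p fh] C_def m_def by (intro sum.cong) auto
    moreover have "((\<lambda>r. rmean p r U) \<longlongrightarrow> (\<Sum>k\<le>n. C k * m k)) (at_left 1)"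
      unfolding U_def m_def by (rule rmean_poly_tendsto[OF p Re_p Im_p])
    ultimately have "((\<lambda>r. rmean p r U) \<longlongrightarrow> tcoeff (\<lambda>z. p z * f z) n) (at_left 1)"
      by simp
    from tendsto_Re[OF this] show ?thesis using fp0 by (simp add: mult.commute)
  qed
  define Z where "Z = {a. norm a = 1 \<and> Re (U a) = 0}"
  have finZ: "finite Z"
    unfolding Z_def U_def using B0_D(2)[OF fB, of 0] n
    by (intro finite_zeros_Re_poly_circle) (auto simp: C_def)
  note vanish = rmean_tendsto_0[OF p Re_p Im_p _ Ucont U_nonneg Ulim]
  \<comment> \<open>Lagrange basis polynomials for the nodes Z.\<close>
  define P where "P = (\<lambda>\<zeta>. smult (1 / (\<Prod>i\<in>Z-{\<zeta>}. \<zeta> - i)) (\<Prod>i\<in>Z-{\<zeta>}. [:-i, 1:]))"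
  define L where "L = (\<lambda>\<zeta>. poly (P \<zeta>))"
  have L: "L \<zeta> x = (if x = \<zeta> then 1 else 0)" if "\<zeta> \<in> Z" "x \<in> Z" for \<zeta> x
    using that finZ by (auto simp: L_def P_def poly_prod)
  have Lcont: "continuous_on A (L \<zeta>)" for A \<zeta>
    unfolding L_def by (intro continuous_intros)
  have "\<exists>w. ((\<lambda>r. rmean p r (L \<zeta>)) \<longlongrightarrow> w) (at_left 1)" for \<zeta>
    unfolding L_def poly_altdef using rmean_poly_tendsto[OF p Re_p Im_p] by blast
  then obtain w where w: "\<And>\<zeta>. ((\<lambda>r. rmean p r (L \<zeta>)) \<longlongrightarrow> w \<zeta>) (at_left 1)"
    by metis
  have r01: "eventually (\<lambda>r::real. 0 < r \<and> r < 1) (at_left 1)"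
    unfolding eventually_at_left_field by (intro exI[of _ 0]) auto
  have w_real: "Im (w \<zeta>) = 0 \<and> Re (w \<zeta>) \<ge> 0" if \<zeta>: "\<zeta> \<in> Z" for \<zeta>
  proof -
    \<comment> \<open>On Z the values of L are 0 and 1, so L and its squared modulus agree there and
      have the same limit. The means of the squared modulus are real and nonnegative.\<close>
    let ?S = "\<lambda>a. of_real ((norm (L \<zeta> a))\<^sup>2) :: complex"
    have Scont: "continuous_on (sphere 0 1) ?S" by (intro continuous_intros Lcont)
    have "((\<lambda>r. rmean p r (\<lambda>a. L \<zeta> a - ?S a)) \<longlongrightarrow> 0) (at_left 1)"
    proof (rule vanish)
      show "continuous_on (sphere 0 1) (\<lambda>a. L \<zeta> a - ?S a)" by (intro continuous_intros Lcont)
    qed (auto simp: L[OF \<zeta>] Z_def)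
    from tendsto_diff[OF w this] have "((\<lambda>r. rmean p r (L \<zeta>) - rmean p r (\<lambda>a. L \<zeta> a - ?S a)) \<longlongrightarrow> w \<zeta>) (at_left 1)"
      by simp
    moreover have "eventually (\<lambda>r. rmean p r (L \<zeta>) - rmean p r (\<lambda>a. L \<zeta> a - ?S a) = rmean p r ?S) (at_left 1)"
      using r01 by eventually_elim (subst rmean_diff[OF p Re_p Im_p Lcont Scont], auto)
    ultimately have lim: "((\<lambda>r. rmean p r ?S) \<longlongrightarrow> w \<zeta>) (at_left 1)"
      by (rule Lim_transform_eventually)
    have S: "Im (rmean p r ?S) = 0 \<and> Re (rmean p r ?S) \<ge> 0" if r: "0 < r" "r < 1" for r
    proof -
      note int = rmean_integrable[OF p Re_p Im_p Scont r]
      have "Im (rmean p r ?S) = integral {0..1} (\<lambda>t. 0)"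
        unfolding rmean_def using integral_linear[OF int bounded_linear_Im] by (simp add: o_def)
      moreover have "Re (rmean p r ?S) = integral {0..1} (\<lambda>t. (norm (L \<zeta> (inverse (unit_pt t))))\<^sup>2 * Re (p (of_real r * unit_pt t)))"
        unfolding rmean_def using integral_linear[OF int bounded_linear_Re] by (simp add: o_def)
      moreover have "\<dots> \<ge> 0"
        using integrable_linear[OF int bounded_linear_Re] Re_p_circle[OF p Re_p Im_p r]
        by (intro integral_nonneg) (auto simp: o_def)
      ultimately show ?thesis by simp
    qed
    have "((\<lambda>r. Im (rmean p r ?S)) \<longlongrightarrow> 0) (at_left 1)"
      by (rule tendsto_eventually) (rule eventually_mono[OF r01], use S in blast)
    then have "Im (w \<zeta>) = 0"
      using tendsto_unique[OF _ tendsto_Im[OF lim]] by simp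
    moreover have "Re (w \<zeta>) \<ge> 0"
      by (rule tendsto_lowerbound[OF tendsto_Re[OF lim]]) (rule eventually_mono[OF r01], use S in blast, simp)
    ultimately show ?thesis by simp
  qed
  have moments: "m k = (\<Sum>\<zeta>\<in>Z. \<zeta> ^ k * w \<zeta>)" for k
  proof -
    \<comment> \<open>The power a^k minus its interpolant vanishes on Z, so its means tend to 0.
      This gives the moments of every order k from the weights.\<close>
    let ?\<phi> = "\<lambda>a. a ^ k - (\<Sum>\<zeta>\<in>Z. \<zeta> ^ k * L \<zeta> a)"
    have sc: "continuous_on (sphere 0 1) (\<lambda>a. \<Sum>\<zeta>\<in>Z. \<zeta> ^ k * L \<zeta> a)"
      by (intro continuous_intros Lcont)
    have "((\<lambda>r. rmean p r ?\<phi>) \<longlongrightarrow> 0) (at_left 1)"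
    proof (rule vanish)
      show "continuous_on (sphere 0 1) ?\<phi>" by (intro continuous_intros sc)
      fix a :: complex assume "norm a = 1" "Re (U a) = 0"
      then have a: "a \<in> Z" by (simp add: Z_def)
      have "(\<Sum>\<zeta>\<in>Z. \<zeta> ^ k * L \<zeta> a) = (\<Sum>\<zeta>\<in>Z. if \<zeta> = a then a ^ k else 0)"
        using a by (intro sum.cong) (auto simp: L)
      then show "?\<phi> a = 0" using a finZ by simp
    qed auto
    moreover have "eventually (\<lambda>r. rmean p r ?\<phi> = of_real r ^ k * m k - (\<Sum>\<zeta>\<in>Z. \<zeta> ^ k * rmean p r (L \<zeta>))) (at_left 1)"
      using r01
    proof eventually_elim
      case (elim r)
      then have r: "0 < r" "r < 1" by auto
      have "rmean p r (\<lambda>a. \<Sum>\<zeta>\<in>Z. \<zeta> ^ k * L \<zeta> a) = (\<Sum>\<zeta>\<in>Z. \<zeta> ^ k * rmean p r (L \<zeta>))"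
        by (subst rmean_sum[OF p Re_p Im_p finZ _ r])
           (auto intro!: continuous_intros Lcont simp: rmean_cmult[OF p Re_p Im_p])
      moreover have "continuous_on (sphere 0 1) (\<lambda>a::complex. a ^ k)" by (intro continuous_intros)
      ultimately show ?case
        by (simp only: rmean_diff[OF p Re_p Im_p _ sc r] rmean_power[OF p Re_p Im_p r] m_def)
    qed
    ultimately have "((\<lambda>r. of_real r ^ k * m k - (\<Sum>\<zeta>\<in>Z. \<zeta> ^ k * rmean p r (L \<zeta>))) \<longlongrightarrow> 0) (at_left 1)"
      by (rule Lim_transform_eventually)
    moreover have "((\<lambda>r. of_real r ^ k * m k - (\<Sum>\<zeta>\<in>Z. \<zeta> ^ k * rmean p r (L \<zeta>))) \<longlongrightarrow>
        of_real 1 ^ k * m k - (\<Sum>\<zeta>\<in>Z. \<zeta> ^ k * w \<zeta>)) (at_left 1)"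
      by (intro tendsto_intros w)
    ultimately have "0 = of_real 1 ^ k * m k - (\<Sum>\<zeta>\<in>Z. \<zeta> ^ k * w \<zeta>)"
      by (rule tendsto_unique[rotated]) simp
    then show ?thesis by simp
  qed
  \<comment> \<open>\<open>has_atoms\<close> demands positive masses, so nodes of weight 0 are
    dropped.\<close>
  define A where "A = {\<zeta>\<in>Z. w \<zeta> \<noteq> 0}"
  have A: "finite A" "A \<subseteq> Z" using finZ by (auto simp: A_def)
  have Z1: "norm \<zeta> = 1" if "\<zeta> \<in> Z" for \<zeta> using that by (simp add: Z_def)
  have hM: "(\<lambda>z. (1 + \<zeta> * z) / (1 - \<zeta> * z)) holomorphic_on unit_disc" if "\<zeta> \<in> A" for \<zeta>
    using that A Z1 by (intro holomorphic_Mobius) auto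
  have hM': "(\<lambda>z. w \<zeta> * ((1 + \<zeta> * z) / (1 - \<zeta> * z))) holomorphic_on unit_disc" if "\<zeta> \<in> A" for \<zeta>
    by (rule holomorphic_on_mult[OF holomorphic_on_const hM[OF that]])
  have prep: "p z = (\<Sum>\<zeta>\<in>A. w \<zeta> * ((1 + \<zeta> * z) / (1 - \<zeta> * z)))" if z: "z \<in> unit_disc" for z
  proof (rule tcoeff_eqD[OF p _ _ z])
    show "(\<lambda>z. \<Sum>\<zeta>\<in>A. w \<zeta> * ((1 + \<zeta> * z) / (1 - \<zeta> * z))) holomorphic_on unit_disc"
      using hM' by (rule holomorphic_on_sum)
    fix k
    have "tcoeff (\<lambda>z. \<Sum>\<zeta>\<in>A. w \<zeta> * ((1 + \<zeta> * z) / (1 - \<zeta> * z))) k =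
        (\<Sum>\<zeta>\<in>A. tcoeff (\<lambda>z. w \<zeta> * ((1 + \<zeta> * z) / (1 - \<zeta> * z))) k)"
      by (rule tcoeff_sum[OF hM'])
    also have "\<dots> = (\<Sum>\<zeta>\<in>A. w \<zeta> * (if k = 0 then 1 else 2 * \<zeta> ^ k))"
    proof (rule sum.cong[OF refl])
      fix \<zeta> assume \<zeta>: "\<zeta> \<in> A"
      then have "norm \<zeta> \<le> 1" using A Z1 by auto
      then show "tcoeff (\<lambda>z. w \<zeta> * ((1 + \<zeta> * z) / (1 - \<zeta> * z))) k = w \<zeta> * (if k = 0 then 1 else 2 * \<zeta> ^ k)"
        unfolding tcoeff_cmult[OF hM[OF \<zeta>]] by (simp only: tcoeff_Mobius)
    qed
    also have "\<dots> = (\<Sum>\<zeta>\<in>Z. w \<zeta> * (if k = 0 then 1 else 2 * \<zeta> ^ k))"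
      using finZ by (intro sum.mono_neutral_left) (auto simp: A_def)
    also have "\<dots> = (if k = 0 then 1 else 2) * m k"
      unfolding moments by (auto simp: sum_distrib_left mult_ac)
    finally show "tcoeff p k = tcoeff (\<lambda>z. \<Sum>\<zeta>\<in>A. w \<zeta> * ((1 + \<zeta> * z) / (1 - \<zeta> * z))) k"
      by (simp add: m_def)
  qed
  obtain h where h: "bij_betw h {0..<card A} A"
    using ex_bij_betw_nat_finite[OF A(1)] by auto
  \<comment> \<open>Without atoms f would be constant on the disc, although its n-th coefficient is
    nonzero.\<close>
  have "A \<noteq> {}"
  proof
    assume "A = {}"
    then have "f z = c" if "z \<in> unit_disc" for z using that by (simp add: frep prep)
    then have "tcoeff f n = 0" using tcoeff_cong[of f "\<lambda>z. c" n] n by (simp add: tcoeff_const)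
    then show False using extremal_nonzero_coeff[OF f n] by simp
  qed
  then have card: "1 \<le> card A" using A(1) by (simp add: Suc_leI card_gt_0_iff)
  have hA: "h j \<in> A" if "j < card A" for j using h that by (auto simp: bij_betw_def)
  have "has_atoms f (card A)"
    unfolding has_atoms_def
  proof (intro conjI card exI[of _ c] exI[of _ "\<lambda>j. Re (w (h j))"] exI[of _ h] allI impI ballI c)
    fix j assume "j < card A"
    then have j: "h j \<in> A" by (rule hA)
    then have "w (h j) \<noteq> 0" "Im (w (h j)) = 0" "Re (w (h j)) \<ge> 0" using w_real A by (auto simp: A_def)
    then show "Re (w (h j)) > 0" by (auto simp: complex_eq_iff)
    show "norm (h j) = 1" using j A Z1 by auto
  next
    show "inj_on h {..<card A}" using h by (simp add: bij_betw_def lessThan_atLeast0)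
    fix z assume z: "z \<in> unit_disc"
    have "p z = (\<Sum>j\<in>{0..<card A}. w (h j) * ((1 + h j * z) / (1 - h j * z)))"
      unfolding prep[OF z] by (rule sum.reindex_bij_betw[OF h, symmetric])
    also have "\<dots> = (\<Sum>j<card A. of_real (Re (w (h j))) * ((1 + h j * z) / (1 - h j * z)))"
      unfolding lessThan_atLeast0
    proof (rule sum.cong[OF refl])
      fix j assume "j \<in> {0..<card A}"
      then have "w (h j) = of_real (Re (w (h j)))" using w_real hA A by (auto simp: complex_eq_iff)
      then show "w (h j) * ((1 + h j * z) / (1 - h j * z)) = of_real (Re (w (h j))) * ((1 + h j * z) / (1 - h j * z))"
        by simp
    qed
    finally show "f z = c * exp (- (\<Sum>j<card A. of_real (Re (w (h j))) * ((1 + h j * z) / (1 - h j * z))))"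
      by (simp add: frep z)
  qed
  then show ?thesis by (rule that)
qed

section \<open>Atoms and their moments\<close>

text \<open>The vectors \<open>e i\<close> are orthogonal with squared norm l each. Scaling g by l
  avoids divisions: the squared norm of l g - h is nonnegative and expands to the claim times
  l.\<close>

lemma Bessel_finite:
  fixes g :: "nat \<Rightarrow> complex" and e :: "nat \<Rightarrow> nat \<Rightarrow> complex" and lam :: "nat \<Rightarrow> real"
  assumes "finite A" "finite I" and lam: "\<And>j. j \<in> A \<Longrightarrow> lam j \<ge> 0" and l: "l > 0"
    and orth: "\<And>i k. i \<in> I \<Longrightarrow> k \<in> I \<Longrightarrow>
      (\<Sum>j\<in>A. of_real (lam j) * (e i j * cnj (e k j))) = (if i = k then of_real l else 0)"
  shows "(\<Sum>i\<in>I. (norm (\<Sum>j\<in>A. of_real (lam j) * (g j * cnj (e i j))))\<^sup>2) \<le> l * (\<Sum>j\<in>A. lam j * (norm (g j))\<^sup>2)"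
proof -
  define \<nu> where "\<nu> = (\<lambda>i. \<Sum>j\<in>A. of_real (lam j) * (g j * cnj (e i j)))"
  \<comment> \<open>This is l times the orthogonal projection of g to the span of the
    \<open>e i\<close>.\<close>
  define h where "h = (\<lambda>j. \<Sum>i\<in>I. \<nu> i * e i j)"
  let ?B = "\<Sum>i\<in>I. \<nu> i * cnj (\<nu> i)"
  have gh: "(\<Sum>j\<in>A. of_real (lam j) * (g j * cnj (h j))) = ?B"
  proof -
    have "(\<Sum>j\<in>A. of_real (lam j) * (g j * cnj (h j))) =
        (\<Sum>j\<in>A. \<Sum>i\<in>I. cnj (\<nu> i) * (of_real (lam j) * (g j * cnj (e i j))))"
      by (simp add: h_def sum_distrib_left mult_ac)
    also have "\<dots> = (\<Sum>i\<in>I. cnj (\<nu> i) * \<nu> i)"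
      by (subst sum.swap) (simp add: \<nu>_def sum_distrib_left)
    finally show ?thesis by (simp add: mult.commute)
  qed
  have "cnj (\<Sum>j\<in>A. of_real (lam j) * (g j * cnj (h j))) = cnj ?B" using gh by simp
  then have hg: "(\<Sum>j\<in>A. of_real (lam j) * (h j * cnj (g j))) = ?B" by (simp add: mult_ac)
  have hh: "(\<Sum>j\<in>A. of_real (lam j) * (h j * cnj (h j))) = of_real l * ?B"
  proof -
    have hj: "h j * cnj (h j) = (\<Sum>i\<in>I. \<Sum>k\<in>I. \<nu> i * e i j * cnj (\<nu> k * e k j))" for j
      by (simp only: h_def cnj_sum sum_product)
    have "(\<Sum>j\<in>A. of_real (lam j) * (h j * cnj (h j))) =
        (\<Sum>j\<in>A. \<Sum>i\<in>I. \<Sum>k\<in>I. \<nu> i * cnj (\<nu> k) * (of_real (lam j) * (e i j * cnj (e k j))))"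
      unfolding hj sum_distrib_left by (intro sum.cong refl) (simp add: mult_ac)
    also have "\<dots> = (\<Sum>i\<in>I. \<Sum>k\<in>I. \<nu> i * cnj (\<nu> k) * (\<Sum>j\<in>A. of_real (lam j) * (e i j * cnj (e k j))))"
      unfolding sum_distrib_left by (subst sum.swap) (intro sum.cong refl sum.swap)
    also have "\<dots> = (\<Sum>i\<in>I. \<Sum>k\<in>I. \<nu> i * cnj (\<nu> k) * (if i = k then of_real l else 0))"
      by (intro sum.cong refl) (simp add: orth)
    also have "\<dots> = (\<Sum>i\<in>I. of_real l * (\<nu> i * cnj (\<nu> i)))"
      using \<open>finite I\<close> by (intro sum.cong refl) (simp add: if_distrib[of "\<lambda>x. _ * x"] mult_ac cong: if_cong)
    finally show ?thesis by (simp add: sum_distrib_left)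
  qed
  have "(\<Sum>j\<in>A. of_real (lam j) * ((of_real l * g j - h j) * cnj (of_real l * g j - h j))) =
      of_real (l * l) * (\<Sum>j\<in>A. of_real (lam j) * (g j * cnj (g j)))
      - of_real l * (\<Sum>j\<in>A. of_real (lam j) * (g j * cnj (h j)))
      - of_real l * (\<Sum>j\<in>A. of_real (lam j) * (h j * cnj (g j)))
      + (\<Sum>j\<in>A. of_real (lam j) * (h j * cnj (h j)))"
    unfolding sum_distrib_left sum_subtractf[symmetric] sum.distrib[symmetric]
    by (intro sum.cong refl) (simp add: algebra_simps)
  also have "\<dots> = of_real (l * l) * (\<Sum>j\<in>A. of_real (lam j) * (g j * cnj (g j))) - of_real l * ?B"
    unfolding gh hg hh by simp
  finally have eq: "(\<Sum>j\<in>A. lam j * (norm (of_real l * g j - h j))\<^sup>2) =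
      l * l * (\<Sum>j\<in>A. lam j * (norm (g j))\<^sup>2) - l * (\<Sum>i\<in>I. (norm (\<nu> i))\<^sup>2)"
    unfolding complex_norm_square[symmetric] of_real_mult[symmetric] of_real_sum[symmetric] of_real_diff[symmetric] of_real_eq_iff .
  have "(\<Sum>j\<in>A. lam j * (norm (of_real l * g j - h j))\<^sup>2) \<ge> 0"
    using lam by (intro sum_nonneg) auto
  then have "l * (\<Sum>i\<in>I. (norm (\<nu> i))\<^sup>2) \<le> l * (l * (\<Sum>j\<in>A. lam j * (norm (g j))\<^sup>2))"
    unfolding eq by simp
  then show ?thesis using l unfolding \<nu>_def by simp
qed

section \<open>Exponents with finitely many atoms\<close>

definition atom_exponent :: "nat \<Rightarrow> (nat \<Rightarrow> real) \<Rightarrow> (nat \<Rightarrow> complex) \<Rightarrow> complex \<Rightarrow> complex" where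
  "atom_exponent N lam \<alpha> z = (\<Sum>j<N. of_real (lam j) * ((1 + \<alpha> j * z) / (1 - \<alpha> j * z)))"

definition moment :: "nat \<Rightarrow> (nat \<Rightarrow> real) \<Rightarrow> (nat \<Rightarrow> complex) \<Rightarrow> nat \<Rightarrow> complex" where
  "moment N lam \<alpha> k = (\<Sum>j<N. of_real (lam j) * \<alpha> j ^ k)"

lemma has_atomsE:
  assumes "has_atoms f N"
  obtains \<gamma> lam \<alpha> where "1 \<le> N" "norm \<gamma> = 1" "\<And>j. j < N \<Longrightarrow> lam j > 0" "\<And>j. j < N \<Longrightarrow> norm (\<alpha> j) = 1"
    "inj_on \<alpha> {..<N}" "\<And>z. z \<in> unit_disc \<Longrightarrow> f z = \<gamma> * exp (- atom_exponent N lam \<alpha> z)"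
  using assms unfolding has_atoms_def atom_exponent_def by blast

lemma power_mult_cnj_power:
  fixes a :: complex
  assumes a: "norm a = 1" and ik: "i \<le> k"
  shows "a ^ k * cnj (a ^ i) = a ^ (k - i)"
proof -
  have "a * cnj a = 1" using a by (simp add: complex_norm_square[symmetric])
  then have "a ^ (k - i) * (a * cnj a) ^ i = a ^ (k - i)" by simp
  moreover have "a ^ k = a ^ (k - i) * a ^ i" using ik by (simp flip: power_add)
  ultimately show ?thesis by (simp add: power_mult_distrib mult.assoc)
qed

context
  fixes N :: nat and lam :: "nat \<Rightarrow> real" and \<alpha> :: "nat \<Rightarrow> complex"
  assumes lam: "\<And>j. j < N \<Longrightarrow> lam j > 0" and \<alpha>: "\<And>j. j < N \<Longrightarrow> norm (\<alpha> j) = 1"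
begin

lemma holomorphic_atom_summand:
  "j < N \<Longrightarrow> (\<lambda>z. of_real (lam j) * ((1 + \<alpha> j * z) / (1 - \<alpha> j * z))) holomorphic_on unit_disc"
  by (intro holomorphic_on_mult holomorphic_on_const holomorphic_Mobius) (simp add: \<alpha>)

lemma holomorphic_atom_exponent: "atom_exponent N lam \<alpha> holomorphic_on unit_disc"
  unfolding atom_exponent_def[abs_def] by (intro holomorphic_on_sum holomorphic_atom_summand) simp

lemma tcoeff_atom_exponent:
  "tcoeff (atom_exponent N lam \<alpha>) k = (if k = 0 then of_real (\<Sum>j<N. lam j) else 2 * moment N lam \<alpha> k)"
proof -
  have "tcoeff (atom_exponent N lam \<alpha>) k =
      (\<Sum>j<N. tcoeff (\<lambda>z. of_real (lam j) * ((1 + \<alpha> j * z) / (1 - \<alpha> j * z))) k)"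
    unfolding atom_exponent_def[abs_def] by (intro tcoeff_sum holomorphic_atom_summand) simp
  also have "\<dots> = (\<Sum>j<N. of_real (lam j) * (if k = 0 then 1 else 2 * \<alpha> j ^ k))"
  proof (rule sum.cong[OF refl])
    fix j assume "j \<in> {..<N}"
    then have "norm (\<alpha> j) \<le> 1" by (simp add: \<alpha>)
    then show "tcoeff (\<lambda>z. of_real (lam j) * ((1 + \<alpha> j * z) / (1 - \<alpha> j * z))) k =
        of_real (lam j) * (if k = 0 then 1 else 2 * \<alpha> j ^ k)"
      by (simp only: tcoeff_cmult holomorphic_Mobius tcoeff_Mobius)
  qed
  also have "\<dots> = (if k = 0 then of_real (\<Sum>j<N. lam j) else 2 * moment N lam \<alpha> k)"
    by (simp add: moment_def sum_distrib_left mult_ac)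
  finally show ?thesis .
qed

lemma atom_exponent_0: "atom_exponent N lam \<alpha> 0 = of_real (\<Sum>j<N. lam j)"
  by (simp add: atom_exponent_def)

lemma Re_atom_exponent_nonneg:
  assumes "z \<in> unit_disc"
  shows "Re (atom_exponent N lam \<alpha> z) \<ge> 0"
proof -
  have "Re (of_real (lam j) * ((1 + \<alpha> j * z) / (1 - \<alpha> j * z))) \<ge> 0" if "j < N" for j
  proof -
    have "Re ((1 + \<alpha> j * z) / (1 - \<alpha> j * z)) \<ge> 0"
      using assms \<alpha>[OF that] by (intro Re_Cayley_nonneg) (simp add: norm_mult unit_disc_def)
    then have "lam j * Re ((1 + \<alpha> j * z) / (1 - \<alpha> j * z)) \<ge> 0"
      using lam[OF that] by (intro mult_nonneg_nonneg) auto
    then show ?thesis by (simp only: Re_complex_of_real Im_complex_of_real times_complex.simps mult_zero_left diff_zero)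
  qed
  then show ?thesis unfolding atom_exponent_def Re_sum by (intro sum_nonneg) auto
qed

text \<open>Each 1 / (1 - \<alpha> z) is a geometric sum of length M over the common denominator 1 -
  \<beta> z^M. After weighting, the vanishing moments leave only the term i = 0.\<close>

lemma atom_exponent_same_power:
  assumes M: "M \<ge> 1" and pow: "\<And>j. j < N \<Longrightarrow> \<alpha> j ^ M = \<beta>"
    and mom: "\<And>k. 1 \<le> k \<Longrightarrow> k < M \<Longrightarrow> moment N lam \<alpha> k = 0"
    and z: "z \<in> unit_disc" and N: "N \<ge> 1"
  shows "atom_exponent N lam \<alpha> z = of_real (\<Sum>j<N. lam j) * ((1 + \<beta> * z ^ M) / (1 - \<beta> * z ^ M))"
proof -
  have nz: "1 - \<alpha> j * z \<noteq> 0" if "j < N" for j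
    using one_minus_mult_nz[OF _ z] \<alpha>[OF that] by simp
  have geo: "(1 - \<alpha> j * z) * (\<Sum>i<M. (\<alpha> j * z) ^ i) = 1 - \<beta> * z ^ M" if "j < N" for j
    using one_diff_power_eq[of "\<alpha> j * z" M] pow[OF that] by (simp add: power_mult_distrib)
  have nzM: "1 - \<beta> * z ^ M \<noteq> 0"
  proof -
    have "norm \<beta> = 1" using pow[of 0] \<alpha>[of 0] N by (metis less_le_trans norm_power power_one zero_less_one)
    moreover have "z ^ M \<in> unit_disc" using z M by (simp add: unit_disc_def norm_power power_less_one_iff)
    ultimately show ?thesis using one_minus_mult_nz[of \<beta> "z ^ M"] by simp
  qed
  have split: "(1 + w) / (1 - w) = 2 * (1 / (1 - w)) - 1" if "1 - w \<noteq> 0" for w :: complex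
    using that by (simp add: field_simps)
  have inv: "1 / (1 - \<alpha> j * z) = (\<Sum>i<M. (\<alpha> j * z) ^ i) / (1 - \<beta> * z ^ M)" if "j < N" for j
    using geo[OF that] nz[OF that] nzM by (simp add: field_simps)
  have "(\<Sum>j<N. of_real (lam j) * (\<Sum>i<M. (\<alpha> j * z) ^ i)) = (\<Sum>i<M. moment N lam \<alpha> i * z ^ i)"
    unfolding moment_def sum_distrib_left sum_distrib_right
    by (subst sum.swap) (simp add: power_mult_distrib mult_ac)
  also have "\<dots> = (\<Sum>i\<in>{0}. moment N lam \<alpha> i * z ^ i)"
    using M mom by (intro sum.mono_neutral_right) (auto simp: Suc_le_eq)
  finally have geosum: "(\<Sum>j<N. of_real (lam j) * (\<Sum>i<M. (\<alpha> j * z) ^ i)) = of_real (\<Sum>j<N. lam j)"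
    by (simp add: moment_def)
  have "atom_exponent N lam \<alpha> z = (\<Sum>j<N. of_real (lam j) * (2 * ((\<Sum>i<M. (\<alpha> j * z) ^ i) / (1 - \<beta> * z ^ M)) - 1))"
    unfolding atom_exponent_def
  proof (rule sum.cong[OF refl])
    fix j assume "j \<in> {..<N}"
    then have j: "j < N" by simp
    show "of_real (lam j) * ((1 + \<alpha> j * z) / (1 - \<alpha> j * z)) =
        of_real (lam j) * (2 * ((\<Sum>i<M. (\<alpha> j * z) ^ i) / (1 - \<beta> * z ^ M)) - 1)"
      by (simp only: split[OF nz[OF j]] inv[OF j])
  qed
  also have "\<dots> = 2 * ((\<Sum>j<N. of_real (lam j) * (\<Sum>i<M. (\<alpha> j * z) ^ i)) / (1 - \<beta> * z ^ M)) - of_real (\<Sum>j<N. lam j)"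
    by (simp add: right_diff_distrib sum_subtractf sum_distrib_left sum_divide_distrib mult_ac)
  also have "\<dots> = of_real (\<Sum>j<N. lam j) * (2 * (1 / (1 - \<beta> * z ^ M)) - 1)"
    unfolding geosum by (simp add: algebra_simps)
  finally show ?thesis by (simp only: split[OF nzM])
qed

text \<open>Two indices of the window differ by at most n - 2 J - 2 <= J, so inner products of
  distinct powers are vanishing moments or their conjugates.\<close>

lemma moment_Bessel:
  assumes "n \<le> 3 * J + 2" and gap: "\<And>k. 1 \<le> k \<Longrightarrow> k \<le> J \<Longrightarrow> moment N lam \<alpha> k = 0" and N: "N \<ge> 1"
  shows "(\<Sum>i\<in>{J<..<n-J}. (norm (\<Sum>j<N. of_real (lam j) * (g j * cnj (\<alpha> j ^ i))))\<^sup>2)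
    \<le> (\<Sum>j<N. lam j) * (\<Sum>j<N. lam j * (norm (g j))\<^sup>2)"
proof (rule Bessel_finite)
  show "(\<Sum>j<N. lam j) > 0" using N lam by (intro sum_pos) (auto simp: lessThan_empty_iff)
  have off: "(\<Sum>j<N. of_real (lam j) * (\<alpha> j ^ i * cnj (\<alpha> j ^ k))) = 0" 
    if "i \<in> {J<..<n-J}" "k \<in> {J<..<n-J}" "k < i" for i k
  proof -
    have "(\<Sum>j<N. of_real (lam j) * (\<alpha> j ^ i * cnj (\<alpha> j ^ k))) = moment N lam \<alpha> (i - k)"
      unfolding moment_def using that \<alpha> by (intro sum.cong refl) (simp only: power_mult_cnj_power lessThan_iff less_imp_le)
    also have "\<dots> = 0" using that assms(1) by (intro gap) auto
    finally show ?thesis .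
  qed
  fix i k assume ik: "i \<in> {J<..<n-J}" "k \<in> {J<..<n-J}"
  show "(\<Sum>j<N. of_real (lam j) * (\<alpha> j ^ i * cnj (\<alpha> j ^ k))) = (if i = k then of_real (\<Sum>j<N. lam j) else 0)"
  proof (cases i k rule: linorder_cases)
    case less
    have "cnj (\<Sum>j<N. of_real (lam j) * (\<alpha> j ^ i * cnj (\<alpha> j ^ k))) =
        (\<Sum>j<N. of_real (lam j) * (\<alpha> j ^ k * cnj (\<alpha> j ^ i)))" by (simp add: mult_ac)
    also have "\<dots> = 0" by (rule off[OF ik(2,1) less])
    finally have "(\<Sum>j<N. of_real (lam j) * (\<alpha> j ^ i * cnj (\<alpha> j ^ k))) = 0"
      by (simp only: complex_cnj_zero_iff)
    then show ?thesis using less by simp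
  next
    case equal
    have "(\<Sum>j<N. of_real (lam j) * (\<alpha> j ^ i * cnj (\<alpha> j ^ k))) = (\<Sum>j<N. of_real (lam j))"
      unfolding equal by (intro sum.cong refl) (simp only: power_mult_cnj_power[OF \<alpha>] lessThan_iff order_refl diff_self_eq_0 power_0 mult_1_right)
    then show ?thesis using equal by simp
  next
    case greater
    then show ?thesis using off[OF ik] by simp
  qed
qed (use lam in \<open>auto intro: less_imp_le\<close>)

end

lemma exp_gap_zero_converse:
  assumes p: "p holomorphic_on unit_disc" "\<And>z. z \<in> unit_disc \<Longrightarrow> f z = c * exp (- p z)"
    and gap: "\<And>j. 1 \<le> j \<Longrightarrow> j \<le> J \<Longrightarrow> tcoeff p j = 0" and k: "1 \<le> k" "k \<le> J"
  shows "tcoeff f k = 0"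
proof -
  have "(\<Sum>i=1..k. of_nat i * tcoeff p i * tcoeff f (k - i)) = 0"
    using k by (intro sum.neutral ballI) (simp add: gap)
  then show ?thesis using tcoeff_exp_rec[OF p, of k] k by simp
qed

section \<open>Extremal functions with a coefficient gap\<close>

lemma exp_lower_cubic:
  assumes "u \<ge> (0::real)"
  shows "exp u \<ge> 1 + u + u\<^sup>2 / 2 + u ^ 3 / 6"
proof -
  have "(\<Sum>i<4. u ^ i /\<^sub>R fact i) \<le> exp u"
    unfolding exp_def using assms by (intro sum_le_suminf summable_exp_generic) auto
  then show ?thesis by (simp add: eval_nat_numeral field_simps)
qed

text \<open>For \<open>l > 1\<close> the bound \<open>d\<close> is contradictory up to about \<open>l = 2.7\<close> and the bound \<open>Q \<le> l\<^sup>2\<close> from about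
  \<open>l = 2.5\<close> on; \<open>13/5\<close> is a point where both work.\<close>

lemma gap_inequalities_rigid:
  fixes l x S Q A :: real
  assumes l: "l > 0" and x: "x \<le> l" and d: "Q + S \<le> l * (l - x)" and SQ: "S \<le> Q" and Q: "Q \<le> l\<^sup>2"
    and A: "A = x + S" and stat: "l * A = x + 2 * S" and low: "exp (l - 1) \<le> A" and "Q \<ge> 0"
  shows "l = 1 \<and> x = 1 \<and> Q = 0"
proof -
  \<comment> \<open>\<open>A\<close> and \<open>stat\<close> are two linear equations for x and
    S.\<close>
  have S_eq: "S = (l - 1) * A" and x_eq: "x = (2 - l) * A"
    using A stat by (simp_all add: algebra_simps)
  have Apos: "A > 0" using low exp_gt_zero order_less_le_trans by blast
  consider "l < 1" | "l = 1" | "l > 1" "l \<le> 13/5" | "l > 13/5" by linarith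
  then show ?thesis
  proof cases
    case 1
    have "l < exp (l - 1)"
    proof -
      \<comment> \<open>With u = l - 1, squaring 1 + u / 2 <= exp (u / 2) sharpens 1 + u <= exp u to
        a strict inequality.\<close>
      have "((1 + l) / 2)\<^sup>2 \<le> (exp ((l - 1) / 2))\<^sup>2"
        using exp_ge_add_one_self[of "(l - 1) / 2"] l by (intro power_mono) (auto simp: field_simps)
      also have "\<dots> = exp (l - 1)" by (simp add: power2_eq_square flip: exp_add)
      finally have "((1 + l) / 2)\<^sup>2 \<le> exp (l - 1)" .
      moreover have "((1 + l) / 2)\<^sup>2 - l = ((1 - l) / 2)\<^sup>2" by (simp add: power2_eq_square field_simps)
      moreover have "((1 - l) / 2)\<^sup>2 > 0" using 1 by simp
      ultimately show ?thesis by linarith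
    qed
    \<comment> \<open>Now x = (2 - l) A > (2 - l) l > l, against x <= l.\<close>
    then have "(2 - l) * l < (2 - l) * A" using 1 low by (intro mult_strict_left_mono) auto
    then have "(2 - l) * l < l" using x x_eq by simp
    moreover have "(2 - l) * l > 1 * l" using 1 l by (intro mult_strict_right_mono) auto
    ultimately show ?thesis by simp
  next
    case 2
    then have "S = 0" "x = A" using S_eq x_eq by auto
    moreover have "A \<ge> 1" using low 2 by simp
    ultimately show ?thesis using 2 x d \<open>Q \<ge> 0\<close> by auto
  next
    case 3
    define u where "u = l - 1"
    have u: "0 < u" "u \<le> 8/5" using 3 by (auto simp: u_def)
    \<comment> \<open>From \<open>d\<close> and S <= Q follows 2 S <= l (l - x). Substituting S and
      x leaves an upper bound for A, to be compared with the cubic lower bound of exp u.\<close>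
    have "A * (4 * l - 2 - l\<^sup>2) \<le> l\<^sup>2"
      using d SQ unfolding S_eq x_eq by (simp add: algebra_simps power2_eq_square)
    then have le: "A * (1 + 2 * u - u\<^sup>2) \<le> (1 + u)\<^sup>2"
      by (simp add: u_def algebra_simps power2_eq_square)
    have u2: "u\<^sup>2 \<le> 8/5 * u" using mult_right_mono[OF u(2), of u] u by (simp add: power2_eq_square)
    have pos: "1 + 2 * u - u\<^sup>2 > 0" using u2 u by linarith
    have "(1 + u + u\<^sup>2 / 2 + u ^ 3 / 6) * (1 + 2 * u - u\<^sup>2) \<le> A * (1 + 2 * u - u\<^sup>2)"
      using exp_lower_cubic[of u] low pos u by (intro mult_right_mono) (auto simp: u_def)
    with le have "(1 + u + u\<^sup>2 / 2 + u ^ 3 / 6) * (1 + 2 * u - u\<^sup>2) - (1 + u)\<^sup>2 \<le> 0"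
      by linarith
    \<comment> \<open>The difference is divisible by u, and the cofactor is positive for 0 < u <=
      8/5.\<close>
    moreover have "(1 + u + u\<^sup>2 / 2 + u ^ 3 / 6) * (1 + 2 * u - u\<^sup>2) - (1 + u)\<^sup>2 =
        u * (1 + u / 2 + u\<^sup>2 / 6 - u ^ 3 / 6 - u ^ 4 / 6)"
      by (simp add: field_simps power2_eq_square power3_eq_cube power4_eq_xxxx)
    ultimately have "u * (1 + u / 2 + u\<^sup>2 / 6 - u ^ 3 / 6 - u ^ 4 / 6) \<le> 0"
      by simp
    then have "1 + u / 2 + u\<^sup>2 / 6 - u ^ 3 / 6 - u ^ 4 / 6 \<le> 0"
      using u(1) by (simp add: mult_le_0_iff)
    moreover have "u ^ 3 \<le> 64/25 * u" "u ^ 4 \<le> 64/25 * u\<^sup>2"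
    proof -
      have "u\<^sup>2 \<le> (8/5)\<^sup>2" using u by (intro power_mono) auto
      then have "u\<^sup>2 \<le> 64/25" by (simp add: power2_eq_square)
      then have "u\<^sup>2 * u \<le> 64/25 * u" "u\<^sup>2 * u\<^sup>2 \<le> 64/25 * u\<^sup>2"
        using u by (intro mult_right_mono; simp)+
      then show "u ^ 3 \<le> 64/25 * u" "u ^ 4 \<le> 64/25 * u\<^sup>2" by (simp_all add: power2_eq_square power3_eq_cube power4_eq_xxxx)
    qed
    ultimately show ?thesis using u u2 by linarith
  next
    case 4
    define u where "u = l - 1"
    have u: "u > 8/5" using 4 by (simp add: u_def)
    \<comment> \<open>Here u A = S <= Q <= l^2, too small for the cubic lower bound of A once u >
      8/5.\<close>
    have "u * A \<le> (1 + u)\<^sup>2" using SQ Q unfolding S_eq by (simp add: u_def)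
    moreover have "u * (1 + u + u\<^sup>2 / 2 + u ^ 3 / 6) \<le> u * A"
      using exp_lower_cubic[of u] low u by (intro mult_left_mono) (auto simp: u_def)
    ultimately have "u ^ 3 / 2 + u ^ 4 / 6 \<le> 1 + u"
      by (simp add: algebra_simps power2_eq_square power3_eq_cube power4_eq_xxxx)
    moreover have "u ^ 3 \<ge> 64/25 * u" "u ^ 4 \<ge> 64/25 * (8/5) * u"
    proof -
      have "(8/5)\<^sup>2 \<le> u\<^sup>2" "(8/5)^3 \<le> u^3" using u by (intro power_mono; simp)+
      then have "64/25 \<le> u\<^sup>2" "512/125 \<le> u ^ 3" by (simp_all add: power2_eq_square power3_eq_cube)
      then have "64/25 * u \<le> u\<^sup>2 * u" "512/125 * u \<le> u ^ 3 * u"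
        using u by (intro mult_right_mono; simp)+
      then show "u ^ 3 \<ge> 64/25 * u" "u ^ 4 \<ge> 64/25 * (8/5) * u" by (simp_all add: power2_eq_square power3_eq_cube power4_eq_xxxx)
    qed
    ultimately show ?thesis using u by linarith
  qed
qed

lemma extremal_gap_imp_krzyz_fn:
  assumes f: "extremal n f" and norm: "normalized f" and n: "n \<ge> 1"
    and gap: "\<And>j. 1 \<le> j \<Longrightarrow> j \<le> n div 3 \<Longrightarrow> tcoeff f j = 0"
    and z: "z \<in> unit_disc"
  shows "f z = krzyz_fn n z"
proof -
  \<comment> \<open>The least J with n <= 3 J + 2, the range of the quadratic formula.\<close>
  define J where "J = n div 3"
  have nJ: "n \<le> 3 * J + 2" unfolding J_def by linarith
  obtain N where "has_atoms f N" using extremal_has_atoms[OF f n] .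
  then obtain \<gamma> lam \<alpha> where N: "1 \<le> N" and \<gamma>: "norm \<gamma> = 1" and lam: "\<And>j. j < N \<Longrightarrow> lam j > 0"
    and \<alpha>: "\<And>j. j < N \<Longrightarrow> norm (\<alpha> j) = 1" and "inj_on \<alpha> {..<N}"
    and frep: "\<And>z. z \<in> unit_disc \<Longrightarrow> f z = \<gamma> * exp (- atom_exponent N lam \<alpha> z)"
    by (rule has_atomsE) blast
  let ?P = "atom_exponent N lam \<alpha>" and ?\<mu> = "moment N lam \<alpha>"
  define l where "l = (\<Sum>j<N. lam j)"
  have l: "l > 0" unfolding l_def using N lam by (intro sum_pos) (auto simp: lessThan_empty_iff)
  have P: "?P holomorphic_on unit_disc"
    and P_coeff: "\<And>k. tcoeff ?P k = (if k = 0 then of_real l else 2 * ?\<mu> k)"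
    and P0: "?P 0 = of_real l"
    and ReP: "\<And>z. z \<in> unit_disc \<Longrightarrow> Re (?P z) \<ge> 0"
    using holomorphic_atom_exponent tcoeff_atom_exponent atom_exponent_0 Re_atom_exponent_nonneg lam \<alpha>
    unfolding l_def by blast+
  have f0: "f 0 = \<gamma> * of_real (exp (- l))" using frep[of 0] by (simp add: P0 flip: exp_of_real)
  have "\<gamma> = 1"
  proof -
    have "f 0 \<in> \<real>" "Re (f 0) > 0" using norm by (auto simp: normalized_def)
    moreover have "Im (f 0) = Im \<gamma> * exp (- l)" "Re (f 0) = Re \<gamma> * exp (- l)" unfolding f0 by simp_all
    ultimately have "Im \<gamma> = 0" "Re \<gamma> > 0" by (auto simp: complex_is_Real_iff zero_less_mult_iff)
    then show ?thesis using \<gamma> by (simp add: cmod_eq_Re complex_eq_iff)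
  qed
  have frep1: "f z = 1 * exp (- ?P z)" if "z \<in> unit_disc" for z using frep[OF that] \<open>\<gamma> = 1\<close> by simp
  have "f 0 \<noteq> 0" using f0 \<open>\<gamma> = 1\<close> by simp
  have P_gap: "tcoeff ?P k = 0" if "1 \<le> k" "k \<le> J" for k
    using tcoeff_exp_gap_zero[OF P frep1 \<open>f 0 \<noteq> 0\<close>, of J k] gap that by (auto simp: J_def)
  have \<mu>_gap: "?\<mu> k = 0" if "1 \<le> k" "k \<le> J" for k
    using P_gap[OF that] that by (simp add: P_coeff)

  let ?W = "{J<..<n-J}"
  define x where "x = - Re (?\<mu> n)"
  define S where "S = Re (\<Sum>i\<in>?W. ?\<mu> i * ?\<mu> (n - i))"
  define Q where "Q = (\<Sum>i\<in>?W. (norm (?\<mu> i))\<^sup>2)"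
  have Q_rev: "(\<Sum>i\<in>?W. (norm (?\<mu> (n - i)))\<^sup>2) = Q"
    unfolding Q_def by (rule sum.reindex_bij_witness[of _ "\<lambda>i. n - i" "\<lambda>i. n - i"]) auto

  \<comment> \<open>Scaling the exponent by s keeps the gap, so the quadratic formula holds along
    the whole family; s = 1 is f itself.\<close>
  have M_scaled: "Mfun n (\<lambda>z. 1 * exp (- (of_real s * ?P z))) = exp (- (s * l)) * (2 * s * x + 2 * s\<^sup>2 * S)" for s
  proof -
    let ?f = "\<lambda>z. 1 * exp (- (of_real s * ?P z))"
    have sP: "(\<lambda>z. of_real s * ?P z) holomorphic_on unit_disc" by (intro holomorphic_intros P)
    have sP_coeff: "tcoeff (\<lambda>z. of_real s * ?P z) k = of_real s * tcoeff ?P k" for k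
      by (rule tcoeff_cmult[OF P])
    have f0: "?f 0 = of_real (exp (- (s * l)))" by (simp add: P0 flip: exp_of_real)
    have zero: "tcoeff ?f k = 0" if "1 \<le> k" "k \<le> J" for k
      by (rule exp_gap_zero_converse[OF sP, where c = 1]) (use that P_gap in \<open>auto simp: sP_coeff\<close>)
    have "tcoeff ?f n = ?f 0 * ((\<Sum>i\<in>?W. tcoeff (\<lambda>z. of_real s * ?P z) i * tcoeff (\<lambda>z. of_real s * ?P z) (n - i)) / 2
        - tcoeff (\<lambda>z. of_real s * ?P z) n)"
      by (rule tcoeff_exp_gap_quadratic[OF sP _ _ zero n nJ]) auto
    also have "(\<Sum>i\<in>?W. tcoeff (\<lambda>z. of_real s * ?P z) i * tcoeff (\<lambda>z. of_real s * ?P z) (n - i)) =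
        of_real (4 * s\<^sup>2) * (\<Sum>i\<in>?W. ?\<mu> i * ?\<mu> (n - i))"
      unfolding sum_distrib_left
      by (intro sum.cong refl) (auto simp: sP_coeff P_coeff power2_eq_square)
    also have "tcoeff (\<lambda>z. of_real s * ?P z) n = of_real (2 * s) * ?\<mu> n"
      using n by (simp add: sP_coeff P_coeff)
    also have "of_real (4 * s\<^sup>2) * (\<Sum>i\<in>?W. ?\<mu> i * ?\<mu> (n - i)) / 2 = of_real (2 * s\<^sup>2) * (\<Sum>i\<in>?W. ?\<mu> i * ?\<mu> (n - i))"
      by simp
    finally have "tcoeff ?f n = of_real (exp (- (s * l))) *
        (of_real (2 * s\<^sup>2) * (\<Sum>i\<in>?W. ?\<mu> i * ?\<mu> (n - i)) - of_real (2 * s) * ?\<mu> n)"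
      unfolding f0 .
    moreover have "Re (of_real a * (of_real b * X - of_real c * Y)) = a * (b * Re X - c * Re Y)" for a b c X Y
      by simp
    ultimately have "Mfun n ?f = exp (- (s * l)) * (2 * s\<^sup>2 * S - 2 * s * Re (?\<mu> n))"
      unfolding Mfun_def S_def by (simp only:)
    then show ?thesis unfolding x_def by (simp add: algebra_simps)
  qed
  have Mf: "Mfun n f = exp (- (1 * l)) * (2 * 1 * x + 2 * 1\<^sup>2 * S)"
    unfolding M_scaled[symmetric] Mfun_def by (rule arg_cong[OF tcoeff_cong]) (simp add: frep1)
  define A where "A = x + S"

  have stat: "l * A = x + 2 * S"
  proof -
    let ?g = "\<lambda>s. exp (- (s * l)) * (2 * s * x + 2 * s\<^sup>2 * S)"
    have der: "DERIV ?g 1 :> exp (- l) * (- l) * (2 * x + 2 * S) + exp (- l) * (2 * x + 4 * S)"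
      by (auto intro!: derivative_eq_intros simp: algebra_simps)
    \<comment> \<open>Every s > 0 gives a member of \<open>B0\<close>, so s = 1 is an interior
      maximum.\<close>
    have mx: "\<forall>s. \<bar>1 - s\<bar> < 1 \<longrightarrow> ?g s \<le> ?g 1"
    proof (intro allI impI)
      fix s :: real assume "\<bar>1 - s\<bar> < 1"
      then have "s > 0" by auto
      then have "(\<lambda>z. 1 * exp (- (of_real s * ?P z))) \<in> B0"
        using ReP by (intro exp_minus_in_B0 holomorphic_intros P) auto
      then show "?g s \<le> ?g 1" using f M_scaled[of s] Mf unfolding extremal_def by metis
    qed
    have "exp (- l) * (- l) * (2 * x + 2 * S) + exp (- l) * (2 * x + 4 * S) = 0"
      by (rule DERIV_local_max[OF der _ mx]) simp
    then have "exp (- l) * (2 * (x + 2 * S - l * A)) = 0" by (simp add: A_def algebra_simps)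
    then show ?thesis by simp
  qed
  \<comment> \<open>This is 2/e <= 2 exp(- l) A, the comparison with f_n.\<close>
  have low: "exp (l - 1) \<le> A"
  proof -
    have "2 / exp 1 \<le> exp (- l) * (2 * A)"
      using Mfun_extremal_ge[OF f n] unfolding Mf by (simp add: A_def algebra_simps)
    then have "exp l * (2 / exp 1) \<le> exp l * (exp (- l) * (2 * A))" by (intro mult_left_mono) auto
    then show ?thesis by (simp add: exp_diff exp_minus field_simps)
  qed
  have norm_\<mu>: "norm (?\<mu> k) \<le> l" for k
  proof -
    have "norm (?\<mu> k) \<le> (\<Sum>j<N. norm (of_real (lam j) * \<alpha> j ^ k))"
      unfolding moment_def by (rule norm_sum)
    also have "\<dots> = l"
      unfolding l_def using \<alpha> lam by (intro sum.cong refl) (simp add: norm_mult norm_power less_imp_le)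
    finally show ?thesis .
  qed
  have x_le: "x \<le> l"
    using norm_\<mu>[of n] abs_Re_le_cmod[of "?\<mu> n"] unfolding x_def by linarith
  have dist_sum: "(\<Sum>j<N. lam j * (norm (1 + \<alpha> j ^ n))\<^sup>2) = 2 * (l - x)"
  proof -
    have "lam j * (norm (1 + \<alpha> j ^ n))\<^sup>2 = 2 * lam j + 2 * Re (of_real (lam j) * \<alpha> j ^ n)" if "j < N" for j
    proof -
      have "(norm (\<alpha> j ^ n))\<^sup>2 = 1" using \<alpha>[OF that] by (simp add: norm_power)
      then have "(norm (1 + \<alpha> j ^ n))\<^sup>2 = 2 + 2 * Re (\<alpha> j ^ n)"
        unfolding cmod_power2 by (simp add: power2_eq_square algebra_simps)
      then show ?thesis by (simp add: algebra_simps)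
    qed
    then have "(\<Sum>j<N. lam j * (norm (1 + \<alpha> j ^ n))\<^sup>2) = (\<Sum>j<N. 2 * lam j + 2 * Re (of_real (lam j) * \<alpha> j ^ n))"
      by (intro sum.cong) auto
    also have "\<dots> = 2 * (l - x)"
      by (simp only: sum.distrib sum_distrib_left[symmetric] Re_sum[symmetric] l_def x_def moment_def) simp
    finally show ?thesis .
  qed
  note Bessel = moment_Bessel[OF lam \<alpha> nJ \<mu>_gap N, folded l_def]
  have \<mu>_cnj: "(\<Sum>j<N. of_real (lam j) * (1 * cnj (\<alpha> j ^ i))) = cnj (?\<mu> i)" for i
    unfolding moment_def by simp
  have \<mu>_rev: "(\<Sum>j<N. of_real (lam j) * (\<alpha> j ^ n * cnj (\<alpha> j ^ i))) = ?\<mu> (n - i)" if "i \<le> n" for i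
    unfolding moment_def by (intro sum.cong refl) (simp only: power_mult_cnj_power[OF \<alpha> that] lessThan_iff)
  have Q_le: "Q \<le> l\<^sup>2"
    using Bessel[of "\<lambda>j. 1"] unfolding \<mu>_cnj Q_def by (simp add: l_def power2_eq_square)
  \<comment> \<open>Bessel for 1 + \<alpha>^n: its i-th coefficient is cnj \<mu>_i + \<mu>_(n-i).
    Since the window is invariant under i -> n - i, the squares add up to 2 Q + 2 S.\<close>
  have d: "Q + S \<le> l * (l - x)"
  proof -
    have "(norm (\<Sum>j<N. of_real (lam j) * ((1 + \<alpha> j ^ n) * cnj (\<alpha> j ^ i))))\<^sup>2 =
        (norm (?\<mu> i))\<^sup>2 + (norm (?\<mu> (n - i)))\<^sup>2 + 2 * Re (?\<mu> i * ?\<mu> (n - i))" if "i \<in> ?W" for i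
    proof -
      have "(\<Sum>j<N. of_real (lam j) * ((1 + \<alpha> j ^ n) * cnj (\<alpha> j ^ i))) = cnj (?\<mu> i) + ?\<mu> (n - i)"
        using that unfolding \<mu>_cnj[symmetric] by (subst \<mu>_rev[symmetric]) (auto simp: sum.distrib[symmetric] algebra_simps)
      then show ?thesis
        unfolding cmod_power2 by (simp add: power2_eq_square algebra_simps)
    qed
    then have "(\<Sum>i\<in>?W. (norm (\<Sum>j<N. of_real (lam j) * ((1 + \<alpha> j ^ n) * cnj (\<alpha> j ^ i))))\<^sup>2) =
        Q + (\<Sum>i\<in>?W. (norm (?\<mu> (n - i)))\<^sup>2) + 2 * S"
      unfolding Q_def S_def Re_sum sum_distrib_left sum.distrib[symmetric] by (intro sum.cong refl)
    then have "2 * Q + 2 * S \<le> l * (2 * (l - x))"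
      using Bessel[of "\<lambda>j. 1 + \<alpha> j ^ n"] unfolding dist_sum Q_rev by simp
    then show ?thesis by (simp add: algebra_simps)
  qed
  have SQ: "S \<le> Q"
  proof -
    have "2 * S \<le> (\<Sum>i\<in>?W. (norm (?\<mu> i))\<^sup>2 + (norm (?\<mu> (n - i)))\<^sup>2)"
      unfolding S_def Re_sum sum_distrib_left
    proof (rule sum_mono)
      fix i
      have "2 * Re (?\<mu> i * ?\<mu> (n - i)) \<le> 2 * (norm (?\<mu> i) * norm (?\<mu> (n - i)))"
        using complex_Re_le_cmod[of "?\<mu> i * ?\<mu> (n - i)"] by (simp add: norm_mult)
      also have "\<dots> \<le> (norm (?\<mu> i))\<^sup>2 + (norm (?\<mu> (n - i)))\<^sup>2"
        using sum_squares_bound[of "norm (?\<mu> i)" "norm (?\<mu> (n - i))"] by (simp add: power2_eq_square)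
      finally show "2 * Re (?\<mu> i * ?\<mu> (n - i)) \<le> (norm (?\<mu> i))\<^sup>2 + (norm (?\<mu> (n - i)))\<^sup>2" .
    qed
    also have "\<dots> = Q + Q" unfolding sum.distrib Q_rev by (simp add: Q_def)
    finally show ?thesis by simp
  qed
  have rigid: "l = 1 \<and> x = 1 \<and> Q = 0"
    by (rule gap_inequalities_rigid[OF l x_le d SQ Q_le A_def stat low]) (simp add: Q_def sum_nonneg)
  have \<alpha>n: "\<alpha> j ^ n = -1" if "j < N" for j
  proof -
    \<comment> \<open>Since l = x, the nonnegative terms sum to 0.\<close>
    have "(\<Sum>j<N. lam j * (norm (1 + \<alpha> j ^ n))\<^sup>2) = 0" using dist_sum rigid by simp
    moreover have "\<And>j. j \<in> {..<N} \<Longrightarrow> 0 \<le> lam j * (norm (1 + \<alpha> j ^ n))\<^sup>2"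
      using lam by (simp add: less_imp_le)
    ultimately have "lam j * (norm (1 + \<alpha> j ^ n))\<^sup>2 = 0"
      using sum_nonneg_eq_0_iff[of "{..<N}" "\<lambda>j. lam j * (norm (1 + \<alpha> j ^ n))\<^sup>2"] that by simp
    then have "1 + \<alpha> j ^ n = 0" using lam[OF that] by simp
    then show ?thesis by (simp add: add_eq_0_iff)
  qed
  have \<mu>0: "?\<mu> k = 0" if k: "1 \<le> k" "k < n" for k
  proof -
    consider "k \<le> J" | "k \<in> ?W" | "1 \<le> n - k" "n - k \<le> J"
      using k unfolding greaterThanLessThan_iff by linarith
    then show ?thesis
    proof cases
      case 1 then show ?thesis using \<mu>_gap k by simp
    next
      case 2
      have "(norm (?\<mu> k))\<^sup>2 = 0"
        using sum_nonneg_eq_0_iff[of ?W "\<lambda>i. (norm (?\<mu> i))\<^sup>2"] rigid 2 by (simp add: Q_def)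
      then show ?thesis by simp
    next
      case 3
      \<comment> \<open>From \<alpha>^n = -1 follows \<mu>_k = - cnj \<mu>_(n-k), which reflects the
        gap up to J to the indices from n - J on.\<close>
      have "cnj (?\<mu> (n - k)) = - (\<Sum>j<N. of_real (lam j) * (\<alpha> j ^ n * cnj (\<alpha> j ^ (n - k))))"
        unfolding \<mu>_cnj[symmetric] sum_negf[symmetric] by (intro sum.cong refl) (simp add: \<alpha>n)
      also have "\<dots> = - ?\<mu> k" using k by (subst \<mu>_rev) auto
      finally show ?thesis using \<mu>_gap[OF 3] by simp
    qed
  qed
  have "?P z = of_real l * ((1 + (-1) * z ^ n) / (1 - (-1) * z ^ n))"
    unfolding l_def by (rule atom_exponent_same_power[OF lam \<alpha> n \<alpha>n \<mu>0 z N])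
  then show ?thesis
    using frep1[OF z] krzyz_fn_eq[of n z] rigid by simp
qed

section \<open>A single atom is never extremal beyond the second coefficient\<close>

text \<open>\<open>lsum n s = exp (- s) * L\<^sub>n (2 * s)\<close> with the Laguerre polynomial \<open>L\<^sub>n\<close>: the partial sums of the
  Taylor coefficients \<open>lcoef n s\<close> of \<open>exp (- s (1 + z) / (1 - z))\<close>.\<close>

fun lsum :: "nat \<Rightarrow> real \<Rightarrow> real" where
  "lsum 0 s = exp (- s)"
| "lsum (Suc 0) s = (1 - 2 * s) * exp (- s)"
| "lsum (Suc (Suc n)) s = ((2 * real n + 3 - 2 * s) * lsum (Suc n) s - (real n + 1) * lsum n s) / (real n + 2)"

definition lcoef :: "nat \<Rightarrow> real \<Rightarrow> real" where
  "lcoef n s = (if n = 0 then lsum 0 s else lsum n s - lsum (n - 1) s)"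

section \<open>Recurrences and derivatives of the Laguerre sums\<close>

lemma lsum_at_0: "lsum n 0 = 1"
  by (induction n "0::real" rule: lsum.induct) (auto simp: field_simps)

lemma lsum_recurrence:
  "(real n + 2) * lsum (Suc (Suc n)) s = (2 * real n + 3 - 2 * s) * lsum (Suc n) s - (real n + 1) * lsum n s"
  by simp

declare lsum.simps(3) [simp del]

text \<open>The three-term recurrence says that the left side changes by - 2 s lsum (n + 1) when n
  grows by 1.\<close>

lemma lsum_Suc_diff: "(real n + 1) * (lsum (Suc n) s - lsum n s) = - 2 * s * (\<Sum>i\<le>n. lsum i s)"
proof (induction n)
  case (Suc n)
  have "(real (Suc n) + 1) * (lsum (Suc (Suc n)) s - lsum (Suc n) s) =
      (real n + 1) * (lsum (Suc n) s - lsum n s) - 2 * s * lsum (Suc n) s"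
    using lsum_recurrence[of n s] by (simp add: algebra_simps)
  then show ?case using Suc.IH by (simp add: algebra_simps)
qed (simp add: algebra_simps)

text \<open>The classical L_n' = - (L_0 + ... + L_(n-1)); the factor exp(- s) adds - lsum n, and the
  argument 2 s gives the factor 2.\<close>

lemma DERIV_lsum [derivative_intros]:
  "((\<lambda>s. lsum n s) has_real_derivative (- lsum n s - 2 * (\<Sum>i<n. lsum i s))) (at s)"
proof (induction n rule: lsum.induct[of "\<lambda>n _. ((\<lambda>s. lsum n s) has_real_derivative (- lsum n s - 2 * (\<Sum>i<n. lsum i s))) (at s)" _ s])
  case (3 n)
  let ?T = "\<lambda>n. \<Sum>i<n. lsum i s"
  let ?d = "\<lambda>n. - lsum n s - 2 * ?T n"
  have "((\<lambda>s. ((2 * real n + 3 - 2 * s) * lsum (Suc n) s - (real n + 1) * lsum n s) / (real n + 2)) has_real_derivative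
      ((2 * real n + 3 - 2 * s) * ?d (Suc n) - 2 * lsum (Suc n) s - (real n + 1) * ?d n) / (real n + 2)) (at s)"
    using 3 by (auto intro!: derivative_eq_intros)
  moreover have "(2 * real n + 3 - 2 * s) * ?d (Suc n) - 2 * lsum (Suc n) s - (real n + 1) * ?d n =
      (real n + 2) * ?d (Suc (Suc n))"
  proof -
    have "- 2 * s * ?T (Suc n) = (real n + 1) * (lsum (Suc n) s - lsum n s)"
      using lsum_Suc_diff[of n s] by (simp add: lessThan_Suc_atMost)
    then show ?thesis
      using lsum_recurrence[of n s] by (simp add: algebra_simps)
  qed
  moreover have "(real n + 2) * ?d (Suc (Suc n)) / (real n + 2) = ?d (Suc (Suc n))"
    by (rule nonzero_mult_div_cancel_left) simp
  ultimately show ?case by (simp only: lsum.simps(3))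
qed (auto intro!: derivative_eq_intros simp: algebra_simps)

lemma s_deriv_lsum_Suc:
  "s * (- lsum (Suc n) s - 2 * (\<Sum>i<Suc n. lsum i s)) =
    - s * lsum (Suc n) s + (real n + 1) * (lsum (Suc n) s - lsum n s)"
  using lsum_Suc_diff[of n s] by (simp add: lessThan_Suc_atMost algebra_simps)

lemma DERIV_lcoef_Suc [derivative_intros]:
  "((\<lambda>s. lcoef (Suc n) s) has_real_derivative (- (lsum (Suc n) s + lsum n s))) (at s)"
  unfolding lcoef_def by (auto intro!: derivative_eq_intros simp: algebra_simps)

text \<open>With consecutive partial sums a and b, the new term contributes - 2 (a - b) (a + b) = 2
  b^2 - 2 a^2, so the derivative telescopes.\<close>

lemma DERIV_sum_lcoef_sq:
  "((\<lambda>s. \<Sum>j\<le>n. (lcoef j s)\<^sup>2) has_real_derivative (- 2 * (lsum n s)\<^sup>2)) (at s)"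
proof (induction n)
  case 0
  then show ?case
    by (auto simp: lcoef_def power2_eq_square intro!: derivative_eq_intros)
next
  case (Suc n)
  have "((\<lambda>s. (\<Sum>j\<le>n. (lcoef j s)\<^sup>2) + (lcoef (Suc n) s)\<^sup>2) has_real_derivative
     - 2 * (lsum n s)\<^sup>2 + 2 * lcoef (Suc n) s * (- (lsum (Suc n) s + lsum n s))) (at s)"
    by (rule DERIV_add[OF Suc]) (auto intro!: derivative_eq_intros)
  also have "- 2 * (lsum n s)\<^sup>2 + 2 * lcoef (Suc n) s * (- (lsum (Suc n) s + lsum n s)) = - 2 * (lsum (Suc n) s)\<^sup>2"
    by (simp add: lcoef_def power2_eq_square algebra_simps)
  finally show ?case by simp
qed

text \<open>Another telescoping derivative: s times the derivative of the new summand involves only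
  neighbours, which the three-term recurrence collects into one product.\<close>

lemma DERIV_s_sum_lsum_sq:
  "((\<lambda>s. s * (\<Sum>j\<le>n. (lsum j s)\<^sup>2)) has_real_derivative (real n + 1) * lsum (Suc n) s * lsum n s) (at s)"
proof (induction n)
  case 0
  then show ?case
    by (auto simp: power2_eq_square algebra_simps intro!: derivative_eq_intros)
next
  case (Suc n)
  let ?d = "- lsum (Suc n) s - 2 * (\<Sum>i<Suc n. lsum i s)"
  have "((\<lambda>s. s * (\<Sum>j\<le>n. (lsum j s)\<^sup>2) + s * (lsum (Suc n) s)\<^sup>2) has_real_derivative
     (real n + 1) * lsum (Suc n) s * lsum n s + ((lsum (Suc n) s)\<^sup>2 + s * (2 * lsum (Suc n) s * ?d))) (at s)"
    by (rule DERIV_add[OF Suc]) (auto intro!: derivative_eq_intros)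
  also have "(real n + 1) * lsum (Suc n) s * lsum n s + ((lsum (Suc n) s)\<^sup>2 + s * (2 * lsum (Suc n) s * ?d)) =
      lsum (Suc n) s * ((real n + 1) * lsum n s + lsum (Suc n) s + 2 * (s * ?d))"
    by (simp add: algebra_simps power2_eq_square)
  also have "\<dots> = lsum (Suc n) s * ((2 * real n + 3 - 2 * s) * lsum (Suc n) s - (real n + 1) * lsum n s)"
    unfolding s_deriv_lsum_Suc by (simp add: algebra_simps)
  also have "\<dots> = (real (Suc n) + 1) * lsum (Suc (Suc n)) s * lsum (Suc n) s"
    unfolding lsum_recurrence[symmetric] by (simp add: algebra_simps)
  finally show ?case by (simp add: distrib_left)
qed

text \<open>The factors 2 / (n + 1) and 1 / 2 complete a square: the left side has derivative -
  (lcoef (n + 1))^2 and value 1 at s = 0.\<close>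

lemma lcoef_energy_le_1:
  assumes "s \<ge> 0"
  shows "(\<Sum>j\<le>Suc n. (lcoef j s)\<^sup>2) + 2 / (real n + 1) * (s * (\<Sum>j\<le>n. (lsum j s)\<^sup>2)) - (lcoef (Suc n) s)\<^sup>2 / 2 \<le> 1"
proof -
  let ?G = "\<lambda>s. (\<Sum>j\<le>Suc n. (lcoef j s)\<^sup>2) + 2 / (real n + 1) * (s * (\<Sum>j\<le>n. (lsum j s)\<^sup>2)) - (lcoef (Suc n) s)\<^sup>2 / 2"
  have "(?G has_real_derivative (- (lcoef (Suc n) s)\<^sup>2)) (at s)" for s
  proof -
    have "((\<lambda>s. (lcoef (Suc n) s)\<^sup>2 / 2) has_real_derivative lcoef (Suc n) s * (- (lsum (Suc n) s + lsum n s))) (at s)"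
      by (auto intro!: derivative_eq_intros)
    then have "(?G has_real_derivative (- 2 * (lsum (Suc n) s)\<^sup>2
        + 2 / (real n + 1) * ((real n + 1) * lsum (Suc n) s * lsum n s)
        - lcoef (Suc n) s * (- (lsum (Suc n) s + lsum n s)))) (at s)"
      by (intro DERIV_diff DERIV_add DERIV_cmult DERIV_sum_lcoef_sq DERIV_s_sum_lsum_sq)
    also have "2 / (real n + 1) * ((real n + 1) * lsum (Suc n) s * lsum n s) = 2 * (lsum (Suc n) s * lsum n s)"
      by (simp add: field_simps)
    also have "- 2 * (lsum (Suc n) s)\<^sup>2 + 2 * (lsum (Suc n) s * lsum n s)
        - lcoef (Suc n) s * (- (lsum (Suc n) s + lsum n s)) = - (lcoef (Suc n) s)\<^sup>2"
      by (simp add: lcoef_def power2_eq_square algebra_simps)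
    finally show ?thesis .
  qed
  then have "?G s \<le> ?G 0"
    using assms by (intro DERIV_nonpos_imp_nonincreasing[of 0 s ?G]) (auto intro!: exI)
  moreover have "?G 0 = 1"
  proof -
    have "(\<Sum>j\<le>Suc n. (lcoef j 0)\<^sup>2) = (\<Sum>j\<le>Suc n. if j = 0 then 1 else 0)"
      by (intro sum.cong refl) (simp add: lcoef_def lsum_at_0)
    moreover have "lcoef (Suc n) 0 = 0" by (simp add: lcoef_def lsum_at_0)
    ultimately show ?thesis by simp
  qed
  ultimately show ?thesis by simp
qed

section \<open>Generating functions of the Laguerre sums\<close>

definition exp_atom :: "real \<Rightarrow> complex \<Rightarrow> complex" where
  "exp_atom s z = exp (- (of_real s * ((1 + z) / (1 - z))))"

text \<open>Multiplication by the geometric series turns Taylor coefficients into their partial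
  sums.\<close>

definition geom :: "complex \<Rightarrow> complex" where
  "geom z = 1 / (1 - z)"

lemma one_minus_nz: "z \<in> unit_disc \<Longrightarrow> 1 - z \<noteq> 0"
  using one_minus_mult_nz[of 1 z] by simp

lemma exp_atom_add: "exp_atom (s + t) z = exp_atom s z * exp_atom t z"
  by (simp only: exp_atom_def exp_add[symmetric] of_real_add distrib_right minus_add_distrib)

lemma holomorphic_geom: "geom holomorphic_on unit_disc"
  unfolding geom_def[abs_def] using one_minus_nz by (intro holomorphic_intros) auto

lemma holomorphic_exp_atom: "exp_atom s holomorphic_on unit_disc"
  unfolding exp_atom_def[abs_def] using one_minus_nz by (intro holomorphic_intros) auto

lemma DERIV_geom: "z \<in> unit_disc \<Longrightarrow> (geom has_field_derivative 1 / (1 - z)\<^sup>2) (at z)"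
  unfolding geom_def[abs_def] using one_minus_nz[of z]
  by (auto intro!: derivative_eq_intros simp: power2_eq_square)

lemma DERIV_exp_atom:
  assumes "z \<in> unit_disc"
  shows "(exp_atom s has_field_derivative - (of_real s * (2 / (1 - z)\<^sup>2)) * exp_atom s z) (at z)"
proof -
  have "((\<lambda>z. (1 + z) / (1 - z)) has_field_derivative 2 / (1 - z)\<^sup>2) (at z)"
    using one_minus_nz[OF assms] by (auto intro!: derivative_eq_intros simp: power2_eq_square)
  from DERIV_chain2[OF DERIV_exp DERIV_minus[OF DERIV_cmult[OF this, of "of_real s"]]]
  show ?thesis unfolding exp_atom_def[abs_def] by (simp only: mult.commute)
qed

lemma tcoeff_geom: "tcoeff geom n = 1"
proof -
  define M :: "complex \<Rightarrow> complex" where "M = (\<lambda>z. (1 + 1 * z) / (1 - 1 * z))"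
  have M: "M holomorphic_on unit_disc" "tcoeff M n = (if n = 0 then 1 else 2 * 1 ^ n)"
    unfolding M_def by (rule holomorphic_Mobius tcoeff_Mobius; simp)+
  have "tcoeff geom n = tcoeff (\<lambda>z. 1/2 * M z + 1/2) n"
    by (rule tcoeff_cong) (use one_minus_nz in \<open>simp add: geom_def M_def field_simps\<close>)
  also have "\<dots> = tcoeff (\<lambda>z. 1/2 * M z) n + tcoeff (\<lambda>z. 1/2) n"
    by (intro tcoeff_add holomorphic_on_mult holomorphic_on_const M(1))
  also have "\<dots> = 1/2 * tcoeff M n + (if n = 0 then 1/2 else 0)"
    by (simp only: tcoeff_cmult[OF M(1)] tcoeff_const)
  finally show ?thesis by (simp add: M(2))
qed

text \<open>The product g satisfies (1 - z)^2 g' = (1 - z - 2 s) g, whose coefficient form is the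
  recurrence defining \<open>lsum\<close>.\<close>

lemma tcoeff_exp_atom_geom: "tcoeff (\<lambda>z. exp_atom s z * geom z) n = of_real (lsum n s)"
proof -
  let ?g = "\<lambda>z. exp_atom s z * geom z"
  have g: "?g holomorphic_on unit_disc"
    by (rule holomorphic_on_mult[OF holomorphic_exp_atom holomorphic_geom])
  define c where "c = tcoeff ?g"
  have deriv_g: "deriv ?g z = 2 * (z * deriv ?g z) - z ^ 2 * deriv ?g z + (1 - 2 * of_real s) * ?g z - z * ?g z"
    if z: "z \<in> unit_disc" for z
  proof -
    have nz: "1 - z \<noteq> 0" by (rule one_minus_nz[OF z])
    have "deriv ?g z = - (of_real s * (2 / (1 - z)\<^sup>2)) * exp_atom s z * geom z + 1 / (1 - z)\<^sup>2 * exp_atom s z"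
      by (rule DERIV_imp_deriv[OF DERIV_mult[OF DERIV_exp_atom[OF z] DERIV_geom[OF z]]])
    also have "1 / (1 - z)\<^sup>2 * exp_atom s z = (1 - z) / (1 - z)\<^sup>2 * ?g z"
      using nz by (simp add: geom_def)
    finally have "(1 - z)\<^sup>2 * deriv ?g z = (1 - z - 2 * of_real s) * ?g z"
      using nz by (simp add: field_simps)
    then show ?thesis by (simp add: algebra_simps power2_eq_square)
  qed
  define F where "F = Abs_fps c"
  have F: "?g has_fps_expansion F" unfolding F_def c_def by (rule has_fps_expansion_tcoeff[OF g])
  have dF: "deriv ?g has_fps_expansion fps_deriv F" by (rule has_fps_expansion_deriv[OF F])
  have "(\<lambda>z. 2 * (z * deriv ?g z) - z ^ 2 * deriv ?g z + (1 - 2 * of_real s) * ?g z - z * ?g z) has_fps_expansion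
      fps_const 2 * (fps_X * fps_deriv F) - fps_X ^ 2 * fps_deriv F + fps_const (1 - 2 * of_real s) * F - fps_X * F"
    by (intro fps_expansion_intros F dF)
  note rhs = this
  have ev: "eventually (\<lambda>z. deriv ?g z = 2 * (z * deriv ?g z) - z ^ 2 * deriv ?g z + (1 - 2 * of_real s) * ?g z - z * ?g z) (nhds 0)"
    using eventually_nhds_in_open[OF open_unit_disc unit_disc_0] by eventually_elim (rule deriv_g)
  have "deriv ?g has_fps_expansion
      fps_const 2 * (fps_X * fps_deriv F) - fps_X ^ 2 * fps_deriv F + fps_const (1 - 2 * of_real s) * F - fps_X * F"
    by (rule has_fps_expansion_cong[OF ev refl, THEN iffD2, OF rhs])
  then have fps: "fps_deriv F = fps_const 2 * (fps_X * fps_deriv F) - fps_X ^ 2 * fps_deriv F + fps_const (1 - 2 * of_real s) * F - fps_X * F"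
    using fps_expansion_unique_complex[OF dF] by blast
  have c0: "c 0 = of_real (exp (- s))"
    by (simp add: c_def exp_atom_def geom_def flip: exp_of_real)
  have c1: "c (Suc 0) = of_real ((1 - 2 * s) * exp (- s))"
    using arg_cong[OF fps, of "\<lambda>F. fps_nth F 0"] c0 by (simp add: F_def)
  have c2: "of_nat (n + 2) * c (Suc (Suc n)) = (of_nat (2 * n + 3) - 2 * of_real s) * c (Suc n) - of_nat (n + 1) * c n" for n
  proof -
    have "fps_nth (fps_deriv F) (Suc n) = 2 * fps_nth (fps_deriv F) n
        - (if n = 0 then 0 else fps_nth (fps_deriv F) (n - 1))
        + (1 - 2 * of_real s) * fps_nth F (Suc n) - fps_nth F n"
      using arg_cong[OF fps, of "\<lambda>F. fps_nth F (Suc n)"]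
      by (cases n) (simp_all add: fps_X_power_mult_nth del: fps_deriv_nth)
    then show ?thesis by (cases n) (simp_all add: F_def algebra_simps)
  qed
  have "c n = of_real (lsum n s)"
  proof (induction n rule: lsum.induct[of "\<lambda>n _. c n = of_real (lsum n s)" _ s])
    case (3 n)
    have "of_nat (n + 2) * c (Suc (Suc n)) = of_real ((2 * real n + 3 - 2 * s) * lsum (Suc n) s - (real n + 1) * lsum n s)"
      unfolding c2 3 by simp
    also have "\<dots> = of_nat (n + 2) * of_real (lsum (Suc (Suc n)) s)"
      unfolding lsum_recurrence[symmetric] by simp
    finally show ?case
    proof (subst (asm) mult_left_cancel)
      show "of_nat (n + 2) \<noteq> (0::complex)" by (simp only: of_nat_eq_0_iff)
    qed
  qed (use c0 c1 in auto)
  then show ?thesis by (simp add: c_def)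
qed

lemma tcoeff_exp_atom: "tcoeff (exp_atom s) n = of_real (lcoef n s)"
proof -
  have sums: "of_real (lsum n s) = (\<Sum>i\<le>n. tcoeff (exp_atom s) i)" for n
    using tcoeff_mult[OF holomorphic_exp_atom holomorphic_geom, of s n]
    by (simp add: tcoeff_exp_atom_geom tcoeff_geom)
  show ?thesis
  proof (cases n)
    case 0
    then show ?thesis using sums[of 0] by (simp add: lcoef_def)
  next
    case (Suc m)
    then show ?thesis using sums[of m] sums[of "Suc m"] by (simp add: lcoef_def)
  qed
qed

lemma lcoef_double: "lcoef n (2 * s) = (\<Sum>j\<le>n. lcoef j s * lcoef (n - j) s)"
proof -
  have "of_real (lcoef n (2 * s)) = tcoeff (\<lambda>z. exp_atom s z * exp_atom s z) n"
    unfolding tcoeff_exp_atom[symmetric] by (rule tcoeff_cong) (simp add: exp_atom_add[symmetric])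
  also have "\<dots> = of_real (\<Sum>j\<le>n. lcoef j s * lcoef (n - j) s)"
    by (simp add: tcoeff_mult holomorphic_exp_atom tcoeff_exp_atom)
  finally show ?thesis by (simp only: of_real_eq_iff)
qed

text \<open>The derivative of exp_atom (2 s) is - 4 s (exp_atom s * geom)^2. Together with
  \<open>lcoef_double\<close> this gives two convolution formulas for the same coefficient.\<close>

lemma lcoef_double_lsum:
  "(real n + 1) * lcoef (Suc n) (2 * s) = - 4 * s * (\<Sum>j\<le>n. lsum j s * lsum (n - j) s)"
proof -
  let ?g = "\<lambda>z. exp_atom s z * geom z"
  have g: "?g holomorphic_on unit_disc"
    by (rule holomorphic_on_mult[OF holomorphic_exp_atom holomorphic_geom])
  have "of_real ((real n + 1) * lcoef (Suc n) (2 * s)) = tcoeff (deriv (exp_atom (2 * s))) n"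
    by (simp add: tcoeff_deriv holomorphic_exp_atom tcoeff_exp_atom)
  also have "\<dots> = tcoeff (\<lambda>z. of_real (- 4 * s) * (?g z * ?g z)) n"
  proof (rule tcoeff_cong)
    fix z assume z: "z \<in> unit_disc"
    have "deriv (exp_atom (2 * s)) z = - (of_real (2 * s) * (2 / (1 - z)\<^sup>2)) * exp_atom (2 * s) z"
      by (rule DERIV_imp_deriv[OF DERIV_exp_atom[OF z]])
    moreover have "exp_atom (2 * s) z = exp_atom s z * exp_atom s z"
      by (simp add: exp_atom_add[symmetric])
    ultimately show "deriv (exp_atom (2 * s)) z = of_real (- 4 * s) * (?g z * ?g z)"
      by (simp add: geom_def power2_eq_square)
  qed
  also have "\<dots> = of_real (- 4 * s * (\<Sum>j\<le>n. lsum j s * lsum (n - j) s))"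
    by (simp only: tcoeff_cmult[OF holomorphic_on_mult[OF g g]] tcoeff_mult[OF g g]
        tcoeff_exp_atom_geom of_real_mult of_real_sum)
  finally show ?thesis by (simp only: of_real_eq_iff)
qed

section \<open>Bounds for the coefficients of a single atom\<close>

lemma abs_sum_mult_rev_le:
  fixes a :: "nat \<Rightarrow> real"
  shows "\<bar>\<Sum>j\<le>n. a j * a (n - j)\<bar> \<le> (\<Sum>j\<le>n. (a j)\<^sup>2)"
proof -
  have rev: "(\<Sum>j\<le>n. (a (n - j))\<^sup>2) = (\<Sum>j\<le>n. (a j)\<^sup>2)"
    by (rule sum.reindex_bij_witness[of _ "\<lambda>i. n - i" "\<lambda>i. n - i"]) auto
  have "\<bar>\<Sum>j\<le>n. a j * a (n - j)\<bar> \<le> (\<Sum>j\<le>n. ((a j)\<^sup>2 + (a (n - j))\<^sup>2) / 2)"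
  proof (rule order_trans[OF sum_abs sum_mono])
    fix j show "\<bar>a j * a (n - j)\<bar> \<le> ((a j)\<^sup>2 + (a (n - j))\<^sup>2) / 2"
      using sum_squares_bound[of "\<bar>a j\<bar>" "\<bar>a (n - j)\<bar>"] by (simp add: abs_mult)
  qed
  also have "\<dots> = (\<Sum>j\<le>n. (a j)\<^sup>2)" by (simp add: add_divide_distrib sum.distrib rev flip: sum_divide_distrib)
  finally show ?thesis .
qed

text \<open>From 2 |a b| = a^2 + b^2 - (|a| - |b|)^2 for the pair j, n - j; the equal defects at j =
  0 and j = n are retained.\<close>

lemma abs_sum_mult_rev_le':
  fixes a :: "nat \<Rightarrow> real"
  assumes "n \<ge> 1"
  shows "\<bar>\<Sum>j\<le>n. a j * a (n - j)\<bar> \<le> (\<Sum>j\<le>n. (a j)\<^sup>2) - (\<bar>a 0\<bar> - \<bar>a n\<bar>)\<^sup>2"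
proof -
  have rev: "(\<Sum>j\<le>n. (a (n - j))\<^sup>2) = (\<Sum>j\<le>n. (a j)\<^sup>2)"
    by (rule sum.reindex_bij_witness[of _ "\<lambda>i. n - i" "\<lambda>i. n - i"]) auto
  have "2 * (\<bar>a 0\<bar> - \<bar>a n\<bar>)\<^sup>2 = (\<Sum>j\<in>{0,n}. (\<bar>a j\<bar> - \<bar>a (n - j)\<bar>)\<^sup>2)"
    using assms by (simp add: power2_commute)
  also have "\<dots> \<le> (\<Sum>j\<le>n. (\<bar>a j\<bar> - \<bar>a (n - j)\<bar>)\<^sup>2)"
    by (rule sum_mono2) auto
  also have "\<dots> = (\<Sum>j\<le>n. (a j)\<^sup>2 + (a (n - j))\<^sup>2 - 2 * \<bar>a j * a (n - j)\<bar>)"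
    by (intro sum.cong refl) (simp add: power2_diff abs_mult)
  also have "\<dots> = 2 * (\<Sum>j\<le>n. (a j)\<^sup>2) - 2 * (\<Sum>j\<le>n. \<bar>a j * a (n - j)\<bar>)"
    by (simp add: sum.distrib sum_subtractf rev sum_distrib_left)
  finally show ?thesis using sum_abs[of "\<lambda>j. a j * a (n - j)" "{..n}"] by linarith
qed

text \<open>At s = t / 2 the two convolution formulas bound the coefficient by D minus a defect and
  by Y. Adding the first bound to half the second allows the energy inequality for D + Y /
  2.\<close>

lemma abs_lcoef_le:
  assumes "n \<ge> 1" "t \<ge> 0"
  shows "3 * \<bar>lcoef n t\<bar> \<le> 2 + 2 * exp (- t)"
proof -
  obtain m where m: "n = Suc m" using assms(1) by (cases n) auto
  define s where "s = t / 2"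
  have t: "t = 2 * s" and s: "s \<ge> 0" using assms by (auto simp: s_def)
  define D where "D = (\<Sum>j\<le>Suc m. (lcoef j s)\<^sup>2)"
  define Y where "Y = 4 * s / (real m + 1) * (\<Sum>j\<le>m. (lsum j s)\<^sup>2)"
  have "\<bar>lcoef n t\<bar> \<le> D - (\<bar>lcoef 0 s\<bar> - \<bar>lcoef n s\<bar>)\<^sup>2"
    unfolding t lcoef_double D_def m[symmetric] by (rule abs_sum_mult_rev_le'[OF assms(1)])
  moreover have "\<bar>lcoef n t\<bar> \<le> Y"
  proof -
    have "(real m + 1) * \<bar>lcoef n t\<bar> = 4 * s * \<bar>\<Sum>j\<le>m. lsum j s * lsum (m - j) s\<bar>"
      using arg_cong[OF lcoef_double_lsum[of m s], of abs] s by (simp add: abs_mult t m)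
    also have "\<dots> \<le> 4 * s * (\<Sum>j\<le>m. (lsum j s)\<^sup>2)"
      using s by (intro mult_left_mono abs_sum_mult_rev_le) auto
    finally show ?thesis by (simp add: Y_def field_simps)
  qed
  moreover have "D + Y / 2 - (lcoef n s)\<^sup>2 / 2 \<le> 1"
    using lcoef_energy_le_1[OF s, of m] unfolding D_def Y_def m by (simp add: field_simps)
  \<comment> \<open>The left side is largest when |lcoef n s| is twice |lcoef 0 s|.\<close>
  moreover have "(lcoef n s)\<^sup>2 / 2 - (\<bar>lcoef 0 s\<bar> - \<bar>lcoef n s\<bar>)\<^sup>2 \<le> (lcoef 0 s)\<^sup>2"
  proof -
    have "0 \<le> (\<bar>lcoef n s\<bar> - 2 * \<bar>lcoef 0 s\<bar>)\<^sup>2" by simp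
    then show ?thesis by (simp add: power2_eq_square algebra_simps)
  qed
  moreover have "(lcoef 0 s)\<^sup>2 = exp (- t)"
    by (simp add: lcoef_def t power2_eq_square flip: exp_add)
  moreover have "a \<le> D - E \<Longrightarrow> a \<le> Y \<Longrightarrow> D + Y / 2 - h / 2 \<le> 1 \<Longrightarrow> h / 2 - E \<le> q \<Longrightarrow> q = x \<Longrightarrow> 3 * a \<le> 2 + 2 * x"
    for a D E Y h q x :: real by linarith
  ultimately show ?thesis by blast
qed

text \<open>Add to the exponent an atom in z^k with k = n - j > n / 2: only its coefficients 1 and 2
  b at degrees 0 and k enter, giving Re (a_n + 2 b a_j) >= 0. The unimodular b is chosen so that b
  a_j = - |a_j|.\<close>

lemma extremal_coeff_le_half:
  assumes f: "extremal n f" and j: "2 * j < n"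
  shows "2 * norm (tcoeff f j) \<le> Mfun n f"
proof (cases "tcoeff f j = 0")
  case True
  then show ?thesis using Mfun_extremal_ge[OF f] j by (simp add: order_trans[of 0 "2 / exp 1"])
next
  case False
  define k where "k = n - j"
  have k: "k \<ge> 1" "n < 2 * k" "j = n - k" "k \<le> n" using j by (auto simp: k_def)
  define b where "b = - cnj (tcoeff f j) / of_real (norm (tcoeff f j))"
  have b: "norm b = 1" using False by (simp add: b_def norm_divide)
  have bj: "b * tcoeff f j = - of_real (norm (tcoeff f j))"
    using False by (simp add: b_def complex_norm_square[symmetric] mult.commute power2_eq_square)
  let ?q = "\<lambda>z. (1 + b * z ^ k) / (1 - b * z ^ k)"
  have Mb: "(\<lambda>z. (1 + b * z) / (1 - b * z)) holomorphic_on unit_disc"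
    using b by (intro holomorphic_Mobius) simp
  have q: "?q holomorphic_on unit_disc" using holomorphic_power_arg[OF Mb k(1)] .
  have fh: "f holomorphic_on unit_disc" using f B0_D(1) by (simp add: extremal_def)
  have q_coeff: "tcoeff ?q i = (if i = 0 then 1 else if i = k then 2 * b else 0)" if "i \<le> n" for i
  proof -
    have "tcoeff ?q i = (if k dvd i then if i div k = 0 then 1 else 2 * b ^ (i div k) else 0)"
      using tcoeff_power_arg[OF Mb k(1), of i] b by (simp add: tcoeff_Mobius)
    moreover have "i = 0 \<or> i = k" if "k dvd i"
      using that \<open>i \<le> n\<close> k by (auto elim!: dvdE) (metis One_nat_def less_2_cases mult.commute mult_less_cancel2 order_le_less_trans)
    ultimately show ?thesis using k(1) by auto
  qed
  have "Re (tcoeff (\<lambda>z. f z * ?q z) n) \<ge> 0"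
    using b by (intro extremal_add_Re_nonneg[OF f q] Re_Cayley_nonneg)
      (simp add: unit_disc_def norm_mult norm_power power_le_one)
  also have "tcoeff (\<lambda>z. f z * ?q z) n = tcoeff (\<lambda>z. ?q z * f z) n" by (simp only: mult.commute)
  also have "\<dots> = (\<Sum>i\<le>n. (if i = 0 then tcoeff f n else 0) + (if i = k then 2 * b * tcoeff f j else 0))"
    unfolding tcoeff_mult[OF q fh] using k by (intro sum.cong refl) (auto simp: q_coeff)
  also have "\<dots> = tcoeff f n + 2 * (b * tcoeff f j)"
    using k(4) by (simp add: sum.distrib mult.assoc)
  also have "Re \<dots> = Mfun n f - 2 * norm (tcoeff f j)"
    unfolding bj by (simp add: Mfun_def)
  finally show ?thesis by simp
qed

text \<open>By convexity exp lies below its chord from ln 2 to 2, and at both ends it is below 4 x: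
  2 < 4 ln 2 and e^2 < 8.\<close>

lemma exp_lt_4x:
  assumes "2 \<le> exp x" "x \<le> (2::real)"
  shows "exp x < 4 * x"
proof -
  have "ln 2 \<le> ln (exp x)" using assms(1) by (subst ln_le_cancel_iff) auto
  then have ln2: "ln 2 \<le> x" "ln 2 > (1/2::real)" using ln2_ge_two_thirds by auto
  have e2: "exp (2::real) < 8"
  proof -
    have "exp (2::real) = exp 1 * exp 1" by (simp flip: exp_add)
    also have "\<dots> < (272/100) * (272/100)" by (intro mult_strict_mono e_less_272) auto
    finally show ?thesis by simp
  qed
  define t where "t = (x - ln 2) / (2 - ln 2)"
  have d: "2 - ln 2 > (0::real)" using ln_2_less_1 by simp
  have t: "0 \<le> t" "t \<le> 1" using ln2 assms d by (auto simp: t_def field_simps)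
  have x: "x = (1 - t) * ln 2 + t * 2"
  proof -
    have "2 - ln 2 \<noteq> (0::real)" by (rule less_imp_neq[OF d, symmetric])
    then have "t * (2 - ln 2) = x - ln 2" by (simp only: t_def times_divide_eq_left nonzero_mult_div_cancel_right not_False_eq_True)
    then show ?thesis by (simp add: algebra_simps)
  qed
  have "exp x \<le> (1 - t) * exp (ln 2) + t * exp 2"
    unfolding x using convex_onD[OF exp_convex, of t "ln 2" 2] t by simp
  also have "\<dots> < (1 - t) * (4 * ln 2) + t * 8"
  proof (cases "t = 1")
    case False
    then have "(1 - t) * exp (ln 2) < (1 - t) * (4 * ln 2)" using t ln2 by (intro mult_strict_left_mono) auto
    moreover have "t * exp 2 \<le> t * 8" using t e2 by (intro mult_left_mono) auto
    ultimately show ?thesis by linarith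
  qed (use e2 in simp)
  also have "\<dots> = 4 * x" by (simp add: x algebra_simps)
  finally show ?thesis .
qed

lemma one_atom_not_extremal:
  assumes n: "n \<ge> 3" and l: "l > 0" and \<gamma>: "norm \<gamma> = 1" and \<beta>: "norm \<beta> = 1"
    and F: "extremal n (\<lambda>z. \<gamma> * exp (- (of_real l * ((1 + \<beta> * z) / (1 - \<beta> * z)))))"
  shows False
proof -
  let ?F = "\<lambda>z. \<gamma> * exp (- (of_real l * ((1 + \<beta> * z) / (1 - \<beta> * z))))"
  have coeff: "norm (tcoeff ?F k) = \<bar>lcoef k l\<bar>" for k
  proof -
    have "tcoeff ?F k = tcoeff (\<lambda>z. \<gamma> * exp_atom l (\<beta> * z)) k"
      by (simp only: exp_atom_def)
    also have "\<dots> = \<gamma> * (\<beta> ^ k * of_real (lcoef k l))"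
      by (simp only: tcoeff_cmult[OF holomorphic_rotate[OF holomorphic_exp_atom \<beta>]]
          tcoeff_rotate[OF holomorphic_exp_atom \<beta>] tcoeff_exp_atom)
    finally have "tcoeff ?F k = \<gamma> * (\<beta> ^ k * of_real (lcoef k l))" .
    then show ?thesis using \<gamma> \<beta> by (simp add: norm_mult norm_power)
  qed
  define A where "A = Mfun n ?F"
  have "A \<le> \<bar>lcoef n l\<bar>"
    unfolding A_def Mfun_def coeff[symmetric] by (rule complex_Re_le_cmod)
  then have upper: "3 * A \<le> 2 + 2 * exp (- l)" using abs_lcoef_le[of n l] n l by simp
  have "2 * \<bar>lcoef 0 l\<bar> \<le> A" "2 * \<bar>lcoef 1 l\<bar> \<le> A"
    unfolding A_def coeff[symmetric] using n by (intro extremal_coeff_le_half[OF F]; simp)+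
  then have c0: "2 * exp (- l) \<le> A" and c1: "4 * l * exp (- l) \<le> A"
    using l by (simp_all add: lcoef_def algebra_simps abs_mult)
  \<comment> \<open>Indeed 3 A <= 2 + 2 exp(- l) <= 2 + A.\<close>
  have "A \<le> 1" using upper c0 by linarith
  then have "2 * exp (- l) \<le> 1" "4 * l * exp (- l) \<le> 1" using c0 c1 by auto
  then have "2 \<le> exp l" "4 * l \<le> exp l" by (simp_all add: exp_minus field_simps)
  \<comment> \<open>For l <= 2 the chord bound would give exp l < 4 l.\<close>
  then have "l > 2" using exp_lt_4x[of l] by force
  then have "8 * exp (- l) \<le> 4 * l * exp (- l)" by (intro mult_right_mono) auto
  \<comment> \<open>Now 2 exp(- l) <= A / 4, so 3 A <= 2 + A / 4.\<close>
  then have "A \<le> 8/11" using c1 upper by linarith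
  moreover have "8/11 < 2 / exp (1::real)" using e_less_272 by (simp add: field_simps)
  ultimately show False using Mfun_extremal_ge[OF F] n unfolding A_def by simp
qed

section \<open>The five conditions\<close>

text \<open>A competitor G of F yields the competitor G(z^M) of f, with the coefficient of index n
  div M moved to index n.\<close>

lemma extremal_power_arg:
  assumes f: "extremal n f" and M: "M \<ge> 1" and F: "F \<in> B0"
    and fF: "\<And>z. z \<in> unit_disc \<Longrightarrow> f z = F (z ^ M)" and n: "n \<ge> 1"
  shows "M dvd n" "extremal (n div M) F"
proof -
  note Fh = B0_D(1)[OF F]
  have coeff: "tcoeff f n = (if M dvd n then tcoeff F (n div M) else 0)"
    using tcoeff_cong[of f "\<lambda>z. F (z ^ M)" n] fF tcoeff_power_arg[OF Fh M] by simp
  then show dvd: "M dvd n" using extremal_nonzero_coeff[OF f n] by (auto split: if_splits)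
  have "Mfun (n div M) G \<le> Mfun (n div M) F" if G: "G \<in> B0" for G
  proof -
    have "z ^ M \<in> unit_disc" if "z \<in> unit_disc" for z
      using that M by (simp add: unit_disc_def norm_power power_less_one_iff)
    then have "(\<lambda>z. G (z ^ M)) \<in> B0"
      using B0_D[OF G] M by (intro B0_I holomorphic_power_arg) auto
    then have "Mfun n (\<lambda>z. G (z ^ M)) \<le> Mfun n f" using f by (simp add: extremal_def)
    then show ?thesis
      using dvd coeff tcoeff_power_arg[OF B0_D(1)[OF G] M, of n] by (simp add: Mfun_def)
  qed
  then show "extremal (n div M) F" using F by (simp add: extremal_def)
qed

text \<open>The moments \<open>\<mu>\<^sub>1, \<dots>, \<mu>\<^sub>N\<^sub>-\<^sub>1\<close> vanish, so the nodes \<open>\<alpha>\<^sub>j\<close> form the quadrature rule of the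
  polynomial \<open>\<Prod>\<^sub>j (x - \<alpha>\<^sub>j) = x\<^sup>N - \<beta>\<close>, and \<open>f\<close> is a one-atom function of \<open>z\<^sup>N\<close>.\<close>

lemma extremal_full_gap:
  assumes f: "extremal n f" and n: "n \<ge> 1" and atoms: "has_atoms f N"
    and gap: "\<And>j. 1 \<le> j \<Longrightarrow> j \<le> N - 1 \<Longrightarrow> tcoeff f j = 0"
    and j: "1 \<le> j" "j \<le> n div 3"
  shows "tcoeff f j = 0"
proof -
  from atoms obtain \<gamma> lam \<alpha> where N: "1 \<le> N" and \<gamma>: "norm \<gamma> = 1" and lam: "\<And>j. j < N \<Longrightarrow> lam j > 0"
    and \<alpha>: "\<And>j. j < N \<Longrightarrow> norm (\<alpha> j) = 1" and inj: "inj_on \<alpha> {..<N}"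
    and frep: "\<And>z. z \<in> unit_disc \<Longrightarrow> f z = \<gamma> * exp (- atom_exponent N lam \<alpha> z)"
    by (rule has_atomsE) blast
  define l where "l = (\<Sum>j<N. lam j)"
  have l: "l > 0" unfolding l_def using N lam by (intro sum_pos) (auto simp: lessThan_empty_iff)
  have P: "atom_exponent N lam \<alpha> holomorphic_on unit_disc"
    by (rule holomorphic_atom_exponent[OF lam \<alpha>])
  have "f 0 \<noteq> 0" using f B0_D(2)[of f 0] by (simp add: extremal_def)
  have \<mu>: "moment N lam \<alpha> k = 0" if k: "1 \<le> k" "k < N" for k
  proof -
    have "tcoeff (atom_exponent N lam \<alpha>) k = 0"
      by (rule tcoeff_exp_gap_zero[OF P frep \<open>f 0 \<noteq> 0\<close>, of "N - 1"]) (use gap k in auto)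
    then show ?thesis using tcoeff_atom_exponent[where N = N and k = k, OF lam \<alpha>] k by simp
  qed
  define R where "R = (\<Prod>j<N. [:- \<alpha> j, 1:])"
  have degR: "degree R = N" unfolding R_def by (subst degree_prod_eq_sum_degree) auto
  have "lead_coeff R = 1" unfolding R_def by (simp add: lead_coeff_prod)
  then have lead: "coeff R N = 1" by (simp add: degR)
  have R0: "poly R (\<alpha> j) = 0" if "j < N" for j
    unfolding R_def poly_prod using that by (auto intro!: prod_zero)
  \<comment> \<open>Sum R(\<alpha>_j) = 0 against lam_j cnj (\<alpha>_j^s): since |i - s| < N, the
    vanishing moments leave only the i = s term, coeff R s times l.\<close>
  have mid: "coeff R s = 0" if s: "1 \<le> s" "s < N" for s
  proof -
    have M: "(\<Sum>j<N. of_real (lam j) * (\<alpha> j ^ i * cnj (\<alpha> j ^ s))) = (if i = s then of_real l else 0)" if i: "i \<le> N" for i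
    proof (cases "s \<le> i")
      case True
      have "(\<Sum>j<N. of_real (lam j) * (\<alpha> j ^ i * cnj (\<alpha> j ^ s))) = moment N lam \<alpha> (i - s)"
        unfolding moment_def by (intro sum.cong refl) (simp only: power_mult_cnj_power[OF \<alpha> True] lessThan_iff)
      also have "\<dots> = (if i = s then of_real l else 0)"
        using \<mu>[of "i - s"] True s i by (auto simp: moment_def l_def)
      finally show ?thesis .
    next
      case False
      then have "cnj (\<Sum>j<N. of_real (lam j) * (\<alpha> j ^ i * cnj (\<alpha> j ^ s))) =
          (\<Sum>j<N. of_real (lam j) * (\<alpha> j ^ s * cnj (\<alpha> j ^ i)))" by (simp add: mult_ac)
      also have "\<dots> = moment N lam \<alpha> (s - i)"
        unfolding moment_def using False
        by (intro sum.cong refl) (simp only: power_mult_cnj_power[OF \<alpha>] lessThan_iff less_imp_le not_le)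
      also have "\<dots> = 0" using \<mu>[of "s - i"] False s by simp
      finally have "(\<Sum>j<N. of_real (lam j) * (\<alpha> j ^ i * cnj (\<alpha> j ^ s))) = 0"
        by (simp only: complex_cnj_zero_iff)
      then show ?thesis using False by auto
    qed
    have "0 = (\<Sum>j<N. of_real (lam j) * cnj (\<alpha> j ^ s) * poly R (\<alpha> j))"
      using R0 by (intro sum.neutral[symmetric]) auto
    also have "\<dots> = (\<Sum>j<N. \<Sum>i\<le>N. coeff R i * (of_real (lam j) * (\<alpha> j ^ i * cnj (\<alpha> j ^ s))))"
      unfolding poly_altdef degR sum_distrib_left by (intro sum.cong refl) (simp only: mult_ac)
    also have "\<dots> = (\<Sum>i\<le>N. coeff R i * (\<Sum>j<N. of_real (lam j) * (\<alpha> j ^ i * cnj (\<alpha> j ^ s))))"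
      by (subst sum.swap) (simp only: sum_distrib_left)
    also have "\<dots> = (\<Sum>i\<le>N. coeff R i * (if i = s then of_real l else 0))"
      by (intro sum.cong refl) (simp only: M atMost_iff)
    also have "\<dots> = (\<Sum>i\<le>N. if i = s then coeff R s * of_real l else 0)"
      by (intro sum.cong refl) auto
    also have "\<dots> = coeff R s * of_real l" using s by simp
    finally show ?thesis using l by simp
  qed
  define \<beta> where "\<beta> = - coeff R 0"
  have \<beta>: "\<alpha> j ^ N = \<beta>" if "j < N" for j
  proof -
    have "poly R (\<alpha> j) = (\<Sum>i\<in>{0,N}. coeff R i * \<alpha> j ^ i)"
      unfolding poly_altdef degR using mid by (intro sum.mono_neutral_right) (auto simp: Suc_le_eq)
    also have "\<dots> = \<alpha> j ^ N - \<beta>" using N lead by (simp add: \<beta>_def)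
    finally show ?thesis using R0[OF that] by simp
  qed
  have \<beta>1: "norm \<beta> = 1" using \<beta>[of 0] \<alpha>[of 0] N by (metis less_le_trans norm_power power_one zero_less_one)
  define F where "F = (\<lambda>w. \<gamma> * exp (- (of_real l * ((1 + \<beta> * w) / (1 - \<beta> * w)))))"
  have "F \<in> B0"
    unfolding F_def
  proof (rule exp_minus_in_B0[OF _ _ \<gamma>])
    show "(\<lambda>w. of_real l * ((1 + \<beta> * w) / (1 - \<beta> * w))) holomorphic_on unit_disc"
      using \<beta>1 by (intro holomorphic_on_mult holomorphic_on_const holomorphic_Mobius) simp
    fix w assume "w \<in> unit_disc"
    then have "Re ((1 + \<beta> * w) / (1 - \<beta> * w)) \<ge> 0"
      using \<beta>1 by (intro Re_Cayley_nonneg) (simp add: unit_disc_def norm_mult)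
    then have "l * Re ((1 + \<beta> * w) / (1 - \<beta> * w)) \<ge> 0" using l by simp
    then show "Re (of_real l * ((1 + \<beta> * w) / (1 - \<beta> * w))) \<ge> 0"
      by (simp only: Re_complex_of_real Im_complex_of_real times_complex.simps mult_zero_left diff_zero)
  qed
  have "f z = F (z ^ N)" if z: "z \<in> unit_disc" for z
    using frep[OF z] atom_exponent_same_power[OF lam \<alpha> N \<beta> \<mu> z N] unfolding F_def l_def by simp
  from extremal_power_arg[OF f N \<open>F \<in> B0\<close> this n]
  have dvd: "N dvd n" and ext: "extremal (n div N) F" by auto
  have "n div N < 3"
  proof (rule ccontr)
    assume "\<not> n div N < 3"
    then show False using one_atom_not_extremal[OF _ l \<gamma> \<beta>1 ext[unfolded F_def]] by simp
  qed
  \<comment> \<open>So n is N or 2 N, and n div 3 < N.\<close>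
  then have "n \<le> 2 * N" using dvd by (auto elim!: dvdE simp: mult.commute)
  then have "j \<le> N - 1" using j N by linarith
  then show ?thesis using gap j by simp
qed

text \<open>Splitting off the full power of z leaves a cofactor without roots, which is constant by
  the fundamental theorem of algebra.\<close>

lemma poly_only_root_0:
  fixes p :: "complex poly"
  assumes "p \<noteq> 0" "\<And>z. poly p z = 0 \<Longrightarrow> z = 0"
  obtains c k where "c \<noteq> 0" "p = monom c k"
proof -
  define k where "k = order 0 p"
  obtain q where q: "p = [:-0, 1:] ^ k * q" "\<not> [:-0, 1:] dvd q"
    using order_decomp[OF assms(1), of 0] k_def by blast
  have q0: "poly q 0 \<noteq> 0" using q(2) unfolding poly_eq_0_iff_dvd .
  then have "poly q z \<noteq> 0" for z using assms(2)[of z] q(1) by (cases "z = 0") auto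
  then obtain c where c: "q = [:c:]" using fundamental_theorem_of_algebra_alt[of q] by blast
  have "[:0, 1:] ^ k = monom (1::complex) k" by (simp add: monom_altdef)
  then have p: "p = monom c k" using q(1) c by (simp add: smult_monom)
  have "c \<noteq> 0" using p assms(1) by auto
  then show ?thesis using that p by blast
qed

lemma tcoeff_z_power_mult:
  assumes "H holomorphic_on unit_disc" "k < M"
  shows "tcoeff (\<lambda>z. z ^ M * H z) k = 0"
proof -
  have "(\<lambda>z. z ^ M * H z) has_fps_expansion fps_X ^ M * Abs_fps (tcoeff H)"
    by (intro fps_expansion_intros has_fps_expansion_tcoeff assms)
  from tcoeff_eq_fps_nth[OF this, of k] show ?thesis
    using assms(2) by (simp add: fps_X_power_mult_nth)
qed

text \<open>Any branch g of log f differs from - p by a constant: exp (g + p) is constant, so g + p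
  has derivative 0 on the connected disc.\<close>

lemma exp_eq_imp_diff_const:
  assumes p: "p holomorphic_on unit_disc" and g: "g holomorphic_on unit_disc"
    and eq: "\<And>z. z \<in> unit_disc \<Longrightarrow> exp (g z) = c * exp (- p z)" and z: "z \<in> unit_disc"
  shows "g z - g 0 = p 0 - p z"
proof -
  have gp: "(\<lambda>z. g z + p z) holomorphic_on unit_disc" using p g by (intro holomorphic_intros)
  have e: "exp (g z + p z) = c" if "z \<in> unit_disc" for z
  proof -
    have "exp (g z + p z) = c * (exp (- p z) * exp (p z))"
      by (simp only: exp_add eq[OF that] mult.assoc)
    then show ?thesis by (simp flip: exp_add)
  qed
  have der0: "((\<lambda>z. g z + p z) has_field_derivative 0) (at z)" if z: "z \<in> unit_disc" for z
  proof -
    define d where "d = deriv (\<lambda>z. g z + p z) z"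
    have d: "((\<lambda>z. g z + p z) has_field_derivative d) (at z)"
      unfolding d_def using holomorphic_derivI[OF gp open_unit_disc z] .
    have "((\<lambda>z. exp (g z + p z)) has_field_derivative exp (g z + p z) * d) (at z)"
      by (rule DERIV_chain2[OF DERIV_exp d])
    moreover have "((\<lambda>z. exp (g z + p z)) has_field_derivative 0) (at z)"
      by (rule has_field_derivative_transform_within_open[OF DERIV_const[of c] open_unit_disc z]) (simp add: e)
    ultimately have "exp (g z + p z) * d = 0" by (rule DERIV_unique)
    then show ?thesis using d by simp
  qed
  have der: "((\<lambda>z. g z + p z) has_field_derivative 0) (at z within unit_disc)" if "z \<in> unit_disc" for z
    by (rule has_field_derivative_at_within[OF der0[OF that]])
  have "\<exists>k. \<forall>z\<in>unit_disc. g z + p z = k"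
    by (rule has_field_derivative_zero_constant[OF _ der]) (simp_all add: unit_disc_def)
  then obtain k where "\<And>z. z \<in> unit_disc \<Longrightarrow> g z + p z = k" by blast
  then have "g z + p z = g 0 + p 0" using z by simp
  then show ?thesis by (simp add: algebra_simps)
qed

text \<open>The numerator of the sum of c j / (1 - \<alpha> j z)^m over the common denominator. The
  case m = 1 serves P - P 0, and m = 2 serves P'.\<close>

definition atom_numerator :: "nat \<Rightarrow> nat \<Rightarrow> (nat \<Rightarrow> complex) \<Rightarrow> (nat \<Rightarrow> complex) \<Rightarrow> complex poly" where
  "atom_numerator m N c \<alpha> = (\<Sum>j<N. smult (c j) (\<Prod>i\<in>{..<N}-{j}. [:1, - \<alpha> i:] ^ m))"

lemma poly_atom_numerator:
  assumes "\<And>j. j < N \<Longrightarrow> 1 - \<alpha> j * z \<noteq> 0"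
  shows "poly (atom_numerator m N c \<alpha>) z = (\<Prod>i<N. (1 - \<alpha> i * z) ^ m) * (\<Sum>j<N. c j / (1 - \<alpha> j * z) ^ m)"
proof -
  have "poly (atom_numerator m N c \<alpha>) z = (\<Sum>j<N. c j * (\<Prod>i\<in>{..<N}-{j}. (1 - \<alpha> i * z) ^ m))"
    by (simp add: atom_numerator_def poly_sum poly_prod mult.commute)
  also have "\<dots> = (\<Sum>j<N. (\<Prod>i<N. (1 - \<alpha> i * z) ^ m) * (c j / (1 - \<alpha> j * z) ^ m))"
  proof (rule sum.cong[OF refl])
    fix j assume j: "j \<in> {..<N}"
    have "(\<Prod>i<N. (1 - \<alpha> i * z) ^ m) = (1 - \<alpha> j * z) ^ m * (\<Prod>i\<in>{..<N}-{j}. (1 - \<alpha> i * z) ^ m)"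
      using j by (intro prod.remove) auto
    then show "c j * (\<Prod>i\<in>{..<N}-{j}. (1 - \<alpha> i * z) ^ m) = (\<Prod>i<N. (1 - \<alpha> i * z) ^ m) * (c j / (1 - \<alpha> j * z) ^ m)"
      using assms[of j] j by simp
  qed
  finally show ?thesis by (simp add: sum_distrib_left)
qed

text \<open>At the pole 1 / \<alpha> j only the j-th summand survives. Hence a root of the numerator
  is never a pole.\<close>

lemma poly_atom_numerator_pole:
  assumes j: "j < N" and z: "1 - \<alpha> j * z = 0" and inj: "inj_on \<alpha> {..<N}" and c: "c j \<noteq> 0" and m: "m \<ge> 1"
  shows "poly (atom_numerator m N c \<alpha>) z \<noteq> 0"
proof -
  have "z \<noteq> 0" using z by auto
  have "poly (atom_numerator m N c \<alpha>) z = (\<Sum>k<N. c k * (\<Prod>i\<in>{..<N}-{k}. (1 - \<alpha> i * z) ^ m))"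
    by (simp add: atom_numerator_def poly_sum poly_prod mult.commute)
  also have "\<dots> = (\<Sum>k\<in>{j}. c k * (\<Prod>i\<in>{..<N}-{k}. (1 - \<alpha> i * z) ^ m))"
  proof (rule sum.mono_neutral_right)
    show "\<forall>k\<in>{..<N} - {j}. c k * (\<Prod>i\<in>{..<N}-{k}. (1 - \<alpha> i * z) ^ m) = 0"
    proof
      fix k assume "k \<in> {..<N} - {j}"
      then have "(\<Prod>i\<in>{..<N}-{k}. (1 - \<alpha> i * z) ^ m) = 0"
        using j z m by (intro prod_zero) (auto intro!: bexI[of _ j] simp: power_0_left)
      then show "c k * (\<Prod>i\<in>{..<N}-{k}. (1 - \<alpha> i * z) ^ m) = 0" by simp
    qed
  qed (use j in auto)
  also have "\<dots> \<noteq> 0"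
  proof -
    have "1 - \<alpha> i * z \<noteq> 0" if "i \<in> {..<N} - {j}" for i
    proof
      assume "1 - \<alpha> i * z = 0"
      then have "\<alpha> i * z = \<alpha> j * z" using z by simp
      then have "\<alpha> i = \<alpha> j" using \<open>z \<noteq> 0\<close> by simp
      then show False using inj_onD[OF inj] that j by auto
    qed
    then show ?thesis using c by (simp add: prod_zero_iff)
  qed
  finally show ?thesis .
qed

text \<open>Outside the disc \<open>Re P \<le> 0 < P 0\<close>, so all solutions of \<open>P z = P 0\<close> lie in the disc; if there is only
  \<open>z = 0\<close>, the numerator of \<open>P - P 0\<close> is a monomial.\<close>

lemma cond2_imp_full_gap:
  assumes atoms: "has_atoms f N" and c2: "cond2 f" and k: "1 \<le> k" "k \<le> N - 1"
  shows "tcoeff f k = 0"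
proof -
  from atoms obtain \<gamma> lam \<alpha> where N: "1 \<le> N" and \<gamma>: "norm \<gamma> = 1" and lam: "\<And>j. j < N \<Longrightarrow> lam j > 0"
    and \<alpha>: "\<And>j. j < N \<Longrightarrow> norm (\<alpha> j) = 1" and inj: "inj_on \<alpha> {..<N}"
    and frep: "\<And>z. z \<in> unit_disc \<Longrightarrow> f z = \<gamma> * exp (- atom_exponent N lam \<alpha> z)"
    by (rule has_atomsE) blast
  let ?P = "atom_exponent N lam \<alpha>"
  have P: "?P holomorphic_on unit_disc" by (rule holomorphic_atom_exponent[OF lam \<alpha>])
  obtain g where g: "g holomorphic_on unit_disc" "\<And>z. z \<in> unit_disc \<Longrightarrow> exp (g z) = f z"
    "\<And>z. z \<in> unit_disc \<Longrightarrow> g z = g 0 \<longleftrightarrow> z = 0"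
    using c2 unfolding cond2_def by blast
  have P_inj0: "?P z \<noteq> ?P 0" if z: "z \<in> unit_disc" "z \<noteq> 0" for z
    using exp_eq_imp_diff_const[OF P g(1) _ z(1), of \<gamma>] g(2) frep g(3)[OF z(1)] z(2) by auto
  define c where "c = (\<lambda>j. of_real (lam j) * \<alpha> j)"
  have c_nz: "c j \<noteq> 0" if "j < N" for j using lam[OF that] \<alpha>[OF that] by (auto simp: c_def)
  define B where "B = atom_numerator 1 N c \<alpha>"
  have nz: "1 - \<alpha> j * z \<noteq> 0" if "j < N" "z \<in> unit_disc" for j z
    using one_minus_mult_nz[OF _ that(2)] \<alpha>[OF that(1)] by simp
  have summand: "(1 + w) / (1 - w) = 1 + 2 * (w / (1 - w))" if "1 - w \<noteq> 0" for w :: complex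
    using that by (simp add: field_simps)
  \<comment> \<open>Stated for all z off the poles, because roots of B outside the disc must be
    excluded too.\<close>
  have P_eq: "(\<Sum>j<N. of_real (lam j) * ((1 + \<alpha> j * z) / (1 - \<alpha> j * z))) =
      of_real (\<Sum>j<N. lam j) + 2 * z * (\<Sum>j<N. c j / (1 - \<alpha> j * z) ^ 1)"
    if "\<And>j. j < N \<Longrightarrow> 1 - \<alpha> j * z \<noteq> 0" for z
  proof -
    have "(\<Sum>j<N. of_real (lam j) * ((1 + \<alpha> j * z) / (1 - \<alpha> j * z))) =
        (\<Sum>j<N. of_real (lam j) + 2 * z * (c j / (1 - \<alpha> j * z) ^ 1))"
    proof (rule sum.cong[OF refl])
      fix j assume "j \<in> {..<N}"
      then have "1 - \<alpha> j * z \<noteq> 0" using that by simp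
      from summand[OF this] show "of_real (lam j) * ((1 + \<alpha> j * z) / (1 - \<alpha> j * z)) =
          of_real (lam j) + 2 * z * (c j / (1 - \<alpha> j * z) ^ 1)"
        by (simp add: c_def algebra_simps)
    qed
    then show ?thesis by (simp add: sum.distrib sum_distrib_left)
  qed
  have lpos: "(\<Sum>j<N. lam j) > 0" using N lam by (intro sum_pos) (auto simp: lessThan_empty_iff)
  have B_root: "z = 0" if root: "poly B z = 0" for z
  proof (rule ccontr)
    assume z0: "z \<noteq> 0"
    have ne: "1 - \<alpha> j * z \<noteq> 0" if "j < N" for j
      using poly_atom_numerator_pole[where m = 1 and z = z and c = c and \<alpha> = \<alpha>, OF that _ inj c_nz[OF that]] root by (auto simp: B_def)
    have "(\<Sum>j<N. c j / (1 - \<alpha> j * z) ^ 1) = 0"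
      using poly_atom_numerator[OF ne, where m = 1 and c = c] root ne by (auto simp: B_def prod_zero_iff)
    then have eq: "(\<Sum>j<N. of_real (lam j) * ((1 + \<alpha> j * z) / (1 - \<alpha> j * z))) = of_real (\<Sum>j<N. lam j)"
      using P_eq[OF ne] by simp
    show False
    proof (cases "z \<in> unit_disc")
      case True
      then show False using P_inj0[OF True z0] eq by (simp add: atom_exponent_def)
    next
      case False
      then have z1: "norm z \<ge> 1" by (simp add: unit_disc_def)
      have "Re (of_real (lam j) * ((1 + \<alpha> j * z) / (1 - \<alpha> j * z))) \<le> 0" if "j < N" for j
      proof -
        let ?w = "\<alpha> j * z"
        have "Re ((1 + ?w) / (1 - ?w)) = (1 - (norm ?w)\<^sup>2) / (norm (1 - ?w))\<^sup>2"
          unfolding cmod_power2 by (simp add: Re_divide algebra_simps power2_eq_square)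
        moreover have "(norm ?w)\<^sup>2 \<ge> 1" using \<alpha>[OF that] z1 by (simp add: norm_mult)
        ultimately have "Re ((1 + ?w) / (1 - ?w)) \<le> 0" by (simp add: divide_nonpos_nonneg)
        then have "lam j * Re ((1 + ?w) / (1 - ?w)) \<le> 0"
          using lam[OF that] by (intro mult_nonneg_nonpos) auto
        then show ?thesis
          by (simp only: Re_complex_of_real Im_complex_of_real times_complex.simps mult_zero_left diff_zero)
      qed
      then have "Re (\<Sum>j<N. of_real (lam j) * ((1 + \<alpha> j * z) / (1 - \<alpha> j * z))) \<le> 0"
        unfolding Re_sum by (intro sum_nonpos) auto
      then show False using lpos unfolding eq by simp
    qed
  qed
  have deg_term: "degree (\<Prod>i\<in>{..<N}-{j}. [:1, - \<alpha> i:] ^ 1) = N - 1"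
    and lead_term: "coeff (\<Prod>i\<in>{..<N}-{j}. [:1, - \<alpha> i:] ^ 1) (N - 1) = (\<Prod>i\<in>{..<N}-{j}. - \<alpha> i)"
    if j: "j < N" for j
  proof -
    have a: "\<alpha> i \<noteq> 0" if "i < N" for i using \<alpha>[OF that] by auto
    show deg: "degree (\<Prod>i\<in>{..<N}-{j}. [:1, - \<alpha> i:] ^ 1) = N - 1"
      using j a by (subst degree_prod_eq_sum_degree) auto
    have "coeff (\<Prod>i\<in>{..<N}-{j}. [:1, - \<alpha> i:] ^ 1) (N - 1) = (\<Prod>i\<in>{..<N}-{j}. lead_coeff ([:1, - \<alpha> i:] ^ 1))"
      using lead_coeff_prod[of "\<lambda>i. [:1, - \<alpha> i:] ^ 1" "{..<N}-{j}"] unfolding deg .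
    also have "\<dots> = (\<Prod>i\<in>{..<N}-{j}. - \<alpha> i)"
      using a by (intro prod.cong refl) auto
    finally show "coeff (\<Prod>i\<in>{..<N}-{j}. [:1, - \<alpha> i:] ^ 1) (N - 1) = (\<Prod>i\<in>{..<N}-{j}. - \<alpha> i)" .
  qed
  \<comment> \<open>The coefficient is nonzero because the total mass is positive, and so it fixes
    the degree of the monomial B as N - 1.\<close>
  have "coeff B (N - 1) = (\<Sum>j<N. - of_real (lam j) * (\<Prod>i<N. - \<alpha> i))"
    unfolding B_def atom_numerator_def coeff_sum coeff_smult
  proof (rule sum.cong[OF refl])
    fix j assume j: "j \<in> {..<N}"
    have "(\<Prod>i<N. - \<alpha> i) = - \<alpha> j * (\<Prod>i\<in>{..<N}-{j}. - \<alpha> i)" using j by (intro prod.remove) auto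
    then show "c j * coeff (\<Prod>i\<in>{..<N}-{j}. [:1, - \<alpha> i:] ^ 1) (N - 1) = - of_real (lam j) * (\<Prod>i<N. - \<alpha> i)"
      using lead_term[of j] j by (simp add: c_def)
  qed
  also have "\<dots> = - of_real (\<Sum>j<N. lam j) * (\<Prod>i<N. - \<alpha> i)"
    by (simp add: sum_distrib_right sum_negf)
  finally have B_coeff: "coeff B (N - 1) = - of_real (\<Sum>j<N. lam j) * (\<Prod>i<N. - \<alpha> i)" .
  then have B_lead: "coeff B (N - 1) \<noteq> 0"
  proof -
    have "(\<Prod>i<N. - \<alpha> i) \<noteq> 0" using \<alpha> by (force simp: prod_zero_iff)
    moreover have "complex_of_real (\<Sum>j<N. lam j) \<noteq> 0" using lpos by (simp only: of_real_eq_0_iff)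
    ultimately show ?thesis
      unfolding B_coeff by (metis mult_eq_0_iff neg_equal_0_iff_equal)
  qed
  then have "B \<noteq> 0" by auto
  obtain b d where b: "b \<noteq> 0" "B = monom b d" using poly_only_root_0[OF \<open>B \<noteq> 0\<close> B_root] by blast
  have "d = N - 1" using B_lead unfolding b(2) coeff_monom by presburger
  then have B: "B = monom b (N - 1)" using b by simp
  \<comment> \<open>The cofactor in P - P 0 = z^N H, which makes the coefficients of P between 1 and
    N - 1 vanish.\<close>
  define H where "H = (\<lambda>z. 2 * b / (\<Prod>i<N. (1 - \<alpha> i * z) ^ 1))"
  have H: "H holomorphic_on unit_disc"
    unfolding H_def using nz by (intro holomorphic_intros) (auto simp: prod_zero_iff)
  have P_H: "?P z - ?P 0 = z ^ N * H z" if z: "z \<in> unit_disc" for z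
  proof -
    have pr: "(\<Prod>i<N. (1 - \<alpha> i * z) ^ 1) \<noteq> 0" using nz z by (auto simp: prod_zero_iff)
    have "poly B z = (\<Prod>i<N. (1 - \<alpha> i * z) ^ 1) * (\<Sum>j<N. c j / (1 - \<alpha> j * z) ^ 1)"
      unfolding B_def using nz z by (intro poly_atom_numerator) auto
    then have "(\<Sum>j<N. c j / (1 - \<alpha> j * z) ^ 1) = b * z ^ (N - 1) / (\<Prod>i<N. (1 - \<alpha> i * z) ^ 1)"
      using pr by (simp add: B poly_monom field_simps)
    moreover have "?P z - ?P 0 = 2 * z * (\<Sum>j<N. c j / (1 - \<alpha> j * z) ^ 1)"
      using P_eq[of z] nz z by (simp add: atom_exponent_def)
    moreover have "z * z ^ (N - 1) = z ^ N" using N by (cases N) auto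
    ultimately show ?thesis by (simp add: H_def mult_ac)
  qed
  have Pk: "tcoeff ?P i = 0" if "1 \<le> i" "i \<le> N - 1" for i
  proof -
    have "tcoeff ?P i = tcoeff (\<lambda>z. ?P 0 + z ^ N * H z) i"
      by (rule tcoeff_cong) (simp add: P_H[symmetric])
    also have "\<dots> = tcoeff (\<lambda>z. ?P 0) i + tcoeff (\<lambda>z. z ^ N * H z) i"
      by (intro tcoeff_add holomorphic_intros H)
    also have "\<dots> = 0" using that N tcoeff_z_power_mult[OF H, of i N] by (simp add: tcoeff_const)
    finally show ?thesis .
  qed
  show ?thesis by (rule exp_gap_zero_converse[OF P frep Pk k])
qed

text \<open>The function \<open>z P' z\<close> is symmetric under \<open>z \<mapsto> 1 / cnj z\<close> and negative on the circle, so its zeros off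
  the origin come in pairs with one member in the disc.\<close>

lemma cond3_imp_full_gap:
  assumes atoms: "has_atoms f N" and c3: "cond3 f" and k: "1 \<le> k" "k \<le> N - 1"
  shows "tcoeff f k = 0"
proof -
  from atoms obtain \<gamma> lam \<alpha> where N: "1 \<le> N" and \<gamma>: "norm \<gamma> = 1" and lam: "\<And>j. j < N \<Longrightarrow> lam j > 0"
    and \<alpha>: "\<And>j. j < N \<Longrightarrow> norm (\<alpha> j) = 1" and inj: "inj_on \<alpha> {..<N}"
    and frep: "\<And>z. z \<in> unit_disc \<Longrightarrow> f z = \<gamma> * exp (- atom_exponent N lam \<alpha> z)"
    by (rule has_atomsE) blast
  let ?P = "atom_exponent N lam \<alpha>"
  have P: "?P holomorphic_on unit_disc" by (rule holomorphic_atom_exponent[OF lam \<alpha>])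
  define c where "c = (\<lambda>j. of_real (lam j) * \<alpha> j)"
  have c_nz: "c j \<noteq> 0" if "j < N" for j using lam[OF that] \<alpha>[OF that] by (auto simp: c_def)
  have nz: "1 - \<alpha> j * z \<noteq> 0" if "j < N" "z \<in> unit_disc" for j z
    using one_minus_mult_nz[OF _ that(2)] \<alpha>[OF that(1)] by simp
  define B where "B = atom_numerator 2 N c \<alpha>"
  define D where "D = (\<lambda>z. \<Sum>j<N. c j / (1 - \<alpha> j * z) ^ 2)"
  define Q where "Q = (\<lambda>z. \<Prod>i<N. (1 - \<alpha> i * z) ^ 2)"
  have BD: "poly B z = Q z * D z" if "\<And>j. j < N \<Longrightarrow> 1 - \<alpha> j * z \<noteq> 0" for z
    unfolding B_def Q_def D_def using that by (rule poly_atom_numerator)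
  have Q_nz: "Q z \<noteq> 0" if "\<And>j. j < N \<Longrightarrow> 1 - \<alpha> j * z \<noteq> 0" for z
    unfolding Q_def using that by (auto simp: prod_zero_iff)
  have P_deriv: "(?P has_field_derivative 2 * D z) (at z)" if z: "z \<in> unit_disc" for z
  proof -
    have "((\<lambda>z. of_real (lam j) * ((1 + \<alpha> j * z) / (1 - \<alpha> j * z))) has_field_derivative 2 * (c j / (1 - \<alpha> j * z) ^ 2)) (at z)"
      if "j \<in> {..<N}" for j
    proof -
      have "((\<lambda>z. (1 + \<alpha> j * z) / (1 - \<alpha> j * z)) has_field_derivative 2 * \<alpha> j / (1 - \<alpha> j * z) ^ 2) (at z)"
        using nz[of j z] that z
        by (auto intro!: derivative_eq_intros simp: power2_eq_square algebra_simps)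
      from DERIV_cmult[OF this, of "of_real (lam j)"] show ?thesis by (simp add: c_def mult_ac)
    qed
    then show ?thesis
      unfolding D_def sum_distrib_left atom_exponent_def[abs_def] by (rule DERIV_sum)
  qed
  have D_nz: "D z \<noteq> 0" if z: "z \<in> unit_disc" "z \<noteq> 0" for z
  proof
    assume "D z = 0"
    have "((\<lambda>z. \<gamma> * exp (- ?P z)) has_field_derivative \<gamma> * (exp (- ?P z) * (- (2 * D z)))) (at z)"
      by (intro DERIV_cmult DERIV_chain2[OF DERIV_exp] DERIV_minus P_deriv z)
    then have "(f has_field_derivative \<gamma> * (exp (- ?P z) * (- (2 * D z)))) (at z)"
      by (rule has_field_derivative_transform_within_open[OF _ open_unit_disc z(1)]) (simp add: frep)
    then have "deriv f z = 0" using \<open>D z = 0\<close> by (simp add: DERIV_imp_deriv)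
    then show False using c3 z by (auto simp: cond3_def)
  qed
  have zD: "z * D z = (\<Sum>j<N. of_real (lam j) * ((\<alpha> j * z) / (1 - \<alpha> j * z) ^ 2))" for z
    unfolding D_def sum_distrib_left c_def by (intro sum.cong refl) simp
  have sym: "(1 / cnj z) * D (1 / cnj z) = cnj (z * D z)" if z: "z \<noteq> 0" for z
  proof -
    \<comment> \<open>At w = 1 both sides are 0 by the convention for division by 0.\<close>
    have key: "v / (1 - v) ^ 2 = cnj (w / (1 - w) ^ 2)" if "v = 1 / cnj w" "w \<noteq> 0" for v w :: complex
    proof (cases "w = 1")
      case False
      have "cnj w \<noteq> 1" using False complex_cnj_one_iff by blast
      then have *: "cnj w - 1 \<noteq> 0" by simp
      have "1 - v = (cnj w - 1) / cnj w" using that by (simp add: field_simps)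
      then have "v / (1 - v) ^ 2 = cnj w / (cnj w - 1) ^ 2" using that * by (simp add: power2_eq_square)
      also have "\<dots> = cnj (w / (1 - w) ^ 2)" by (simp add: power2_commute)
      finally show ?thesis .
    qed (use that in simp)
    have "(\<alpha> j * (1 / cnj z)) / (1 - \<alpha> j * (1 / cnj z)) ^ 2 = cnj ((\<alpha> j * z) / (1 - \<alpha> j * z) ^ 2)" if "j < N" for j
    proof (rule key)
      have "\<alpha> j * cnj (\<alpha> j) = 1" using \<alpha>[OF that] by (simp add: complex_norm_square[symmetric])
      moreover from this have "cnj (\<alpha> j) \<noteq> 0" by auto
      ultimately show "\<alpha> j * (1 / cnj z) = 1 / cnj (\<alpha> j * z)" using z by (simp add: field_simps)
      show "\<alpha> j * z \<noteq> 0" using \<alpha>[OF that] z by auto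
    qed
    then show ?thesis unfolding zD cnj_sum by (intro sum.cong refl) simp
  qed
  have B_root: "z = 0" if root: "poly B z = 0" for z
  proof (rule ccontr)
    assume z0: "z \<noteq> 0"
    have ne: "1 - \<alpha> j * z \<noteq> 0" if "j < N" for j
      using poly_atom_numerator_pole[where m = 2 and z = z and c = c and \<alpha> = \<alpha>, OF that _ inj c_nz[OF that]] root by (auto simp: B_def)
    have Dz: "D z = 0" using BD[OF ne] Q_nz[OF ne] root by simp
    consider "norm z < 1" | "norm z = 1" | "norm z > 1" by linarith
    then show False
    proof cases
      case 1
      then show False using D_nz[of z] z0 Dz by (simp add: unit_disc_def)
    next
      case 2
      have "Re (of_real (lam j) * ((\<alpha> j * z) / (1 - \<alpha> j * z) ^ 2)) < 0" if j: "j < N" for j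
      proof -
        define w where "w = \<alpha> j * z"
        have "norm w = 1" using \<alpha>[OF j] 2 by (simp add: w_def norm_mult)
        then have w: "w * cnj w = 1" "1 - w \<noteq> 0"
          using ne[OF j] by (simp_all only: w_def[symmetric] complex_norm_square[symmetric]) auto
        \<comment> \<open>For |w| = 1 this leads to w / (1 - w)^2 = - 1 / |1 - w|^2, a negative real
          number.\<close>
        have "of_real ((norm (1 - w))\<^sup>2) = (1 - w) * cnj (1 - w)" by (rule complex_norm_square)
        then have "w * of_real ((norm (1 - w))\<^sup>2) = w * ((1 - w) * cnj (1 - w))"
          by (simp only:)
        also have "\<dots> = (1 - w) * (w - w * cnj w)" by (simp add: algebra_simps)
        finally have "w * of_real ((norm (1 - w))\<^sup>2) = - ((1 - w) ^ 2)"
          unfolding w(1) by (simp add: power2_eq_square algebra_simps)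
        then have "w / (1 - w) ^ 2 = of_real (- 1 / (norm (1 - w))\<^sup>2)"
          using w(2) by (simp add: field_simps)
        then have "of_real (lam j) * (w / (1 - w) ^ 2) = of_real (lam j * (- 1 / (norm (1 - w))\<^sup>2))"
          by (simp only: of_real_mult)
        moreover have "lam j * (- 1 / (norm (1 - w))\<^sup>2) < 0"
          using lam[OF j] w(2) by (simp add: divide_pos_pos)
        ultimately show ?thesis unfolding w_def[symmetric] by (simp only: Re_complex_of_real)
      qed
      then have "Re (z * D z) < (\<Sum>j<N. 0)"
        unfolding zD Re_sum using N by (intro sum_strict_mono) (auto simp: lessThan_empty_iff)
      then show False using Dz by simp
    next
      case 3
      then have "1 / cnj z \<in> unit_disc" "1 / cnj z \<noteq> 0" using z0 by (auto simp: unit_disc_def norm_divide)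
      then have "D (1 / cnj z) \<noteq> 0" by (rule D_nz)
      then show False using sym[OF z0] Dz z0 by simp
    qed
  qed
  have "B \<noteq> 0"
  proof
    assume "B = 0"
    then have "poly B 1 = 0" by simp
    then show False using B_root[of 1] by simp
  qed
  obtain b d where b: "b \<noteq> 0" "B = monom b d" using poly_only_root_0[OF \<open>B \<noteq> 0\<close> B_root] by blast
  \<comment> \<open>The degree comes from comparing moduli at the mirror points 2 and 1/2: |Q 2| =
    4^N |Q (1/2)| and |D (1/2)| = 4 |D 2| give 4^(d+1) = 4^N.\<close>
  have "d + 1 = N"
  proof -
    have half: "1/2 \<in> unit_disc" by (simp add: unit_disc_def norm_divide)
    have n2: "1 - \<alpha> j * 2 \<noteq> 0" if "j < N" for j
    proof
      assume "1 - \<alpha> j * 2 = 0"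
      then have "norm (\<alpha> j * 2) = 1" by simp
      then show False using \<alpha>[OF that] by (simp add: norm_mult)
    qed
    have B2: "b * 2 ^ d = Q 2 * D 2" and B12: "b * (1/2) ^ d = Q (1/2) * D (1/2)"
      using BD[OF n2] BD[OF nz[OF _ half]] unfolding b(2) poly_monom by auto
    have Qn: "norm (Q 2) = 4 ^ N * norm (Q (1/2))"
    proof -
      have "norm (1 - \<alpha> j * 2) = 2 * norm (1 - \<alpha> j * (1/2))" if "j < N" for j
      proof -
        have "cnj (\<alpha> j) * \<alpha> j = 1" using \<alpha>[OF that] by (simp add: complex_norm_square[symmetric] mult.commute)
        then have "cnj (1 - \<alpha> j * 2) * \<alpha> j = \<alpha> j - 2" by (simp add: algebra_simps)
        then have "norm (cnj (1 - \<alpha> j * 2) * \<alpha> j) = norm (\<alpha> j - 2)" by simp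
        then have "norm (1 - \<alpha> j * 2) = norm (\<alpha> j - 2)" using \<alpha>[OF that] by (simp only: norm_mult complex_mod_cnj mult_1_right)
        also have "\<alpha> j - 2 = - 2 * (1 - \<alpha> j * (1/2))" by simp
        finally show ?thesis by (simp only: norm_mult norm_minus_cancel) simp
      qed
      then have "norm (Q 2) = (\<Prod>i<N. 4 * norm ((1 - \<alpha> i * (1/2)) ^ 2))"
        unfolding Q_def prod_norm[symmetric] by (intro prod.cong refl) (simp add: norm_power power_mult_distrib)
      then show ?thesis unfolding Q_def prod_norm[symmetric] by (simp add: prod.distrib)
    qed
    have "norm ((1/2) * D (1/2)) = norm (2 * D 2)" using sym[of 2] by (metis complex_cnj_numeral complex_mod_cnj zero_neq_numeral)
    then have Dn: "norm (D (1/2)) = 4 * norm (D 2)" by (simp add: norm_mult norm_divide)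
    have "norm b * 2 ^ d = norm (Q 2) * norm (D 2)"
      using arg_cong[OF B2, of norm] by (simp add: norm_mult norm_power)
    moreover have "norm b * (1/2) ^ d = norm (Q (1/2)) * norm (D (1/2))"
      using arg_cong[OF B12, of norm] by (simp add: norm_mult norm_power norm_divide power_divide)
    ultimately have "4 * (norm b * 2 ^ d) = 4 ^ N * (norm b * (1/2) ^ d)"
      unfolding Qn Dn by simp
    then have "(4::real) * 2 ^ d = 4 ^ N * (1/2) ^ d" using b(1) by simp
    then have "(4::real) * (2 ^ d * 2 ^ d) = 4 ^ N" by (simp add: power_divide field_simps)
    then have "(4::real) ^ (d + 1) = 4 ^ N" by (simp flip: power_mult_distrib)
    then show ?thesis by (subst (asm) power_inject_exp) auto
  qed
  then have B: "B = monom b (N - 1)" using b(2) by (metis add_diff_cancel_right')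
  define H where "H = (\<lambda>z. 2 * b / Q z)"
  have H: "H holomorphic_on unit_disc"
    unfolding H_def using Q_nz nz by (auto simp: Q_def intro!: holomorphic_intros)
  have Pk: "tcoeff ?P i = 0" if i: "1 \<le> i" "i \<le> N - 1" for i
  proof -
    have "tcoeff (deriv ?P) (i - 1) = tcoeff (\<lambda>z. z ^ (N - 1) * H z) (i - 1)"
    proof (rule tcoeff_cong)
      fix z assume z: "z \<in> unit_disc"
      have "deriv ?P z = 2 * D z" by (rule DERIV_imp_deriv[OF P_deriv[OF z]])
      moreover have "b * z ^ (N - 1) = Q z * D z" using BD[of z] nz z by (simp add: B poly_monom)
      moreover have "Q z \<noteq> 0" using Q_nz nz z by blast
      ultimately show "deriv ?P z = z ^ (N - 1) * H z" by (simp add: H_def field_simps)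
    qed
    also have "\<dots> = 0" using i by (intro tcoeff_z_power_mult[OF H]) simp
    finally show ?thesis using i by (simp add: tcoeff_deriv[OF P])
  qed
  show ?thesis by (rule exp_gap_zero_converse[OF P frep Pk k])
qed

text \<open>Invariance gives u^k a_k = a_k. Since a_n is nonzero, u^n = 1, and the bound on \<theta>
  leaves only \<theta> = 2 pi / n. Then u is a primitive n-th root of unity, so a_j = 0 for 0 < j <
  n.\<close>

lemma cond1_imp_gap:
  assumes f: "extremal n f" and n: "n \<ge> 1" and c1: "cond1 n f" and j: "1 \<le> j" "j < n"
  shows "tcoeff f j = 0"
proof -
  obtain \<theta> where \<theta>: "0 < \<theta>" "\<theta> < 4 * pi / real n"
    and inv: "\<And>z. z \<in> unit_disc \<Longrightarrow> f (exp (\<i> * of_real \<theta>) * z) = f z"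
    using c1 unfolding cond1_def by blast
  define u where "u = exp (\<i> * of_real \<theta>)"
  have u: "norm u = 1" by (simp add: u_def)
  have fh: "f holomorphic_on unit_disc" using f B0_D(1) by (simp add: extremal_def)
  have fix_coeff: "u ^ k * tcoeff f k = tcoeff f k" for k
    using tcoeff_rotate[OF fh u, of k] tcoeff_cong[of "\<lambda>z. f (u * z)" f k] inv by (simp add: u_def)
  have uk: "u ^ k = exp (\<i> * of_real (real k * \<theta>))" for k
    by (simp add: u_def mult_ac flip: exp_of_nat_mult)
  have one: "\<exists>m::int. real k * \<theta> = 2 * pi * real_of_int m" if "u ^ k = 1" for k
    using that unfolding uk exp_eq_1 by (auto simp: mult_ac)
  have "u ^ n = 1" using fix_coeff[of n] extremal_nonzero_coeff[OF f n] by simp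
  then obtain m :: int where m: "real n * \<theta> = 2 * pi * real_of_int m" using one by blast
  have "0 < 2 * pi * real_of_int m" "2 * pi * real_of_int m < 2 * pi * 2"
    using \<theta> n unfolding m[symmetric] by (auto simp: field_simps)
  then have "0 < real_of_int m" "real_of_int m < 2" by (simp_all add: zero_less_mult_iff)
  then have "m = 1" by linarith
  then have n\<theta>: "real n * \<theta> = 2 * pi" using m by simp
  show ?thesis
  proof (rule ccontr)
    assume "tcoeff f j \<noteq> 0"
    then have "u ^ j = 1" using fix_coeff[of j] by simp
    then obtain m' :: int where m': "real j * \<theta> = 2 * pi * real_of_int m'" using one by blast
    have "0 < real j * \<theta>" "real j * \<theta> < real n * \<theta>" using j \<theta> by (auto intro!: mult_strict_right_mono)
    then have "0 < 2 * pi * real_of_int m'" "2 * pi * real_of_int m' < 2 * pi * 1" unfolding m' n\<theta> by auto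
    then have "0 < real_of_int m'" "real_of_int m' < 1" by (simp_all add: zero_less_mult_iff)
    then have "0 < m'" "m' < 1" by simp_all
    then show False by linarith
  qed
qed

section \<open>Extremal functions under the Krzyz conjecture\<close>

text \<open>A normalized rotation of f is f_n; rotating back by \<open>cnj u\<close> puts a
  unimodular factor in front of z^n.\<close>

lemma extremal_imp_rotated_krzyz_fn:
  assumes K: krzyz_conjecture and f: "extremal n f" and n: "n \<ge> 1"
  obtains \<gamma> b where "norm \<gamma> = 1" "norm b = 1"
    "\<And>z. z \<in> unit_disc \<Longrightarrow> f z = \<gamma> * exp (- ((1 + b * z ^ n) / (1 - b * z ^ n)))"
proof -
  obtain u where u: "norm u = 1" and ext: "extremal n (\<lambda>z. cnj (u ^ n) * f (u * z))"
    and norm: "normalized (\<lambda>z. cnj (u ^ n) * f (u * z))"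
    using extremal_normalize[OF f n] by blast
  have eq: "cnj (u ^ n) * f (u * z) = krzyz_fn n z" if "z \<in> unit_disc" for z
    using K ext norm n that unfolding krzyz_conjecture_iff by blast
  have uu: "u ^ n * cnj (u ^ n) = 1" "u * cnj u = 1"
    using u by (simp_all only: complex_norm_square[symmetric] norm_power) simp_all
  show ?thesis
  proof (rule that[of "u ^ n" "- (cnj u ^ n)"])
    fix z assume z: "z \<in> unit_disc"
    then have "cnj u * z \<in> unit_disc" using u by (simp add: unit_disc_def norm_mult)
    from eq[OF this] have "cnj (u ^ n) * f (u * (cnj u * z)) = krzyz_fn n (cnj u * z)" .
    then have "cnj (u ^ n) * f z = krzyz_fn n (cnj u * z)"
      using uu(2) by (simp add: mult.assoc[symmetric])
    then have "u ^ n * (cnj (u ^ n) * f z) = u ^ n * krzyz_fn n (cnj u * z)" by simp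
    then have "f z = u ^ n * krzyz_fn n (cnj u * z)" using uu(1) by (simp only: mult.assoc[symmetric] mult_1)
    then show "f z = u ^ n * exp (- ((1 + - (cnj u ^ n) * z ^ n) / (1 - - (cnj u ^ n) * z ^ n)))"
      by (simp add: krzyz_fn_eq power_mult_distrib)
  qed (use u in \<open>simp_all add: norm_power\<close>)
qed

lemma rotated_krzyz_fn_conditions:
  assumes n: "n \<ge> 3" and \<gamma>: "norm \<gamma> = 1" and b: "norm b = 1"
    and f: "\<And>z. z \<in> unit_disc \<Longrightarrow> f z = \<gamma> * exp (- ((1 + b * z ^ n) / (1 - b * z ^ n)))"
  shows "cond1 n f" "cond2 f" "cond3 f" "cond4 f" "cond5 n f"
proof -
  define p where "p = (\<lambda>z. (1 + b * z ^ n) / (1 - b * z ^ n))"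
  have frep: "f z = \<gamma> * exp (- p z)" if "z \<in> unit_disc" for z using f[OF that] by (simp add: p_def)
  have n1: "n \<ge> 1" using n by simp
  have Mb: "(\<lambda>z. (1 + b * z) / (1 - b * z)) holomorphic_on unit_disc"
    using b by (intro holomorphic_Mobius) simp
  have p: "p holomorphic_on unit_disc" unfolding p_def using holomorphic_power_arg[OF Mb n1] .
  have p_coeff: "tcoeff p k = (if n dvd k then if k div n = 0 then 1 else 2 * b ^ (k div n) else 0)" for k
    unfolding p_def using tcoeff_power_arg[OF Mb n1, of k] b by (simp add: tcoeff_Mobius)
  have gap: "tcoeff f j = 0" if j: "1 \<le> j" "j \<le> n - 1" for j
  proof (rule exp_gap_zero_converse[OF p frep _ j])
    fix i assume "1 \<le> i" "i \<le> n - 1"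
    then have "\<not> n dvd i" by (auto dest: dvd_imp_le)
    then show "tcoeff p i = 0" by (simp add: p_coeff)
  qed
  have nz: "1 - b * z ^ n \<noteq> 0" if "z \<in> unit_disc" for z
  proof -
    have "z ^ n \<in> unit_disc" using that n by (simp add: unit_disc_def norm_power power_less_one_iff)
    then show ?thesis using one_minus_mult_nz b by (metis order_refl)
  qed
  show "cond1 n f"
    unfolding cond1_def
  proof (intro exI[of _ "2 * pi / real n"] conjI ballI)
    show "0 < 2 * pi / real n" "2 * pi / real n < 4 * pi / real n" using n by (auto intro: divide_strict_right_mono)
    fix z assume z: "z \<in> unit_disc"
    define u where "u = exp (\<i> * of_real (2 * pi / real n))"
    have "u ^ n = exp (of_nat n * (\<i> * of_real (2 * pi / real n)))" by (simp only: u_def exp_of_nat_mult)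
    also have "of_nat n * (\<i> * of_real (2 * pi / real n)) = 2 * of_real pi * \<i>" using n by simp
    finally have un: "u ^ n = 1" by (simp only: exp_two_pi_i)
    have "u * z \<in> unit_disc" using z by (simp add: unit_disc_def norm_mult u_def)
    then show "f (exp (\<i> * of_real (2 * pi / real n)) * z) = f z"
      using f[of "u * z"] f[OF z] un unfolding u_def[symmetric] by (simp add: power_mult_distrib)
  qed
  show "cond2 f"
    unfolding cond2_def
  proof (intro exI[of _ "\<lambda>z. Ln \<gamma> - p z"] conjI ballI)
    show "(\<lambda>z. Ln \<gamma> - p z) holomorphic_on unit_disc" by (intro holomorphic_intros p)
    fix z assume z: "z \<in> unit_disc"
    have "\<gamma> \<noteq> 0" "b \<noteq> 0" using \<gamma> b by auto
    then show "exp (Ln \<gamma> - p z) = f z" using frep[OF z] by (simp add: exp_diff exp_minus divide_inverse)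
    have "p 0 = 1" using n by (simp add: p_def power_0_left)
    moreover have "p z = 1 \<longleftrightarrow> b * z ^ n = 0" using nz[OF z] by (auto simp: p_def field_simps)
    ultimately show "Ln \<gamma> - p z = Ln \<gamma> - p 0 \<longleftrightarrow> z = 0" using \<open>b \<noteq> 0\<close> n by auto
  qed
  show "cond3 f"
    unfolding cond3_def
  proof (intro ballI)
    fix z assume "z \<in> unit_disc - {0}"
    then have z: "z \<in> unit_disc" "z \<noteq> 0" by auto
    define d where "d = 2 * (b * (of_nat n * z ^ (n - 1))) / (1 - b * z ^ n) ^ 2"
    have "(p has_field_derivative d) (at z)"
      unfolding p_def d_def using nz[OF z(1)]
      by (auto intro!: derivative_eq_intros simp: power2_eq_square) (simp add: algebra_simps)
    then have "((\<lambda>z. \<gamma> * exp (- p z)) has_field_derivative \<gamma> * (exp (- p z) * - d)) (at z)"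
      by (intro DERIV_cmult DERIV_chain2[OF DERIV_exp] DERIV_minus)
    then have "(f has_field_derivative \<gamma> * (exp (- p z) * - d)) (at z)"
      by (rule has_field_derivative_transform_within_open[OF _ open_unit_disc z(1)]) (simp add: frep)
    then have "deriv f z = \<gamma> * (exp (- p z) * - d)" by (rule DERIV_imp_deriv)
    moreover have "d \<noteq> 0" using nz[OF z(1)] z(2) b n by (auto simp: d_def)
    moreover have "\<gamma> \<noteq> 0" using \<gamma> by auto
    ultimately show "deriv f z \<noteq> 0" by simp
  qed
  show "cond5 n f"
    unfolding cond5_def
  proof (intro allI impI)
    fix j :: nat assume j: "1 \<le> j \<and> real j \<le> real_of_int \<lceil>(real n - 2) / 3\<rceil>"
    \<comment> \<open>The ceiling is below (n + 1) / 3, hence j < n.\<close>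
    have "real_of_int \<lceil>(real n - 2) / 3\<rceil> < (real n - 2) / 3 + 1" by linarith
    then have "real j < (real n - 2) / 3 + 1" using j by linarith
    then have "3 * real j < real n + 1" by (simp add: field_simps)
    then have "j < n" using j by linarith
    then show "tcoeff f j = 0" using j by (intro gap) auto
  qed
  show "cond4 f"
    unfolding cond4_def
  proof (intro allI impI)
    \<comment> \<open>\<open>cond4\<close> ranges over all atom representations of f, so N <= n is
      derived for an arbitrary one.\<close>
    fix N j assume atoms: "has_atoms f N" and j: "1 \<le> j \<and> j \<le> N - 1"
    from atoms obtain \<gamma>' lam \<alpha> where N: "1 \<le> N" and \<gamma>': "norm \<gamma>' = 1" and lam: "\<And>j. j < N \<Longrightarrow> lam j > 0"
      and \<alpha>: "\<And>j. j < N \<Longrightarrow> norm (\<alpha> j) = 1" and inj: "inj_on \<alpha> {..<N}"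
      and frep': "\<And>z. z \<in> unit_disc \<Longrightarrow> f z = \<gamma>' * exp (- atom_exponent N lam \<alpha> z)"
      by (rule has_atomsE) blast
    have P: "atom_exponent N lam \<alpha> holomorphic_on unit_disc" by (rule holomorphic_atom_exponent[OF lam \<alpha>])
    have f0: "f 0 \<noteq> 0" using frep[of 0] \<gamma> by auto
    have "norm (f 0) = exp (- 1)" using f[of 0] \<gamma> n by (simp add: norm_mult power_0_left)
    moreover have "norm (f 0) = exp (- (\<Sum>j<N. lam j))" using frep'[of 0] \<gamma>' by (simp add: norm_mult atom_exponent_0[OF lam \<alpha>])
    ultimately have sum1: "(\<Sum>j<N. lam j) = 1" by simp
    \<comment> \<open>The gap up to n - 1 makes a_n linear in either exponent, so both exponents
      have the same n-th coefficient.\<close>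
    have lin: "tcoeff f n = - f 0 * tcoeff q n" if "q holomorphic_on unit_disc"
      "\<And>z. z \<in> unit_disc \<Longrightarrow> f z = c * exp (- q z)" for q c
      by (rule tcoeff_exp_gap_linear[OF that f0 gap]) (use n in auto)
    have "tcoeff (atom_exponent N lam \<alpha>) n = tcoeff p n"
      using lin[OF P frep'] lin[OF p frep] f0 by simp
    then have mom: "moment N lam \<alpha> n = b"
      using n tcoeff_atom_exponent[where N = N and k = n, OF lam \<alpha>] by (simp add: p_coeff)
    \<comment> \<open>Total mass 1 and an n-th moment b of modulus 1 give a weighted sum of
      |\<alpha>^n - b|^2 equal to 2 - 2 = 0. So all nodes are among the n roots of z^n = b.\<close>
    have "\<alpha> i ^ n = b" if i: "i < N" for i
    proof -
      have node: "of_real (lam j * (norm (\<alpha> j ^ n - b))\<^sup>2) =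
          2 * of_real (lam j) - of_real (lam j) * \<alpha> j ^ n * cnj b - cnj (of_real (lam j) * \<alpha> j ^ n) * b" if "j < N" for j
      proof -
        have 1: "\<alpha> j ^ n * cnj (\<alpha> j ^ n) = 1" "b * cnj b = 1"
          using \<alpha>[OF that] b by (simp_all only: complex_norm_square[symmetric] norm_power) simp_all
        have "of_real ((norm (\<alpha> j ^ n - b))\<^sup>2) = (\<alpha> j ^ n - b) * cnj (\<alpha> j ^ n - b)" by (rule complex_norm_square)
        also have "\<dots> = \<alpha> j ^ n * cnj (\<alpha> j ^ n) + b * cnj b - \<alpha> j ^ n * cnj b - cnj (\<alpha> j ^ n) * b"
          by (simp add: algebra_simps)
        also have "\<dots> = 2 - \<alpha> j ^ n * cnj b - cnj (\<alpha> j ^ n) * b" unfolding 1 by simp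
        finally have "of_real (lam j * (norm (\<alpha> j ^ n - b))\<^sup>2) = of_real (lam j) * (2 - \<alpha> j ^ n * cnj b - cnj (\<alpha> j ^ n) * b)"
          by (simp only: of_real_mult)
        then show ?thesis by (simp add: algebra_simps)
      qed
      have "of_real (\<Sum>j<N. lam j * (norm (\<alpha> j ^ n - b))\<^sup>2) =
          (\<Sum>j<N. 2 * of_real (lam j) - of_real (lam j) * \<alpha> j ^ n * cnj b - cnj (of_real (lam j) * \<alpha> j ^ n) * b)"
        unfolding of_real_sum by (intro sum.cong refl) (simp only: node lessThan_iff)
      also have "\<dots> = 2 * of_real (\<Sum>j<N. lam j) - moment N lam \<alpha> n * cnj b - cnj (moment N lam \<alpha> n) * b"
        by (simp only: sum_subtractf sum_distrib_left[symmetric] sum_distrib_right[symmetric] moment_def cnj_sum of_real_sum)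
      also have "\<dots> = 2 - 2 * (b * cnj b)" unfolding mom sum1 by (simp add: mult.commute)
      also have "b * cnj b = 1" using b by (simp add: complex_norm_square[symmetric])
      finally have "complex_of_real (\<Sum>j<N. lam j * (norm (\<alpha> j ^ n - b))\<^sup>2) = of_real 0"
        by (simp only: mult_1_right diff_self of_real_0)
      then have "(\<Sum>j<N. lam j * (norm (\<alpha> j ^ n - b))\<^sup>2) = 0" by (simp only: of_real_eq_iff)
      moreover have "\<And>j. j \<in> {..<N} \<Longrightarrow> 0 \<le> lam j * (norm (\<alpha> j ^ n - b))\<^sup>2" using lam by (simp add: less_imp_le)
      ultimately have "lam i * (norm (\<alpha> i ^ n - b))\<^sup>2 = 0"
        using sum_nonneg_eq_0_iff[of "{..<N}" "\<lambda>j. lam j * (norm (\<alpha> j ^ n - b))\<^sup>2"] i by simp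
      then show ?thesis using lam[OF i] by simp
    qed
    then have "\<alpha> ` {..<N} \<subseteq> {z. z ^ n = b}" by auto
    then have "card (\<alpha> ` {..<N}) \<le> card {z. z ^ n = b}"
      using n by (intro card_mono finite_nth_roots) auto
    moreover have "card {z. z ^ n = b} = n" using b n by (intro card_nth_roots) auto
    ultimately have "N \<le> n" by (simp add: card_image[OF inj])
    then show "tcoeff f j = 0" using j by (intro gap) auto
  qed
qed

text \<open>For n = 1 and n = 2 the range 1 <= j <= n div 3 is empty, so indices n >= 3
  suffice.\<close>

lemma krzyz_conjecture_if_gaps:
  assumes "\<And>n f j. n \<ge> 3 \<Longrightarrow> extremal n f \<Longrightarrow> 1 \<le> j \<Longrightarrow> j \<le> n div 3 \<Longrightarrow> tcoeff f j = 0"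
  shows krzyz_conjecture
  unfolding krzyz_conjecture_iff
proof (intro allI impI ballI)
  fix n :: nat and f z
  assume n: "1 \<le> n" and f: "extremal n f" and norm: "normalized f" and z: "z \<in> unit_disc"
  show "f z = krzyz_fn n z"
  proof (rule extremal_gap_imp_krzyz_fn[OF f norm n _ z])
    fix j assume j: "1 \<le> j" "j \<le> n div 3"
    then have "n \<ge> 3" by linarith
    then show "tcoeff f j = 0" using assms f j by blast
  qed
qed

theorem theorem4:
  shows "(krzyz_conjecture \<longleftrightarrow> (\<forall>n\<ge>3. \<forall>f. extremal n f \<longrightarrow> cond1 n f)) \<and>
         (krzyz_conjecture \<longleftrightarrow> (\<forall>n\<ge>3. \<forall>f. extremal n f \<longrightarrow> cond2 f)) \<and>
         (krzyz_conjecture \<longleftrightarrow> (\<forall>n\<ge>3. \<forall>f. extremal n f \<longrightarrow> cond3 f)) \<and>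
         (krzyz_conjecture \<longleftrightarrow> (\<forall>n\<ge>3. \<forall>f. extremal n f \<longrightarrow> cond4 f)) \<and>
         (krzyz_conjecture \<longleftrightarrow> (\<forall>n\<ge>3. \<forall>f. extremal n f \<longrightarrow> cond5 n f))"
proof -
  have forward: "cond1 n f \<and> cond2 f \<and> cond3 f \<and> cond4 f \<and> cond5 n f"
    if K: krzyz_conjecture and n: "n \<ge> 3" and f: "extremal n f" for n f
  proof -
    have "n \<ge> 1" using n by simp
    from extremal_imp_rotated_krzyz_fn[OF K f this] obtain \<gamma> b where "norm \<gamma> = 1" "norm b = 1"
      "\<And>z. z \<in> unit_disc \<Longrightarrow> f z = \<gamma> * exp (- ((1 + b * z ^ n) / (1 - b * z ^ n)))" by blast
    from rotated_krzyz_fn_conditions[OF n this] show ?thesis by blast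
  qed
  \<comment> \<open>The common route for conditions (2), (3) and (4): vanishing coefficients below
    the number of atoms.\<close>
  have full_gap: krzyz_conjecture
    if "\<And>n f N j. n \<ge> 3 \<Longrightarrow> extremal n f \<Longrightarrow> has_atoms f N \<Longrightarrow> 1 \<le> j \<Longrightarrow> j \<le> N - 1 \<Longrightarrow> tcoeff f j = 0"
  proof (rule krzyz_conjecture_if_gaps)
    fix n f j assume n: "3 \<le> n" and f: "extremal n f" and j: "1 \<le> j" "j \<le> n div 3"
    have n1: "n \<ge> 1" using n by simp
    obtain N where N: "has_atoms f N" using extremal_has_atoms[OF f n1] .
    show "tcoeff f j = 0"
      by (rule extremal_full_gap[OF f n1 N _ j]) (rule that[OF n f N])
  qed
  have back1: krzyz_conjecture if "\<forall>n\<ge>3. \<forall>f. extremal n f \<longrightarrow> cond1 n f"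
  proof (rule krzyz_conjecture_if_gaps)
    fix n f j assume n: "3 \<le> n" and f: "extremal n f" and j: "1 \<le> j" "j \<le> n div 3"
    have "n \<ge> 1" "j < n" using n j by auto
    then show "tcoeff f j = 0" using cond1_imp_gap[OF f] that n f j by blast
  qed
  have back2: krzyz_conjecture if "\<forall>n\<ge>3. \<forall>f. extremal n f \<longrightarrow> cond2 f"
    by (rule full_gap) (use that cond2_imp_full_gap in blast)
  have back3: krzyz_conjecture if "\<forall>n\<ge>3. \<forall>f. extremal n f \<longrightarrow> cond3 f"
    by (rule full_gap) (use that cond3_imp_full_gap in blast)
  have back4: krzyz_conjecture if "\<forall>n\<ge>3. \<forall>f. extremal n f \<longrightarrow> cond4 f"
    by (rule full_gap) (use that in \<open>unfold cond4_def, blast\<close>)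
  have back5: krzyz_conjecture if "\<forall>n\<ge>3. \<forall>f. extremal n f \<longrightarrow> cond5 n f"
  proof (rule krzyz_conjecture_if_gaps)
    fix n f j assume n: "3 \<le> n" and f: "extremal n f" and j: "1 \<le> (j::nat)" "j \<le> n div 3"
    \<comment> \<open>The ceiling of (n - 2) / 3 reaches n div 3, so \<open>cond5\<close> covers the
      whole required gap.\<close>
    have "real (n div 3) \<le> real_of_int \<lceil>(real n - 2) / 3\<rceil>"
    proof -
      have "real (3 * (n div 3)) \<le> real n" by (rule of_nat_mono) simp
      then have "real_of_int (int (n div 3) - 1) < (real n - 2) / 3" by (simp add: field_simps)
      then have "int (n div 3) - 1 < \<lceil>(real n - 2) / 3\<rceil>" by (simp only: less_ceiling_iff)
      then show ?thesis by linarith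
    qed
    then have "real j \<le> real_of_int \<lceil>(real n - 2) / 3\<rceil>" using j by linarith
    then show "tcoeff f j = 0" using that n f j unfolding cond5_def by blast
  qed
  show ?thesis
    using forward back1 back2 back3 back4 back5 by blast
qed

end
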